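(* Let $Q\in C^\infty(\Omega)$ be a nonzero real-valued function on the compact star graph $\Omega$ with $\int_\Omega Q\,d\Omega=0$. Then for every $k>0$ and every $\alpha\in\mathbb{R}$, the scattering matrix at momentum $k$ for the pair of operators $\mathrm{H}_\varepsilon(\alpha,Q)$ and $\mathrm{H}_0$ converges, as $\varepsilon\to 0^+$, to the scattering matrix at momentum $k$ for the pair $\mathrm{H}(\alpha,Q)$ and $\mathrm{H}_0$. That is, $T^{\varepsilon}_{nm}(k,\alpha)\to T_{nm}(k,\alpha)$ as $\varepsilon\to0^+$ for all $n,m\in\{1,2,3\}$.
   Context: **Graphs.** $\Gamma$ is the noncompact star graph with three half-line edges $\gamma_1,\gamma_2,\gamma_3$ joined at the vertex $a$. Each $\gamma_j$ is parametrized by arc length $s\in(0,\infty)$, with $s=0$ corresponding to $a$. $\Omega$ is the compact star graph with center $b$ and three edges $\omega_1,\omega_2,\omega_3$ of length 1, where $\omega_j$ joins $b$ to a vertex $a_j$ and is parametrized by arc length $s\in[0,1]$, with $s=0$ at $b$ and $s=1$ at $a_j$. For a function $f$ on a graph, $f_g$ is its restriction to the edge $g$, and $\frac{df}{dg}(v)$ is the derivative of $f_g$ at an endpoint $v$ of $g$, taken in the direction away from the vertex $v$ (so $\frac{dg}{d\omega_j}(b)=g_{\omega_j}'(0)$ and $\frac{dg}{d\omega_j}(a_j)=-g_{\omega_j}'(1)$). $C^\infty(\Omega)$ is the set of functions whose restriction to each closed edge is $C^\infty$ (no condition at the vertices). $\int_\Omega$ is the sum of the integrals over the edges. **Regularized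 operator.** For $\varepsilon>0$ let $Q_\varepsilon$ be the function on $\Gamma$ given on $\gamma_j$ by $Q_\varepsilon(s)=\varepsilon^{-2}Q_{\omega_j}(s/\varepsilon)$ for $0<s<\varepsilon$ and $Q_\varepsilon(s)=0$ for $s>\varepsilon$. The operator $\mathrm{H}_\varepsilon(\alpha,Q)$ in $L_2(\Gamma)$ acts by $f\mapsto -f''+\alpha Q_\varepsilon f$ on those $f\in L_2(\Gamma)$ such that $f,f'$ are absolutely continuous on each edge $\gamma_j$, $-f''+\alpha Q_\varepsilon f\in L_2(\Gamma)$, and at $a$ the Kirchhoff conditions $f_{\gamma_1}(a)=f_{\gamma_2}(a)=f_{\gamma_3}(a)$, $\sum_{j=1}^3\frac{df}{d\gamma_j}(a)=0$ hold. $\mathrm{H}_0$ is the free Hamiltonian: $f\mapsto -f''$ on functions that are $H^2$ on each edge and satisfy the Kirchhoff conditions at $a$. **Resonant set and coupling function.** Consider the eigenvalue problem with spectral parameter $\alpha$: $$-g''+\alpha Qg=0 \text{ on each edge of }\Omega,\quad g_{\omega_1}(b)=g_{\omega_2}(b)=g_{\omega_3}(b),\quad \sum_{j=1}^3\frac{dg}{d\omega_j}(b)=0,\quad \frac{dg}{d\omega_j}(a_j)=0\ (j=1,2,3).$$ The resonant set $\Sigma\subset\mathbb{R}$ is the set of $\alpha$ for which a nonzero solution $g$ (eigenfunction) exists. The eigenspaces have dimension 1 or 2. $\Sigma_1$ is the set of simple eigenvalues (eigenspace of dimension 1) and $\Sigma_2$ the set of double eigenvalues (eigenspace of dimension 2),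 so $\Sigma=\Sigma_1\cup\Sigma_2$. For $\alpha\in\Sigma_1$ choose a real eigenfunction $u_\alpha$ with $u_\alpha^2(a_1)+u_\alpha^2(a_2)+u_\alpha^2(a_3)=1$ and put $\theta_j(\alpha)=u_\alpha(a_j)$, $j=1,2,3$. For $\alpha\in\Sigma_2$ choose a real basis $v_\alpha,w_\alpha$ of the eigenspace and let $(\theta_1(\alpha),\theta_2(\alpha),\theta_3(\alpha))$ be the cross product of the vectors $(v_\alpha(a_1),v_\alpha(a_2),v_\alpha(a_3))$ and $(w_\alpha(a_1),w_\alpha(a_2),w_\alpha(a_3))$, the basis being normalized so that $\theta_1^2(\alpha)+\theta_2^2(\alpha)+\theta_3^2(\alpha)=1$. In both cases $\theta(\alpha)=(\theta_1(\alpha),\theta_2(\alpha),\theta_3(\alpha))$ is determined up to sign. **Limit operator.** $\mathrm{H}(\alpha,Q)$ acts by $\psi\mapsto-\psi''$ on functions that are $H^2$ on each edge of $\Gamma$ and satisfy the following conditions at $a$: - if $\alpha\notin\Sigma$: $\psi_{\gamma_1}(a)=\psi_{\gamma_2}(a)=\psi_{\gamma_3}(a)=0$ (Dirichlet); - if $\alpha\in\Sigma_1$: the vector $(\psi_{\gamma_1}(a),\psi_{\gamma_2}(a),\psi_{\gamma_3}(a))$ is a scalar multiple of $\theta(\alpha)$, and $\sum_{j=1}^3\theta_j(\alpha)\frac{d\psi}{d\gamma_j}(a)=0$; - if $\alpha\in\Sigma_2$: the vector $\big(\frac{d\psi}{d\gamma_1}(a),\frac{d\psi}{d\gamma_2}(a),\frac{d\psi}{d\gamma_3}(a)\big)$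 is a scalar multiple of $\theta(\alpha)$, and $\sum_{j=1}^3\theta_j(\alpha)\psi_{\gamma_j}(a)=0$. **Scattering matrices.** Fix $k>0$. The scattering matrix for $\mathrm{H}(\alpha,Q)$ and $\mathrm{H}_0$ is the $3\times3$ matrix $(T_{nm}(k,\alpha))$ such that, for each $n$, the function $\psi_n$ on $\Gamma$ equal to $T_{nm}e^{iks}$ on $\gamma_m$ for $m\ne n$ and to $e^{-iks}+T_{nn}e^{iks}$ on $\gamma_n$ satisfies the vertex conditions at $a$ of $\mathrm{H}(\alpha,Q)$. The scattering matrix for $\mathrm{H}_\varepsilon(\alpha,Q)$ and $\mathrm{H}_0$ is the $3\times 3$ matrix $(T^\varepsilon_{nm}(k,\alpha))$ such that, for each $n$, there is a function $y$ on $\Gamma$ with $y,y'$ locally absolutely continuous on each edge (in particular continuous at $s=\varepsilon$), satisfying $-y''+\alpha Q_\varepsilon y=k^2y$ (almost everywhere) on each edge and the Kirchhoff conditions at $a$, and equal for $s\ge\varepsilon$ to $T^\varepsilon_{nm}e^{iks}$ on $\gamma_m$ for $m\neq n$ and to $e^{-iks}+T^\varepsilon_{nn}e^{iks}$ on $\gamma_n$. These conditions determine the coefficients $T_{nm}$ and $T^\varepsilon_{nm}$ uniquely. *)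

theory Defs
  imports "HOL-Analysis.Analysis" "HOL-Library.Function_Algebras"
begin

text \<open>
  A function on a star graph with three edges is a family, indexed by the type \<^typ>\<open>3\<close>, of functions of
  the arc length measured from the centre.  Edges of \<open>\<Omega>\<close> are \<open>{0..1}\<close>, with \<open>0\<close> the centre \<open>b\<close> and
  \<open>1\<close> the outer vertex \<open>a\<^sub>j\<close>; edges of \<open>\<Gamma>\<close> are \<open>{0..}\<close>, with \<open>0\<close> the vertex \<open>a\<close>.
  Values outside these sets are irrelevant, and so is the value of \<open>Q\<^sub>\<epsilon>\<close> at \<open>s = 0\<close> and \<open>s = \<epsilon>\<close>.
\<close>

type_synonym 'a star_fun = "3 \<Rightarrow> real \<Rightarrow> 'a"

definition smooth_on_Omega :: "real star_fun \<Rightarrow> bool" where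
  "smooth_on_Omega Q \<longleftrightarrow> (\<forall>j. \<exists>D :: nat \<Rightarrow> real \<Rightarrow> real. D 0 = Q j \<and>
     (\<forall>n. \<forall>s\<in>{0..1}. (D n has_real_derivative D (Suc n) s) (at s within {0..1})))"

definition integral_Omega :: "real star_fun \<Rightarrow> real" where
  "integral_Omega Q = (\<Sum>j\<in>UNIV. integral {0..1} (Q j))"

definition kirchhoff :: "(3 \<Rightarrow> complex) \<Rightarrow> (3 \<Rightarrow> complex) \<Rightarrow> bool" where
  "kirchhoff x d \<longleftrightarrow> (\<forall>i j. x i = x j) \<and> (\<Sum>j\<in>UNIV. d j) = 0"

subsection \<open>The resonant set and the coupling function\<close>

definition deriv_b :: "complex star_fun \<Rightarrow> 3 \<Rightarrow> complex" where
  "deriv_b g j = vector_derivative (g j) (at 0 within {0..1})"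

definition deriv_aj :: "complex star_fun \<Rightarrow> 3 \<Rightarrow> complex" where
  "deriv_aj g j = - vector_derivative (g j) (at 1 within {0..1})"

definition resonance_problem :: "real star_fun \<Rightarrow> real \<Rightarrow> complex star_fun \<Rightarrow> bool" where
  "resonance_problem Q \<alpha> g \<longleftrightarrow>
     (\<forall>j. \<exists>g1 g2. \<forall>s\<in>{0..1}.
        (g j has_vector_derivative g1 s) (at s within {0..1}) \<and>
        (g1 has_vector_derivative g2 s) (at s within {0..1}) \<and>
        - g2 s + of_real (\<alpha> * Q j s) * g j s = 0) \<and>
     kirchhoff (\<lambda>j. g j 0) (deriv_b g) \<and>
     (\<forall>j. deriv_aj g j = 0)"

text \<open>
  Each function on \<open>\<Omega>\<close> is represented by its extension by zero, so that equality, linear independence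
  and dimension in the complex vector space of all families are those of functions on \<open>\<Omega>\<close>.
\<close>

definition eigenspace :: "real star_fun \<Rightarrow> real \<Rightarrow> complex star_fun set" where
  "eigenspace Q \<alpha> = {g. resonance_problem Q \<alpha> g \<and> (\<forall>j. \<forall>s. s \<notin> {0..1} \<longrightarrow> g j s = 0)}"

definition star_scale :: "complex \<Rightarrow> complex star_fun \<Rightarrow> complex star_fun" where
  "star_scale c g = (\<lambda>j s. c * g j s)"

global_interpretation star: vector_space star_scale
  by standard (auto simp: star_scale_def fun_eq_iff algebra_simps)

definition resonant_set :: "real star_fun \<Rightarrow> real set" where
  "resonant_set Q = {\<alpha>. \<exists>g \<in> eigenspace Q \<alpha>. g \<noteq> 0}"

definition simple_resonances :: "real star_fun \<Rightarrow> real set" where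
  "simple_resonances Q = {\<alpha> \<in> resonant_set Q. star.dim (eigenspace Q \<alpha>) = 1}"

definition double_resonances :: "real star_fun \<Rightarrow> real set" where
  "double_resonances Q = {\<alpha> \<in> resonant_set Q. star.dim (eigenspace Q \<alpha>) = 2}"

definition real_star :: "real star_fun \<Rightarrow> complex star_fun" where
  "real_star u = (\<lambda>j s. of_real (u j s))"

definition outer_values :: "real star_fun \<Rightarrow> real ^ 3" where
  "outer_values u = (\<chi> j. u j 1)"

definition simple_coupling :: "real star_fun \<Rightarrow> real \<Rightarrow> real ^ 3 \<Rightarrow> bool" where
  "simple_coupling Q \<alpha> \<theta> \<longleftrightarrow>
     (\<exists>u. real_star u \<in> eigenspace Q \<alpha> \<and> real_star u \<noteq> 0 \<and>
          \<theta> = outer_values u \<and> norm \<theta> = 1)"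

definition double_coupling :: "real star_fun \<Rightarrow> real \<Rightarrow> real ^ 3 \<Rightarrow> bool" where
  "double_coupling Q \<alpha> \<theta> \<longleftrightarrow>
     (\<exists>v w. real_star v \<noteq> real_star w \<and>
          star.independent {real_star v, real_star w} \<and>
          star.span {real_star v, real_star w} = eigenspace Q \<alpha> \<and>
          \<theta> = cross3 (outer_values v) (outer_values w) \<and> norm \<theta> = 1)"

text \<open>
  The vector \<open>\<theta>(\<alpha>)\<close> is determined only up to sign; the vertex conditions below do not depend on the
  sign.  It is unspecified for non-resonant \<open>\<alpha>\<close>, where it is not used.
\<close>

definition coupling_vector :: "real star_fun \<Rightarrow> real \<Rightarrow> real ^ 3" where
  "coupling_vector Q \<alpha> =
     (SOME \<theta>. (\<alpha> \<in> simple_resonances Q \<longrightarrow> simple_coupling Q \<alpha> \<theta>) \<and>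
              (\<alpha> \<in> double_resonances Q \<longrightarrow> double_coupling Q \<alpha> \<theta>))"

subsection \<open>The limit operator\<close>

definition deriv_a :: "complex star_fun \<Rightarrow> 3 \<Rightarrow> complex" where
  "deriv_a \<psi> j = vector_derivative (\<psi> j) (at 0 within {0..})"

definition limit_vertex_conditions :: "real star_fun \<Rightarrow> real \<Rightarrow> complex star_fun \<Rightarrow> bool" where
  "limit_vertex_conditions Q \<alpha> \<psi> \<longleftrightarrow>
     (let \<theta> = coupling_vector Q \<alpha> in
       (\<alpha> \<notin> resonant_set Q \<longrightarrow> (\<forall>j. \<psi> j 0 = 0)) \<and>
       (\<alpha> \<in> simple_resonances Q \<longrightarrow>
          (\<exists>c. \<forall>j. \<psi> j 0 = c * of_real (\<theta> $ j)) \<and>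
          (\<Sum>j\<in>UNIV. of_real (\<theta> $ j) * deriv_a \<psi> j) = 0) \<and>
       (\<alpha> \<in> double_resonances Q \<longrightarrow>
          (\<exists>c. \<forall>j. deriv_a \<psi> j = c * of_real (\<theta> $ j)) \<and>
          (\<Sum>j\<in>UNIV. of_real (\<theta> $ j) * \<psi> j 0) = 0))"

subsection \<open>The regularized operator\<close>

definition Q_eps :: "real star_fun \<Rightarrow> real \<Rightarrow> real star_fun" where
  "Q_eps Q \<epsilon> j s = (if 0 < s \<and> s < \<epsilon> then Q j (s / \<epsilon>) / \<epsilon>\<^sup>2 else 0)"

definition abs_continuous_on_interval :: "real \<Rightarrow> real \<Rightarrow> (real \<Rightarrow> complex) \<Rightarrow> bool" where
  "abs_continuous_on_interval p q f \<longleftrightarrow>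
     (\<forall>e>0. \<exists>d>0. \<forall>I :: (real \<times> real) set.
        finite I \<and> (\<forall>(u, v)\<in>I. p \<le> u \<and> u \<le> v \<and> v \<le> q) \<and>
        pairwise (\<lambda>x y. {fst x<..<snd x} \<inter> {fst y<..<snd y} = {}) I \<and>
        (\<Sum>(u, v)\<in>I. v - u) < d
        \<longrightarrow> (\<Sum>(u, v)\<in>I. norm (f v - f u)) < e)"

text \<open>
  On a half-line edge, locally absolutely continuous means absolutely continuous on \<open>[0,R]\<close> for every
  \<open>R > 0\<close>; in particular the values and the derivatives at the vertex exist.
\<close>

definition regularized_solution ::
    "real star_fun \<Rightarrow> real \<Rightarrow> real \<Rightarrow> real \<Rightarrow> complex star_fun \<Rightarrow> bool" where
  "regularized_solution Q \<alpha> \<epsilon> k y \<longleftrightarrow>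
     (\<forall>j. \<exists>y1.
        (\<forall>s\<ge>0. (y j has_vector_derivative y1 s) (at s within {0..})) \<and>
        (\<forall>R>0. abs_continuous_on_interval 0 R (y j) \<and> abs_continuous_on_interval 0 R y1) \<and>
        (AE s in lebesgue. s > 0 \<longrightarrow>
           (\<exists>y2. (y1 has_vector_derivative y2) (at s) \<and>
                 - y2 + of_real (\<alpha> * Q_eps Q \<epsilon> j s) * y j s = of_real (k\<^sup>2) * y j s))) \<and>
     kirchhoff (\<lambda>j. y j 0) (deriv_a y)"

subsection \<open>Scattering matrices\<close>

definition scattered_wave :: "real \<Rightarrow> complex ^ 3 ^ 3 \<Rightarrow> 3 \<Rightarrow> complex star_fun" where
  "scattered_wave k T n m s =
     (if m = n then exp (- (\<i> * of_real (k * s))) + T $ n $ n * exp (\<i> * of_real (k * s))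
      else T $ n $ m * exp (\<i> * of_real (k * s)))"

definition scattering_matrix :: "real star_fun \<Rightarrow> real \<Rightarrow> real \<Rightarrow> complex ^ 3 ^ 3" where
  "scattering_matrix Q \<alpha> k =
     (THE T. \<forall>n. limit_vertex_conditions Q \<alpha> (scattered_wave k T n))"

definition scattering_matrix_eps ::
    "real star_fun \<Rightarrow> real \<Rightarrow> real \<Rightarrow> real \<Rightarrow> complex ^ 3 ^ 3" where
  "scattering_matrix_eps Q \<alpha> \<epsilon> k =
     (THE T. \<forall>n. \<exists>y. regularized_solution Q \<alpha> \<epsilon> k y \<and>
                     (\<forall>m. \<forall>s\<ge>\<epsilon>. y m s = scattered_wave k T n m s))"

end

theory Submission
  imports Defs
begin

text \<open>
  Rescaling \<open>[0,\<epsilon>]\<close> to \<open>[0,1]\<close> turns the scattering problem into \<open>u'' = (\<alpha> Q - \<kappa>\<^sup>2) u\<close> on \<open>\<Omega>\<close>, with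
  \<open>\<kappa> = \<epsilon> k\<close>, Kirchhoff conditions at the centre, and outer data \<open>u = r + e\<close>, \<open>u' = \<i> \<kappa> (r - e)\<close>, where \<open>e\<close> is
  the incoming and \<open>r\<close> the outgoing amplitude.  Let \<open>V\<close> be the space of outer values of the solutions with
  \<open>\<kappa> = 0\<close> and Neumann data.  Conservation of the current bounds \<open>r\<close>; a Gronwall estimate shows that
  \<open>r + e\<close> is within \<open>O(\<kappa>)\<close> of \<open>V\<close>; Green's formula shows that \<open>r - e\<close> is orthogonal to \<open>V\<close> up to \<open>O(\<kappa>)\<close>.
  In all three cases the vertex conditions of the limit operator say that the boundary values lie in
  \<open>V\<close> and the boundary derivatives are orthogonal to \<open>V\<close>, so the limit row is the reflection
  \<open>2 P e - e\<close> with \<open>P\<close> the projection onto \<open>V\<close>, and \<open>r\<close> converges to it.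
\<close>

subsection \<open>Absolutely continuous functions\<close>

text \<open>Both matrices are definite descriptions, so existence and uniqueness of the coefficients
  have to be settled before any limit can be taken. For positive \<open>\<epsilon>\<close>,
  uniqueness is the current identity without incoming wave, and existence follows from it because
  the Kirchhoff conditions are three equations for three amplitudes. A competing solution is only
  absolutely continuous with the equation holding almost everywhere, so it must first be upgraded to
  a classical one; this is why the development starts with absolute continuity. Data are prescribed
  at the outer end \<open>s = 1\<close>, where the amplitudes are read off. The potential is real,
  so V is the complexification of a real subspace, and the bilinear pairing of Green's formula
  detects orthogonality to V without conjugation. The final limit extracts no subsequences: the
  approximate conditions say that an injective linear map on a finite-dimensional space sends the
  difference of the rows to something small, and such a map is bounded below.\<close>

text \<open>The gauge argument: tags in the exceptional null set contribute little by absolute continuity,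
  the others by smallness of the difference quotient.\<close>

lemma abs_continuous_zero_derivative:
  fixes f :: "real \<Rightarrow> complex"
  assumes ac: "abs_continuous_on_interval a b f" and ab: "a \<le> b"
    and ae: "AE s in lebesgue. a < s \<and> s < b \<longrightarrow> (f has_vector_derivative 0) (at s)"
  shows "f b = f a"
proof -
  \<comment> \<open>The implication puts both endpoints into \<open>N\<close>, as the hypothesis
    says nothing about the derivative there.\<close>
  define N where "N = {s. (a < s \<and> s < b \<longrightarrow> \<not> (f has_vector_derivative 0) (at s))} \<inter> {a..b}"
  have "negligible {s. \<not> (a < s \<and> s < b \<longrightarrow> (f has_vector_derivative 0) (at s))}"
    using ae unfolding eventually_ae_filter negligible_iff_null_sets
    by (auto intro: null_sets_completion_subset)
  then have "negligible ({s. \<not> (a < s \<and> s < b \<longrightarrow> (f has_vector_derivative 0) (at s))} \<union> {a, b})"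
    by (simp add: negligible_Un)
  then have N: "negligible N"
    by (rule negligible_subset) (auto simp: N_def)
  have small: "norm (f b - f a) \<le> e * (1 + (b - a))" if e: "e > 0" for e
  proof -
    obtain d where d: "d > 0" and
      "\<forall>I :: (real \<times> real) set. finite I \<and> (\<forall>(u, v)\<in>I. a \<le> u \<and> u \<le> v \<and> v \<le> b) \<and>
        pairwise (\<lambda>x y. {fst x<..<snd x} \<inter> {fst y<..<snd y} = {}) I \<and>
        (\<Sum>(u, v)\<in>I. v - u) < d \<longrightarrow> (\<Sum>(u, v)\<in>I. norm (f v - f u)) < e"
      using ac[unfolded abs_continuous_on_interval_def, rule_format, OF e] by (elim exE conjE)
    note dI = this(2)[rule_format, OF conjI[OF _ conjI[OF _ conjI]]]
    \<comment> \<open>A gauge for this integral forces the cells tagged in \<open>N\<close> to have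
      total length below \<open>d\<close>, the threshold of absolute continuity.\<close>
    have "((indicator N :: real \<Rightarrow> real) has_integral 0) {a..b}"
      using N unfolding negligible_def by (metis box_real(2))
    then obtain \<gamma> where \<gamma>: "gauge \<gamma>" and
      \<gamma>I: "\<And>p. p tagged_division_of {a..b} \<Longrightarrow> \<gamma> fine p \<Longrightarrow>
        \<bar>\<Sum>(x,k)\<in>p. measure lborel k *\<^sub>R (indicator N x :: real)\<bar> < d"
      unfolding has_integral_real using d by (auto simp del: real_scaleR_def)
    have "\<exists>r>0. \<forall>y. \<bar>y - s\<bar> < r \<longrightarrow> norm (f y - f s) \<le> e * \<bar>y - s\<bar>" if "s \<in> {a..b} - N" for s
    proof -
      have "(f has_derivative (\<lambda>h. h *\<^sub>R 0)) (at s)"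
        using that by (auto simp: N_def has_vector_derivative_def)
      then show ?thesis using e unfolding has_derivative_at_alt by simp
    qed
    then obtain r where r: "\<And>s. s \<in> {a..b} - N \<Longrightarrow> r s > 0"
      "\<And>s y. s \<in> {a..b} - N \<Longrightarrow> \<bar>y - s\<bar> < r s \<Longrightarrow> norm (f y - f s) \<le> e * \<bar>y - s\<bar>"
      by metis
    define \<delta> where "\<delta> s = (if s \<in> {a..b} - N then ball s (r s) else UNIV)" for s
    have "gauge \<delta>" unfolding gauge_def \<delta>_def using r(1) by auto
    then obtain p where p: "p tagged_division_of {a..b}" and fine: "\<gamma> fine p" "\<delta> fine p"
      using fine_division_exists_real[OF gauge_Int[OF \<gamma>], of \<delta> a b] unfolding fine_Int by metis
    have fin: "finite p" using p by auto
    have K: "\<exists>u v. k = {u..v} \<and> u \<le> x \<and> x \<le> v \<and> a \<le> u \<and> v \<le> b" if xk: "(x, k) \<in> p" for x k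
    proof -
      obtain u v where "k = cbox u v"
        using tagged_division_ofD(4)[OF p xk] by blast
      moreover have "x \<in> k" "k \<subseteq> {a..b}"
        using tagged_division_ofD(2,3)[OF p xk] by auto
      ultimately show ?thesis by (intro exI[of _ u] exI[of _ v]) auto
    qed
    define p1 where "p1 = {(x, k) \<in> p. x \<in> N}"
    define p2 where "p2 = {(x, k) \<in> p. x \<notin> N}"
    have pp: "p = p1 \<union> p2" "p1 \<inter> p2 = {}" "finite p1" "finite p2"
      by (auto simp: p1_def p2_def intro!: rev_finite_subset[OF fin])
    define g where "g = (\<lambda>(x :: real, k :: real set). (Inf k, Sup k))"
    have disj: "{Inf k<..<Sup k} \<inter> {Inf k'<..<Sup k'} = {}"
      if "(x, k) \<in> p" "(x', k') \<in> p" "(x, k) \<noteq> (x', k')" for x k x' k'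
      using tagged_division_ofD(5)[OF p that] K[OF that(1)] K[OF that(2)]
      by (auto simp: interior_atLeastAtMost_real)
    \<comment> \<open>Absolute continuity sums over a set of pairs, where cells with equal endpoints
      would be counted once. Distinct tagged cells have disjoint interiors, so equal endpoints force
      a single point, and then the tags agree as well.\<close>
    have inj: "inj_on g p"
    proof (rule inj_onI, clarify, rule ccontr)
      fix x k x' k'
      assume *: "(x, k) \<in> p" "(x', k') \<in> p" "g (x, k) = g (x', k')" "\<not> (x = x' \<and> k = k')"
      obtain u v where k: "k = {u..v}" "u \<le> x" "x \<le> v" using K[OF *(1)] by auto
      obtain u' v' where k': "k' = {u'..v'}" "u' \<le> x'" "x' \<le> v'" using K[OF *(2)] by auto
      have "u = u'" "v = v'" using * k k' by (auto simp: g_def)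
      moreover have "{u<..<v} \<inter> {u'<..<v'} = {}"
        using disj[OF *(1,2)] *(4) k k' by auto
      ultimately have "u = v" using k by (metis Int_absorb greaterThanLessThan_empty_iff order.trans order_antisym)
      then show False using * k k' \<open>u = u'\<close> \<open>v = v'\<close> by auto
    qed
    have c: "measure lborel k = Sup k - Inf k" if "(x, k) \<in> p" for x k
      using K[OF that] by auto
    have "(\<Sum>(u, v)\<in>g ` p1. norm (f v - f u)) < e"
    proof (rule dI)
      show "finite (g ` p1)" using pp by simp
      show "\<forall>(u, v)\<in>g ` p1. a \<le> u \<and> u \<le> v \<and> v \<le> b"
        using K by (force simp: p1_def g_def)
      show "pairwise (\<lambda>x y. {fst x<..<snd x} \<inter> {fst y<..<snd y} = {}) (g ` p1)"
        using disj unfolding pairwise_def p1_def g_def by fastforce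
      have "(\<Sum>(u, v)\<in>g ` p1. v - u) = (\<Sum>(x,k)\<in>p1. Sup k - Inf k)"
        using inj_on_subset[OF inj, of p1] pp
        by (subst sum.reindex) (auto simp: g_def case_prod_unfold)
      also have "\<dots> = (\<Sum>(x,k)\<in>p1. measure lborel k *\<^sub>R (indicator N x :: real))"
        using c by (intro sum.cong) (auto simp: p1_def)
      also have "\<dots> = (\<Sum>(x,k)\<in>p. measure lborel k *\<^sub>R (indicator N x :: real))"
        using fin by (intro sum.mono_neutral_left) (auto simp: p1_def indicator_def)
      also have "\<dots> < d" using \<gamma>I[OF p fine(1)] by linarith
      finally show "(\<Sum>(u, v)\<in>g ` p1. v - u) < d" .
    qed
    then have s1: "(\<Sum>(x,k)\<in>p1. norm (f (Sup k) - f (Inf k))) \<le> e"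
      using inj_on_subset[OF inj, of p1] pp
      by (subst (asm) sum.reindex) (auto simp: g_def case_prod_unfold)
    have "(\<Sum>(x,k)\<in>p2. norm (f (Sup k) - f (Inf k))) \<le> (\<Sum>(x,k)\<in>p2. e * measure lborel k)"
    proof (rule sum_mono, clarify)
      fix x k assume xk: "(x, k) \<in> p2"
      then have xp: "(x, k) \<in> p" "x \<notin> N" by (auto simp: p2_def)
      obtain u v where k: "k = {u..v}" "u \<le> x" "x \<le> v" "a \<le> u" "v \<le> b" using K[OF xp(1)] by auto
      have x: "x \<in> {a..b} - N" using k xp by auto
      have "k \<subseteq> ball x (r x)"
        using fineD[OF fine(2) xp(1)] x by (simp add: \<delta>_def)
      moreover have "u \<in> k" "v \<in> k" using k by auto
      ultimately have "\<bar>u - x\<bar> < r x" "\<bar>v - x\<bar> < r x"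
        by (auto simp: dist_real_def abs_minus_commute subset_eq)
      then have "norm (f v - f x) \<le> e * (v - x)" "norm (f u - f x) \<le> e * (x - u)"
        using r(2)[OF x, of v] r(2)[OF x, of u] k by auto
      then have "norm (f v - f u) \<le> e * (v - x) + e * (x - u)"
        using norm_triangle_ineq4[of "f v - f x" "f u - f x"] by simp
      then show "norm (f (Sup k) - f (Inf k)) \<le> e * measure lborel k"
        using k by (simp add: algebra_simps)
    qed
    also have "\<dots> \<le> (\<Sum>(x,k)\<in>p. e * measure lborel k)"
      using fin e by (intro sum_mono2) (auto simp: p2_def)
    also have "\<dots> = e * (b - a)"
      using additive_content_tagged_division[of p a b] p ab
      by (simp add: sum_distrib_left[symmetric] case_prod_unfold)
    finally have s2: "(\<Sum>(x,k)\<in>p2. norm (f (Sup k) - f (Inf k))) \<le> e * (b - a)" .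
    have "norm (f b - f a) = norm (\<Sum>(x,k)\<in>p. f (Sup k) - f (Inf k))"
      using additive_tagged_division_1[OF ab p, of f] by simp
    also have "\<dots> \<le> (\<Sum>(x,k)\<in>p. norm (f (Sup k) - f (Inf k)))"
      by (rule order_trans[OF norm_sum]) (simp add: case_prod_unfold)
    also have "\<dots> = (\<Sum>(x,k)\<in>p1. norm (f (Sup k) - f (Inf k))) + (\<Sum>(x,k)\<in>p2. norm (f (Sup k) - f (Inf k)))"
      using pp by (simp add: sum.union_disjoint)
    finally show ?thesis using s1 s2 by (simp add: algebra_simps)
  qed
  have "norm (f b - f a) \<le> e" if "e > 0" for e
  proof -
    define c where "c = 1 + (b - a)"
    have "c > 0" using ab by (simp add: c_def)
    then show ?thesis using small[of "e / c"] that unfolding c_def[symmetric] by simp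
  qed
  then show ?thesis by (metis eq_iff_diff_eq_0 field_le_epsilon norm_le_zero_iff add_0)
qed

lemma abs_continuous_subinterval:
  assumes "abs_continuous_on_interval p q f" "p \<le> p'" "q' \<le> q"
  shows "abs_continuous_on_interval p' q' f"
  unfolding abs_continuous_on_interval_def
proof (intro allI impI)
  fix e :: real assume "e > 0"
  from assms(1)[unfolded abs_continuous_on_interval_def, rule_format, OF this]
  obtain d where d: "d > 0" and *: "\<forall>I :: (real \<times> real) set.
        finite I \<and> (\<forall>(u, v)\<in>I. p \<le> u \<and> u \<le> v \<and> v \<le> q) \<and>
        pairwise (\<lambda>x y. {fst x<..<snd x} \<inter> {fst y<..<snd y} = {}) I \<and>
        (\<Sum>(u, v)\<in>I. v - u) < d \<longrightarrow> (\<Sum>(u, v)\<in>I. norm (f v - f u)) < e"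
    by (elim exE conjE)
  have "(\<Sum>(u, v)\<in>I. norm (f v - f u)) < e"
    if "finite I \<and> (\<forall>(u, v)\<in>I. p' \<le> u \<and> u \<le> v \<and> v \<le> q') \<and>
        pairwise (\<lambda>x y. {fst x<..<snd x} \<inter> {fst y<..<snd y} = {}) I \<and>
        (\<Sum>(u, v)\<in>I. v - u) < d" for I :: "(real \<times> real) set"
    using *[rule_format, of I] that assms(2,3) by fastforce
  with d show "\<exists>d>0. \<forall>I :: (real \<times> real) set.
        finite I \<and> (\<forall>(u, v)\<in>I. p' \<le> u \<and> u \<le> v \<and> v \<le> q') \<and>
        pairwise (\<lambda>x y. {fst x<..<snd x} \<inter> {fst y<..<snd y} = {}) I \<and>
        (\<Sum>(u, v)\<in>I. v - u) < d \<longrightarrow> (\<Sum>(u, v)\<in>I. norm (f v - f u)) < e"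
    by blast
qed

lemma abs_continuous_diff_lipschitz:
  assumes f: "abs_continuous_on_interval p q f" and g: "L-lipschitz_on {p..q} g"
  shows "abs_continuous_on_interval p q (\<lambda>s. f s - g s)"
  unfolding abs_continuous_on_interval_def
proof (intro allI impI)
  fix e :: real assume e: "e > 0"
  have L: "0 \<le> L" using g by (rule lipschitz_on_nonneg)
  have "e / 2 > 0" using e by simp
  from f[unfolded abs_continuous_on_interval_def, rule_format, OF this]
  obtain d where d: "d > 0" and *: "\<forall>I :: (real \<times> real) set.
        finite I \<and> (\<forall>(u, v)\<in>I. p \<le> u \<and> u \<le> v \<and> v \<le> q) \<and>
        pairwise (\<lambda>x y. {fst x<..<snd x} \<inter> {fst y<..<snd y} = {}) I \<and>
        (\<Sum>(u, v)\<in>I. v - u) < d \<longrightarrow> (\<Sum>(u, v)\<in>I. norm (f v - f u)) < e / 2"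
    by (elim exE conjE)
  \<comment> \<open>The \<open>+ 1\<close> keeps the threshold positive when
    \<open>L = 0\<close>.\<close>
  define d' where "d' = min d (e / (2 * (L + 1)))"
  have "d' > 0" using d e L by (simp add: d'_def)
  moreover have "(\<Sum>(u, v)\<in>I. norm (f v - g v - (f u - g u))) < e"
    if I: "finite I \<and> (\<forall>(u, v)\<in>I. p \<le> u \<and> u \<le> v \<and> v \<le> q) \<and>
        pairwise (\<lambda>x y. {fst x<..<snd x} \<inter> {fst y<..<snd y} = {}) I \<and>
        (\<Sum>(u, v)\<in>I. v - u) < d'" for I :: "(real \<times> real) set"
  proof -
    have "(\<Sum>(u, v)\<in>I. norm (f v - g v - (f u - g u)))
        \<le> (\<Sum>(u, v)\<in>I. norm (f v - f u) + L * (v - u))"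
    proof (rule sum_mono, clarify)
      fix u v assume "(u, v) \<in> I"
      then have "p \<le> u" "u \<le> v" "v \<le> q" using I by blast+
      then have "norm (g v - g u) \<le> L * (v - u)"
        using lipschitz_onD[OF g, of v u] by (simp add: dist_norm)
      moreover have "norm (f v - g v - (f u - g u)) \<le> norm (f v - f u) + norm (g v - g u)"
        using norm_triangle_ineq4[of "f v - f u" "g v - g u"] by (simp add: algebra_simps)
      ultimately show "norm (f v - g v - (f u - g u)) \<le> norm (f v - f u) + L * (v - u)"
        by linarith
    qed
    also have "\<dots> = (\<Sum>(u, v)\<in>I. norm (f v - f u)) + L * (\<Sum>(u, v)\<in>I. v - u)"
      by (simp add: case_prod_unfold sum.distrib sum_distrib_left)
    also have "\<dots> < e / 2 + e / 2"
    proof (rule add_less_le_mono)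
      show "(\<Sum>(u, v)\<in>I. norm (f v - f u)) < e / 2"
        using *[rule_format, of I] I by (simp add: d'_def)
      have "(\<Sum>(u, v)\<in>I. v - u) \<le> e / (2 * (L + 1))" using I by (simp add: d'_def)
      then have "L * (\<Sum>(u, v)\<in>I. v - u) \<le> L * (e / (2 * (L + 1)))"
        using L by (rule mult_left_mono)
      also have "\<dots> \<le> e / 2" using L e by (simp add: field_simps)
      finally show "L * (\<Sum>(u, v)\<in>I. v - u) \<le> e / 2" .
    qed
    finally show ?thesis by simp
  qed
  ultimately show "\<exists>d>0. \<forall>I :: (real \<times> real) set.
        finite I \<and> (\<forall>(u, v)\<in>I. p \<le> u \<and> u \<le> v \<and> v \<le> q) \<and>
        pairwise (\<lambda>x y. {fst x<..<snd x} \<inter> {fst y<..<snd y} = {}) I \<and>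
        (\<Sum>(u, v)\<in>I. v - u) < d \<longrightarrow> (\<Sum>(u, v)\<in>I. norm (f v - g v - (f u - g u))) < e"
    by blast
qed

lemma lipschitz_abs_continuous:
  assumes "L-lipschitz_on {p..q} f"
  shows "abs_continuous_on_interval p q f"
proof -
  have "abs_continuous_on_interval p q (\<lambda>_. 0)"
    unfolding abs_continuous_on_interval_def by (auto intro: exI[of _ 1])
  moreover have "L-lipschitz_on {p..q} (\<lambda>s. - f s)"
    using assms unfolding lipschitz_on_def by (simp add: dist_minus)
  ultimately show ?thesis
    using abs_continuous_diff_lipschitz[of p q "\<lambda>_. 0"] by fastforce
qed

lemma C1_lipschitz:
  fixes f :: "real \<Rightarrow> 'a::real_normed_vector"
  assumes f: "\<And>s. s \<in> {p..q} \<Longrightarrow> (f has_vector_derivative f' s) (at s within {p..q})"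
    and f': "continuous_on {p..q} f'"
  shows "\<exists>L. L-lipschitz_on {p..q} f"
proof -
  obtain C where C: "\<And>s. s \<in> {p..q} \<Longrightarrow> norm (f' s) \<le> C"
    using compact_imp_bounded[OF compact_continuous_image[OF f' compact_Icc]]
    by (fastforce simp: bounded_iff)
  have "(max C 0)-lipschitz_on {p..q} f"
  proof (rule bounded_derivative_imp_lipschitz)
    show "(f has_derivative (\<lambda>h. h *\<^sub>R f' s)) (at s within {p..q})" if "s \<in> {p..q}" for s
      using f[OF that] by (simp add: has_vector_derivative_def)
    show "onorm (\<lambda>h. h *\<^sub>R f' s) \<le> max C 0" if "s \<in> {p..q}" for s
      using C[OF that] by (intro onorm_bound) (auto simp: mult.commute intro!: mult_left_mono)
  qed auto
  then show ?thesis ..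
qed

text \<open>Subtracting the primitive of \<open>g\<close> leaves an absolutely continuous function
  with derivative zero almost everywhere, hence a constant. A derivative known almost everywhere
  thus becomes one at every point, endpoints included, once it has a continuous
  representative.\<close>

lemma abs_continuous_ftc:
  fixes f :: "real \<Rightarrow> complex"
  assumes ac: "abs_continuous_on_interval a b f" and g: "continuous_on {a..b} g"
    and ae: "AE s in lebesgue. a < s \<and> s < b \<longrightarrow> (f has_vector_derivative g s) (at s)"
    and t: "t \<in> {a..b}"
  shows "(f has_vector_derivative g t) (at t within {a..b})"
proof -
  define G where "G s = integral {a..s} g" for s
  have G: "(G has_vector_derivative g s) (at s within {a..b})" if "s \<in> {a..b}" for s
    unfolding G_def using g that by (rule integral_has_vector_derivative)
  obtain L where L: "L-lipschitz_on {a..b} G" using C1_lipschitz[OF G g] by blast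
  have eq: "f s = G s + (f a - G a)" if s: "s \<in> {a..b}" for s
  proof -
    have "f s - G s = f a - G a"
    proof (rule abs_continuous_zero_derivative)
      show "abs_continuous_on_interval a s (\<lambda>s. f s - G s)"
        by (rule abs_continuous_subinterval[OF abs_continuous_diff_lipschitz[OF ac L]]) (use s in auto)
      show "AE r in lebesgue. a < r \<and> r < s \<longrightarrow> ((\<lambda>s. f s - G s) has_vector_derivative 0) (at r)"
        using ae
      proof eventually_elim
        case (elim r)
        show ?case
        proof
          assume r: "a < r \<and> r < s"
          then have "at r within {a..b} = at r"
            using s by (intro at_within_interior) (auto simp: interior_atLeastAtMost_real)
          then have "(G has_vector_derivative g r) (at r)" using G[of r] r s by auto
          moreover have "(f has_vector_derivative g r) (at r)" using elim r s by auto
          ultimately show "((\<lambda>s. f s - G s) has_vector_derivative 0) (at r)"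
            using has_vector_derivative_diff by fastforce
        qed
      qed
    qed (use s in auto)
    then show ?thesis by (simp add: algebra_simps)
  qed
  have "((\<lambda>s. G s + (f a - G a)) has_vector_derivative g t) (at t within {a..b})"
    using G[OF t] by (auto intro!: derivative_eq_intros)
  then show ?thesis by (rule has_vector_derivative_transform[OF t, rotated]) (rule eq)
qed

subsection \<open>Linear second-order equations on an edge\<close>

text \<open>A scalar majorant takes the place of integrating norms. With \<open>f\<close> zero it is
  monotonicity of \<open>\<phi>\<close>, the form used in the Gronwall estimate; the Picard bounds
  and Green's formula use it in full.\<close>

lemma norm_increment_le:
  fixes f :: "real \<Rightarrow> 'a::real_normed_vector" and \<phi> :: "real \<Rightarrow> real"
  assumes f: "\<And>s. s \<in> {0..1} \<Longrightarrow> (f has_vector_derivative f' s) (at s within {0..1})"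
    and \<phi>: "\<And>s. s \<in> {0..1} \<Longrightarrow> (\<phi> has_real_derivative \<phi>' s) (at s within {0..1})"
    and le: "\<And>s. s \<in> {0..1} \<Longrightarrow> norm (f' s) \<le> \<phi>' s"
    and ab: "0 \<le> a" "a \<le> b" "b \<le> 1"
  shows "norm (f b - f a) \<le> \<phi> b - \<phi> a"
proof (cases "a = b")
  case False
  have sub: "{a..b} \<subseteq> {0..1}" using ab by auto
  have at: "at s within {0..1} = at s" if "a < s" "s < b" for s :: real
    using that ab by (intro at_within_interior) (auto simp: interior_atLeastAtMost_real)
  show ?thesis
  proof (rule differentiable_bound_general)
    show "continuous_on {a..b} f"
      using f by (intro continuous_on_subset[OF _ sub] continuous_on_vector_derivative) auto
    show "continuous_on {a..b} \<phi>"
      using \<phi> by (intro continuous_on_subset[OF _ sub] DERIV_continuous_on) auto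
    show "(f has_vector_derivative f' s) (at s)" if "a < s" "s < b" for s
      using f[of s] at[OF that] that ab by simp
    show "(\<phi> has_vector_derivative \<phi>' s) (at s)" if "a < s" "s < b" for s
      using \<phi>[of s] at[OF that] that ab by (simp add: has_real_derivative_iff_has_vector_derivative)
    show "norm (f' s) \<le> \<phi>' s" if "a < s" "s < b" for s
      using le[of s] that ab by simp
    show "a < b" using False ab by simp
  qed
qed simp

text \<open>Picard iteration: \<open>W n\<close> is the n-th correction, and the second derivative
  of \<open>W (Suc n)\<close> is \<open>q * W n\<close>. The series of the corrections and of their
  first and second derivatives are dominated by exponential series, so the sum may be differentiated
  twice term by term.\<close>

lemma linear_ode_exists:
  fixes q :: "real \<Rightarrow> real"
  assumes q: "continuous_on {0..1} q"
  obtains u u1 where "u 0 = a" "u1 0 = b"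
    "\<And>s. s \<in> {0..1} \<Longrightarrow> (u has_real_derivative u1 s) (at s within {0..1})"
    "\<And>s. s \<in> {0..1} \<Longrightarrow> (u1 has_real_derivative q s * u s) (at s within {0..1})"
proof -
  obtain M where M: "\<And>s. s \<in> {0..1} \<Longrightarrow> \<bar>q s\<bar> \<le> M"
    using compact_imp_bounded[OF compact_continuous_image[OF q compact_Icc]]
    by (fastforce simp: bounded_iff)
  have M0: "0 \<le> M" using M[of 0] by simp
  \<comment> \<open>\<open>V w\<close> is the derivative of the next iterate; naming it lets values
    and derivatives share one induction.\<close>
  define V where "V w = (\<lambda>r. integral {0..r} (\<lambda>s. q s * w s))" for w :: "real \<Rightarrow> real"
  define W where "W = rec_nat (\<lambda>t. a + b * t) (\<lambda>n w t. integral {0..t} (V w))"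
  define W1 where "W1 n = (case n of 0 \<Rightarrow> (\<lambda>t. b) | Suc m \<Rightarrow> V (W m))" for n
  define W2 where "W2 n = (case n of 0 \<Rightarrow> (\<lambda>t. 0) | Suc m \<Rightarrow> (\<lambda>t. q t * W m t))" for n
  have W_simps: "W 0 = (\<lambda>t. a + b * t)" "W (Suc n) = (\<lambda>t. integral {0..t} (V (W n)))" for n
    by (simp_all add: W_def)
  have cont: "continuous_on {0..1} (W n)" for n
  proof (induction n)
    case (Suc n)
    have "continuous_on {0..1} (V (W n))"
      unfolding V_def using Suc q
      by (intro DERIV_continuous_on[OF integral_has_real_derivative] continuous_intros)
    then show ?case
      unfolding W_simps by (intro DERIV_continuous_on[OF integral_has_real_derivative])
  qed (auto simp: W_simps intro!: continuous_intros)
  have dV: "(V (W n) has_real_derivative q s * W n s) (at s within {0..1})" if "s \<in> {0..1}" for n s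
    unfolding V_def using cont q that
    by (intro integral_has_real_derivative[where g = "\<lambda>s. q s * W n s"] continuous_intros)
  have dW1: "(W1 n has_real_derivative W2 n s) (at s within {0..1})" if "s \<in> {0..1}" for n s
    using dV[OF that] by (cases n) (simp_all add: W1_def W2_def)
  have dW: "(W n has_real_derivative W1 n s) (at s within {0..1})" if "s \<in> {0..1}" for n s
  proof (cases n)
    case 0 then show ?thesis by (auto simp: W_simps W1_def intro!: derivative_eq_intros)
  next
    case (Suc m)
    have "continuous_on {0..1} (V (W m))"
      using dV by (intro DERIV_continuous_on) auto
    then show ?thesis
      unfolding Suc W_simps W1_def using that
      by (auto intro!: integral_has_real_derivative[where g = "V (W m)"])
  qed
  define C where "C = \<bar>a\<bar> + \<bar>b\<bar>"
  have V0: "V w 0 = 0" for w by (simp add: V_def)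
  \<comment> \<open>Two integrations per round would gain two powers of \<open>t\<close>. Giving up
    one factor \<open>s \<le> 1\<close> lets \<open>W (Suc n)\<close> inherit the bound of its
    derivative, and one factorial still secures convergence.\<close>
  have bound: "\<bar>W n t\<bar> \<le> C * (M * t) ^ n / fact n \<and>
      \<bar>V (W n) t\<bar> \<le> C * (M * t) ^ Suc n / fact (Suc n)"
    if t: "t \<in> {0..1}" for n t
    using t
  proof (induction n arbitrary: t)
    case 0
    have W0: "\<bar>W 0 s\<bar> \<le> C" if "s \<in> {0..1}" for s
    proof -
      have "\<bar>b * s\<bar> \<le> \<bar>b\<bar>" using that by (auto simp: abs_mult intro: mult_left_le)
      then show ?thesis unfolding W_simps C_def by linarith
    qed
    have "norm (V (W 0) t - V (W 0) 0) \<le> C * (M * t) - C * (M * 0)"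
    proof (rule norm_increment_le)
      fix s :: real assume s: "s \<in> {0..1}"
      show "(V (W 0) has_vector_derivative q s * W 0 s) (at s within {0..1})"
        using dV[OF s] by (simp add: has_real_derivative_iff_has_vector_derivative)
      show "((\<lambda>t. C * (M * t)) has_real_derivative C * M) (at s within {0..1})"
        by (auto intro!: derivative_eq_intros)
      show "norm (q s * W 0 s) \<le> C * M"
        using mult_mono[OF W0[OF s] M[OF s]] by (simp add: abs_mult mult.commute C_def)
    qed (use 0 in auto)
    with W0[OF 0] show ?case by (simp add: V0)
  next
    case (Suc n)
    have step: "((\<lambda>t. C * (M * t) ^ Suc m / fact (Suc m)) has_real_derivative
        C * M * (M * s) ^ m / fact m) (at s within {0..1})" for m s
    proof -
      have "((\<lambda>t. M * t) has_real_derivative M) (at s within {0..1})"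
        by (auto intro!: derivative_eq_intros)
      from DERIV_cmult[OF DERIV_power[OF this, of "Suc m"], of "C / fact (Suc m)"]
      have "((\<lambda>t. C / fact (Suc m) * (M * t) ^ Suc m) has_real_derivative
          C / fact (Suc m) * (real (Suc m) * (M * (M * s) ^ m))) (at s within {0..1})"
        by (simp del: of_nat_Suc fact_Suc)
      also have "C / fact (Suc m) * (real (Suc m) * (M * (M * s) ^ m)) = C * M * (M * s) ^ m / fact m"
        by (simp add: divide_simps del: of_nat_Suc)
      finally show ?thesis by (simp del: fact_Suc power_Suc)
    qed
    have W': "\<bar>W (Suc n) s\<bar> \<le> C * (M * s) ^ Suc n / fact (Suc n)" if s: "s \<in> {0..1}" for s
    proof -
      have W00: "W (Suc n) 0 = 0" by (simp add: W_simps)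
      have "norm (W (Suc n) s - W (Suc n) 0) \<le> C * (M * s) ^ Suc n / fact (Suc n) * s
          - C * (M * s) ^ Suc n / fact (Suc n) * 0"
      proof -
        have "norm (W (Suc n) s - W (Suc n) 0) \<le> integral {0..s} (\<lambda>r. C * (M * s) ^ Suc n / fact (Suc n))"
          unfolding W00 diff_zero unfolding W_simps
        proof (rule integral_norm_bound_integral)
          have "continuous_on {0..s} (V (W n))"
            using s by (intro continuous_on_subset[OF DERIV_continuous_on[OF dV]]) auto
          then show "V (W n) integrable_on {0..s}" by (rule integrable_continuous_real)
          show "norm (V (W n) r) \<le> C * (M * s) ^ Suc n / fact (Suc n)" if r: "r \<in> {0..s}" for r
          proof -
            have "(M * r) ^ Suc n \<le> (M * s) ^ Suc n"
              using r M0 by (intro power_mono mult_left_mono) auto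
            then have "C * (M * r) ^ Suc n / fact (Suc n) \<le> C * (M * s) ^ Suc n / fact (Suc n)"
              by (intro divide_right_mono mult_left_mono) (auto simp: C_def)
            with Suc.IH[of r] r s show ?thesis by auto
          qed
        qed auto
        then show ?thesis using s by (simp add: mult_ac)
      qed
      moreover have "C * (M * s) ^ Suc n / fact (Suc n) * s \<le> C * (M * s) ^ Suc n / fact (Suc n)"
        using s M0 by (intro mult_left_le) (auto simp: C_def intro!: divide_nonneg_nonneg mult_nonneg_nonneg)
      ultimately show ?thesis by (simp add: W00)
    qed
    have "norm (V (W (Suc n)) t - V (W (Suc n)) 0)
        \<le> C * (M * t) ^ Suc (Suc n) / fact (Suc (Suc n)) - C * (M * 0) ^ Suc (Suc n) / fact (Suc (Suc n))"
    proof (rule norm_increment_le[OF _ step])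
      fix s :: real assume s: "s \<in> {0..1}"
      show "(V (W (Suc n)) has_vector_derivative q s * W (Suc n) s) (at s within {0..1})"
        using dV[OF s] by (simp add: has_real_derivative_iff_has_vector_derivative)
      show "norm (q s * W (Suc n) s) \<le> C * M * (M * s) ^ Suc n / fact (Suc n)"
        using mult_mono[OF W'[OF s] M[OF s]] s M0
        by (simp add: abs_mult mult_ac C_def)
    qed (use Suc.prems in auto)
    then show ?case using W'[OF Suc.prems] by (simp add: V0)
  qed
  have sumM: "summable (\<lambda>n. K * M ^ n / fact n)" for K :: real
    using summable_mult[OF summable_exp[of M], of K] by (simp add: field_simps)
  have Wb: "norm (W n t) \<le> C * M ^ n / fact n" if t: "t \<in> {0..1}" for n t
  proof -
    have "(M * t) ^ n \<le> M ^ n" using t M0 by (intro power_mono) (auto intro: mult_left_le)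
    then have "C * (M * t) ^ n / fact n \<le> C * M ^ n / fact n"
      by (intro divide_right_mono mult_left_mono) (auto simp: C_def)
    with bound[OF t, of n] show ?thesis by auto
  qed
  have W1b: "norm (W1 n t) \<le> C * M ^ n / fact n" if t: "t \<in> {0..1}" for n t
  proof (cases n)
    case 0 then show ?thesis by (simp add: W1_def C_def)
  next
    case (Suc m)
    have "(M * t) ^ n \<le> M ^ n" using t M0 by (intro power_mono) (auto intro: mult_left_le)
    then have "C * (M * t) ^ n / fact n \<le> C * M ^ n / fact n"
      by (intro divide_right_mono mult_left_mono) (auto simp: C_def)
    with bound[OF t, of m] Suc show ?thesis by (auto simp: W1_def)
  qed
  have unif: "uniform_limit {0..1} (\<lambda>n x. \<Sum>i<n. W i x) (\<lambda>x. \<Sum>i. W i x) sequentially"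
    "uniform_limit {0..1} (\<lambda>n x. \<Sum>i<n. W1 i x) (\<lambda>x. \<Sum>i. W1 i x) sequentially"
    using Wb W1b by (intro Weierstrass_m_test[OF _ sumM[of C]]; blast)+
  have W2b: "norm (W2 n t) \<le> (case n of 0 \<Rightarrow> 0 | Suc m \<Rightarrow> M * (C * M ^ m / fact m))"
    if t: "t \<in> {0..1}" for n t
    using mult_mono[OF M[OF t] Wb[OF t]] M0
    by (auto simp: W2_def abs_mult split: nat.split)
  have unif2: "uniform_limit {0..1} (\<lambda>n x. \<Sum>i<n. W2 i x) (\<lambda>x. \<Sum>i. W2 i x) sequentially"
  proof (rule Weierstrass_m_test[OF W2b])
    show "summable (\<lambda>n. case n of 0 \<Rightarrow> 0 | Suc m \<Rightarrow> M * (C * M ^ m / fact m))"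
      by (subst summable_Suc_iff[symmetric]) (use summable_mult[OF sumM[of C], of M] in simp)
  qed
  have sW: "summable (\<lambda>n. W n t)" "summable (\<lambda>n. W1 n t)" if "t \<in> {0..1}" for t
    using Wb[OF that] W1b[OF that] by (auto intro!: summable_comparison_test'[OF sumM[of C]])
  obtain u where u: "\<And>t. t \<in> {0..1} \<Longrightarrow> (\<lambda>n. W n t) sums u t \<and>
      (u has_real_derivative (\<Sum>n. W1 n t)) (at t within {0..1})"
    using has_field_derivative_series[OF _ dW unif(2), of 0] sW(1)[of 0] by fastforce
  obtain u1 where u1: "\<And>t. t \<in> {0..1} \<Longrightarrow> (\<lambda>n. W1 n t) sums u1 t \<and>
      (u1 has_real_derivative (\<Sum>n. W2 n t)) (at t within {0..1})"
    using has_field_derivative_series[OF _ dW1 unif2, of 0] sW(2)[of 0] by fastforce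
  have W2s: "(\<Sum>n. W2 n t) = q t * u t" if "t \<in> {0..1}" for t
  proof -
    have "(\<lambda>n. W2 (Suc n) t) sums (q t * u t)"
      using u[OF that] by (simp add: W2_def sums_mult)
    from sums_Suc[OF this] have "(\<lambda>n. W2 n t) sums (q t * u t)" by (simp add: W2_def)
    then show ?thesis by (rule sums_unique[symmetric])
  qed
  have W0: "W n 0 = 0" "W1 n 0 = 0" if "n \<notin> {0}" for n
    using that by (cases n; simp add: W_simps W1_def V0)+
  show thesis
  proof
    have "(\<lambda>n. W n 0) sums a"
      using sums_finite[of "{0}" "\<lambda>n. W n 0", OF _ W0(1)] by (simp add: W_simps(1))
    then show "u 0 = a" using u[of 0] sums_unique2 by force
    have "(\<lambda>n. W1 n 0) sums b"
      using sums_finite[of "{0}" "\<lambda>n. W1 n 0", OF _ W0(2)] by (simp add: W1_def)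
    then show "u1 0 = b" using u1[of 0] sums_unique2 by force
    show "(u has_real_derivative u1 s) (at s within {0..1})" if "s \<in> {0..1}" for s
      using u[OF that] u1[OF that] by (metis sums_unique)
    show "(u1 has_real_derivative q s * u s) (at s within {0..1})" if "s \<in> {0..1}" for s
      using u1[OF that] W2s[OF that] by simp
  qed
qed

text \<open>Gronwall for the energy \<open>E\<close>, run from the outer end towards the centre. In
  \<open>K = 2 + M\<close>, one unit pays for the cross term of \<open>u\<close> and
  \<open>u1\<close>, one for the source, and \<open>M\<close> for the potential. The source
  \<open>h\<close> is there for comparing a solution of positive energy with one of energy
  zero.\<close>

lemma second_order_growth:
  fixes u u1 u2 :: "real \<Rightarrow> 'a::real_inner"
  assumes u: "\<And>s. s \<in> {0..1} \<Longrightarrow> (u has_vector_derivative u1 s) (at s within {0..1})"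
    and u1: "\<And>s. s \<in> {0..1} \<Longrightarrow> (u1 has_vector_derivative u2 s) (at s within {0..1})"
    and u2: "\<And>s. s \<in> {0..1} \<Longrightarrow> norm (u2 s) \<le> M * norm (u s) + h"
    and M: "0 \<le> M" and h: "0 \<le> h" and t: "t \<in> {0..1}"
  shows "(norm (u t))\<^sup>2 + (norm (u1 t))\<^sup>2 \<le> exp (2 + M) * ((norm (u 1))\<^sup>2 + (norm (u1 1))\<^sup>2 + h\<^sup>2)"
proof -
  define K where "K = 2 + M"
  define E where "E s = inner (u s) (u s) + inner (u1 s) (u1 s)" for s
  define E' where "E' s = 2 * inner (u s) (u1 s) + 2 * inner (u1 s) (u2 s)" for s
  have E0: "0 \<le> E s" for s by (simp add: E_def)
  have dE: "(E has_real_derivative E' s) (at s within {0..1})" if "s \<in> {0..1}" for s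
    unfolding has_real_derivative_iff_has_vector_derivative E_def E'_def
    using bounded_bilinear.has_vector_derivative[OF bounded_bilinear_inner u[OF that] u[OF that]]
      bounded_bilinear.has_vector_derivative[OF bounded_bilinear_inner u1[OF that] u1[OF that]]
    by (auto simp: inner_commute intro!: has_vector_derivative_add elim!: back_subst[of "\<lambda>x. (_ has_vector_derivative x) _"])
  have E': "- (K * E s + h\<^sup>2) \<le> E' s" if s: "s \<in> {0..1}" for s
  proof -
    define x where "x = norm (u s)"
    define y where "y = norm (u1 s)"
    have 1: "\<bar>inner (u s) (u1 s)\<bar> \<le> x * y" unfolding x_def y_def by (rule Cauchy_Schwarz_ineq2)
    have "\<bar>inner (u1 s) (u2 s)\<bar> \<le> y * norm (u2 s)" unfolding y_def by (rule Cauchy_Schwarz_ineq2)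
    also have "\<dots> \<le> y * (M * x + h)"
      using u2[OF s] by (intro mult_left_mono) (auto simp: x_def y_def)
    finally have 2: "\<bar>inner (u1 s) (u2 s)\<bar> \<le> y * (M * x + h)" .
    define P where "P = x\<^sup>2 + y\<^sup>2"
    define X where "X = x * y"
    have k: "K * E s = 2 * P + M * P"
      by (simp add: E_def K_def P_def x_def y_def power2_norm_eq_inner algebra_simps)
    have m: "2 * (y * (M * x + h)) = M * (2 * X) + 2 * y * h"
      by (simp add: X_def algebra_simps)
    have X: "2 * X \<le> P" using sum_squares_bound[of x y] by (simp add: X_def P_def)
    have "M * (2 * X) \<le> M * P" using M X by (intro mult_left_mono) auto
    moreover have "2 * y * h \<le> P + h\<^sup>2"
      using sum_squares_bound[of y h] zero_le_power2[of x] unfolding P_def by linarith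
    ultimately show ?thesis using X 1[folded X_def] 2 k m unfolding E'_def by linarith
  qed
  \<comment> \<open>Adding \<open>h\<^sup>2\<close> to the energy absorbs the source: since
    \<open>K \<ge> 1\<close>, the weighted sum is nondecreasing.\<close>
  define F where "F s = exp (K * s) * (E s + h\<^sup>2)" for s
  have "norm ((0::real) - 0) \<le> F 1 - F t"
  proof (rule norm_increment_le[where f = "\<lambda>_. 0" and f' = "\<lambda>_. 0" and \<phi> = F
        and \<phi>' = "\<lambda>s. exp (K * s) * (K * (E s + h\<^sup>2) + E' s)"])
    fix s :: real assume s: "s \<in> {0..1}"
    show "(F has_real_derivative exp (K * s) * (K * (E s + h\<^sup>2) + E' s)) (at s within {0..1})"
      unfolding F_def by (auto intro!: derivative_eq_intros dE[OF s] simp: algebra_simps)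
    have "0 \<le> M * h\<^sup>2" "0 \<le> h\<^sup>2" using M by auto
    then have "0 \<le> K * (E s + h\<^sup>2) + E' s"
      using E'[OF s] by (simp only: K_def distrib_left distrib_right)
    then show "norm (0::real) \<le> exp (K * s) * (K * (E s + h\<^sup>2) + E' s)" by simp
  qed (use t in auto)
  then have "F t \<le> F 1" by simp
  moreover have "1 * (E t + h\<^sup>2) \<le> F t"
    unfolding F_def using E0[of t] M t by (intro mult_right_mono) (auto simp: K_def)
  ultimately have "E t + h\<^sup>2 \<le> exp K * (E 1 + h\<^sup>2)" by (simp add: F_def)
  moreover have "0 \<le> h\<^sup>2" by simp
  ultimately have "E t \<le> exp K * (E 1 + h\<^sup>2)" by linarith
  then show ?thesis by (simp add: E_def K_def power2_norm_eq_inner)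
qed

text \<open>The derivative is carried as a second function, so that its endpoint values are data of
  the solution. The coefficient \<open>q\<close> contains the energy: at positive energy it is
  \<open>\<alpha> * Q j s - (\<epsilon> * k)\<^sup>2\<close>.\<close>

definition edge_solution :: "(real \<Rightarrow> real) \<Rightarrow> (real \<Rightarrow> complex) \<Rightarrow> (real \<Rightarrow> complex) \<Rightarrow> bool" where
  "edge_solution q u u1 \<longleftrightarrow> (\<forall>s\<in>{0..1}.
     (u has_vector_derivative u1 s) (at s within {0..1}) \<and>
     (u1 has_vector_derivative of_real (q s) * u s) (at s within {0..1}))"

lemma edge_solution_add:
  assumes "edge_solution q u u1" "edge_solution q v v1"
  shows "edge_solution q (\<lambda>s. u s + v s) (\<lambda>s. u1 s + v1 s)"
  using assms unfolding edge_solution_def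
  by (auto simp: distrib_left intro!: has_vector_derivative_add)

lemma edge_solution_scale:
  assumes "edge_solution q u u1"
  shows "edge_solution q (\<lambda>s. c * u s) (\<lambda>s. c * u1 s)"
  using assms unfolding edge_solution_def
  by (auto simp: mult.left_commute[of _ c] intro!: has_vector_derivative_mult_right)

lemma edge_solution_diff:
  assumes "edge_solution q u u1" "edge_solution q v v1"
  shows "edge_solution q (\<lambda>s. u s - v s) (\<lambda>s. u1 s - v1 s)"
  using edge_solution_add[OF assms(1) edge_solution_scale[OF assms(2), of "-1"]] by simp

lemma edge_solution_cnj:
  assumes "edge_solution q u u1"
  shows "edge_solution q (\<lambda>s. cnj (u s)) (\<lambda>s. cnj (u1 s))"
  using assms bounded_linear.has_vector_derivative[OF bounded_linear_cnj]
  unfolding edge_solution_def by fastforce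

lemma edge_solution_growth:
  assumes "edge_solution q u u1" "\<And>s. s \<in> {0..1} \<Longrightarrow> \<bar>q s\<bar> \<le> M" "t \<in> {0..1}"
  shows "(norm (u t))\<^sup>2 + (norm (u1 t))\<^sup>2 \<le> exp (2 + M) * ((norm (u 1))\<^sup>2 + (norm (u1 1))\<^sup>2)"
proof -
  have M: "0 \<le> M" using assms(2)[of 0] by simp
  have "norm (of_real (q s) * u s) \<le> M * norm (u s) + 0" if "s \<in> {0..1}" for s
    using mult_right_mono[OF assms(2)[OF that] norm_ge_zero[of "u s"]] by (simp add: norm_mult)
  from second_order_growth[where u = u and ?u1.0 = u1, OF _ _ this M order_refl assms(3)] assms(1)
  show ?thesis by (simp add: edge_solution_def)
qed

lemma edge_solution_bounded:
  assumes "edge_solution q u u1"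
  shows "\<exists>A. \<forall>s\<in>{0..1}. norm (u s) \<le> A"
proof -
  have "continuous_on {0..1} u"
    using assms unfolding edge_solution_def by (intro continuous_on_vector_derivative) auto
  from compact_imp_bounded[OF compact_continuous_image[OF this compact_Icc]]
  show ?thesis by (fastforce simp: bounded_iff)
qed

lemma edge_solution_unique:
  assumes "edge_solution q u u1" "edge_solution q v v1" "continuous_on {0..1} q"
    and "u 1 = v 1" "u1 1 = v1 1" "t \<in> {0..1}"
  shows "u t = v t" "u1 t = v1 t"
proof -
  obtain M where "\<And>s. s \<in> {0..1} \<Longrightarrow> \<bar>q s\<bar> \<le> M"
    using compact_imp_bounded[OF compact_continuous_image[OF assms(3) compact_Icc]]
    by (fastforce simp: bounded_iff)
  from edge_solution_growth[OF edge_solution_diff[OF assms(1,2)] this \<open>t \<in> {0..1}\<close>]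
  have "(norm (u t - v t))\<^sup>2 + (norm (u1 t - v1 t))\<^sup>2 \<le> 0" using assms by simp
  then show "u t = v t" "u1 t = v1 t"
    by (simp_all add: sum_power2_le_zero_iff)
qed

text \<open>The Wronskian of \<open>u\<close> and \<open>v\<close> has derivative
  \<open>(q - r) * u * v\<close>. An estimate of its increment serves two purposes:
  \<open>d = 0\<close> gives constancy, and \<open>d\<close> equal to the energy gives a small
  error.\<close>

lemma edge_green:
  assumes u: "edge_solution q u u1" and v: "edge_solution r v v1"
    and qr: "\<And>s. s \<in> {0..1} \<Longrightarrow> \<bar>q s - r s\<bar> \<le> d"
    and A: "\<And>s. s \<in> {0..1} \<Longrightarrow> norm (u s) \<le> A" and B: "\<And>s. s \<in> {0..1} \<Longrightarrow> norm (v s) \<le> B"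
  shows "norm ((u1 1 * v 1 - u 1 * v1 1) - (u1 0 * v 0 - u 0 * v1 0)) \<le> d * (A * B)"
proof -
  define w where "w s = u1 s * v s - u s * v1 s" for s
  have "norm (w 1 - w 0) \<le> d * (A * B) * 1 - d * (A * B) * 0"
  proof (rule norm_increment_le)
    fix s :: real assume s: "s \<in> {0..1}"
    show "(w has_vector_derivative of_real (q s - r s) * (u s * v s)) (at s within {0..1})"
      unfolding w_def using u v s unfolding edge_solution_def
      by (auto intro!: derivative_eq_intros simp: algebra_simps)
    show "((*) (d * (A * B)) has_real_derivative d * (A * B)) (at s within {0..1})"
      by (auto intro!: derivative_eq_intros)
    have "0 \<le> A" using A[OF s] norm_ge_zero order_trans by blast
    then have "norm (u s) * norm (v s) \<le> A * B"
      using A[OF s] B[OF s] by (intro mult_mono) auto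
    moreover have "0 \<le> d" using qr[OF s] by linarith
    ultimately show "norm (of_real (q s - r s) * (u s * v s)) \<le> d * (A * B)"
      unfolding norm_mult norm_of_real using mult_mono[OF qr[OF s]] by simp
  qed auto
  then show ?thesis by (simp add: w_def)
qed

text \<open>Picard iteration starts at 0, while the data here sit at 1. The reflection of the edge
  flips the sign of the slope, hence the initial slope \<open>- b\<close>, and preserves the form of
  a second-order equation.\<close>

lemma real_edge_solution_exists:
  fixes q :: "real \<Rightarrow> real"
  assumes q: "continuous_on {0..1} q"
  obtains u u1 where "u 1 = a" "u1 1 = b"
    "edge_solution q (\<lambda>s. of_real (u s)) (\<lambda>s. of_real (u1 s))"
proof -
  have "continuous_on {0..1} (\<lambda>s. q (1 - s))"
    by (intro continuous_on_compose2[OF q] continuous_intros) auto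
  then obtain v v1 where v: "v 0 = a" "v1 0 = - b"
    and dv: "\<And>s. s \<in> {0..1} \<Longrightarrow> (v has_real_derivative v1 s) (at s within {0..1})"
    "\<And>s. s \<in> {0..1} \<Longrightarrow> (v1 has_real_derivative q (1 - s) * v s) (at s within {0..1})"
    by (rule linear_ode_exists[where a = a and b = "- b"]) blast
  have reflect: "((\<lambda>s. f (1 - s)) has_real_derivative - f') (at s within {0..1})"
    if "(f has_real_derivative f') (at (1 - s) within {0..1})" for f f' and s :: real
  proof -
    have "((\<lambda>s. 1 - s) has_real_derivative -1) (at s within {0..1})"
      by (auto intro!: derivative_eq_intros)
    moreover have "(f has_real_derivative f') (at (1 - s) within (\<lambda>s. 1 - s) ` {0..1})"
      using that by (rule DERIV_subset) auto
    ultimately show ?thesis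
      using DERIV_image_chain[of f f' "\<lambda>s. 1 - s" s "{0..1}" "-1"] by (simp add: o_def)
  qed
  show thesis
  proof (rule that[of "\<lambda>s. v (1 - s)" "\<lambda>s. - v1 (1 - s)"])
    show "v (1 - 1) = a" "- v1 (1 - 1) = b" using v by auto
    show "edge_solution q (\<lambda>s. of_real (v (1 - s))) (\<lambda>s. of_real (- v1 (1 - s)))"
      unfolding edge_solution_def
    proof
      fix s :: real assume s: "s \<in> {0..1}"
      then have "1 - s \<in> {0..1}" by auto
      note d = reflect[OF dv(1)[OF this]] DERIV_minus[OF reflect[OF dv(2)[OF this]]]
      show "((\<lambda>s. complex_of_real (v (1 - s))) has_vector_derivative of_real (- v1 (1 - s))) (at s within {0..1}) \<and>
         ((\<lambda>s. complex_of_real (- v1 (1 - s))) has_vector_derivative of_real (q s) * of_real (v (1 - s)))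
          (at s within {0..1})"
        using d[THEN has_vector_derivative_of_real] by simp
    qed
  qed
qed

lemma edge_solution_exists:
  assumes q: "continuous_on {0..1} q"
  obtains u u1 where "edge_solution q u u1" "u 1 = a" "u1 1 = b"
proof -
  obtain x x1 where x: "x 1 = Re a" "x1 1 = Re b"
    "edge_solution q (\<lambda>s. of_real (x s)) (\<lambda>s. of_real (x1 s))"
    using real_edge_solution_exists[OF q] by metis
  obtain y y1 where y: "y 1 = Im a" "y1 1 = Im b"
    "edge_solution q (\<lambda>s. of_real (y s)) (\<lambda>s. of_real (y1 s))"
    using real_edge_solution_exists[OF q] by metis
  show thesis
    using that[OF edge_solution_add[OF x(3) edge_solution_scale[OF y(3), of \<i>]]]
    by (simp add: x y complex_eq[symmetric])
qed

section \<open>Solutions on the whole star and Green's formula\<close>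

definition star_solution :: "real star_fun \<Rightarrow> complex star_fun \<Rightarrow> complex star_fun \<Rightarrow> bool" where
  "star_solution q u u1 \<longleftrightarrow> (\<forall>j. edge_solution (q j) (u j) (u1 j)) \<and>
     kirchhoff (\<lambda>j. u j 0) (\<lambda>j. u1 j 0)"

lemma star_solution_add:
  assumes "star_solution q u u1" "star_solution q v v1"
  shows "star_solution q (\<lambda>j s. u j s + v j s) (\<lambda>j s. u1 j s + v1 j s)"
  using assms unfolding star_solution_def kirchhoff_def
  by (auto intro!: edge_solution_add simp: sum.distrib) metis

lemma star_solution_scale:
  assumes "star_solution q u u1"
  shows "star_solution q (\<lambda>j s. c * u j s) (\<lambda>j s. c * u1 j s)"
  using assms unfolding star_solution_def kirchhoff_def
  by (auto intro!: edge_solution_scale simp: sum_distrib_left[symmetric])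

lemma star_solution_cnj:
  assumes "star_solution q u u1"
  shows "star_solution q (\<lambda>j s. cnj (u j s)) (\<lambda>j s. cnj (u1 j s))"
  using assms unfolding star_solution_def kirchhoff_def
  by (auto intro!: edge_solution_cnj simp: cnj_sum[symmetric])

text \<open>The contributions of the centre cancel: the values there are common to all edges, and
  the slopes add up to zero. What remains is the outer boundary term, with one error
  \<open>d * (A * B)\<close> per edge.\<close>

lemma star_green:
  assumes u: "star_solution q u u1" and v: "star_solution r v v1"
    and qr: "\<And>j s. s \<in> {0..1} \<Longrightarrow> \<bar>q j s - r j s\<bar> \<le> d"
    and A: "\<And>j s. s \<in> {0..1} \<Longrightarrow> norm (u j s) \<le> A" and B: "\<And>j s. s \<in> {0..1} \<Longrightarrow> norm (v j s) \<le> B"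
  shows "norm (\<Sum>j\<in>UNIV. u1 j 1 * v j 1 - u j 1 * v1 j 1) \<le> 3 * (d * (A * B))"
proof -
  have k: "u j 0 = u 1 0" "v j 0 = v 1 0" for j
    using u v unfolding star_solution_def kirchhoff_def by blast+
  have "(\<Sum>j\<in>UNIV. u1 j 0 * v j 0 - u j 0 * v1 j 0) = (\<Sum>j\<in>UNIV. u1 j 0 * v 1 0 - u 1 0 * v1 j 0)"
    by (intro sum.cong refl) (metis k)
  also have "\<dots> = (\<Sum>j\<in>UNIV. u1 j 0) * v 1 0 - u 1 0 * (\<Sum>j\<in>UNIV. v1 j 0)"
    by (simp add: sum_subtractf sum_distrib_left sum_distrib_right)
  also have "\<dots> = 0" using u v unfolding star_solution_def kirchhoff_def by simp
  finally have "(\<Sum>j\<in>UNIV. u1 j 1 * v j 1 - u j 1 * v1 j 1) =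
      (\<Sum>j\<in>UNIV. (u1 j 1 * v j 1 - u j 1 * v1 j 1) - (u1 j 0 * v j 0 - u j 0 * v1 j 0))"
    by (simp add: sum_subtractf)
  also have "norm \<dots> \<le> (\<Sum>j\<in>(UNIV :: 3 set). d * (A * B))"
    using u v qr A B unfolding star_solution_def
    by (intro sum_norm_le edge_green) auto
  finally show ?thesis by simp
qed

subsection \<open>The vertex conditions of the limit operator\<close>

text \<open>Derivatives within \<open>{0..1}\<close> are unique also at the endpoints, so
  \<open>deriv_b\<close> and \<open>deriv_aj\<close> are endpoint values of the carried derivative,
  the latter with reversed sign.\<close>

lemma eigenspace_iff:
  "g \<in> eigenspace Q \<alpha> \<longleftrightarrow>
     (\<exists>g1. star_solution (\<lambda>j s. \<alpha> * Q j s) g g1 \<and> (\<forall>j. g1 j 1 = 0)) \<and>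
     (\<forall>j s. s \<notin> {0..1} \<longrightarrow> g j s = 0)"
proof -
  have ends: "deriv_b g j = h 0 \<and> deriv_aj g j = - h 1"
    if "\<And>s. s \<in> {0..1} \<Longrightarrow> (g j has_vector_derivative h s) (at s within {0..1})" for h j
  proof -
    have "vector_derivative (g j) (at s within {0..1}) = h s" if "s \<in> {0..1}" for s
      using vector_derivative_within_cbox[of 0 1 s "g j" "h s"] that \<open>\<And>s. s \<in> {0..1} \<Longrightarrow> _\<close>[OF that]
      by simp
    then show ?thesis by (simp add: deriv_b_def deriv_aj_def)
  qed
  have "resonance_problem Q \<alpha> g \<longleftrightarrow>
     (\<exists>g1. star_solution (\<lambda>j s. \<alpha> * Q j s) g g1 \<and> (\<forall>j. g1 j 1 = 0))"
  proof
    assume *: "resonance_problem Q \<alpha> g"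
    then have "\<forall>j. \<exists>g1. \<forall>s\<in>{0..1}. (g j has_vector_derivative g1 s) (at s within {0..1}) \<and>
        (g1 has_vector_derivative of_real (\<alpha> * Q j s) * g j s) (at s within {0..1})"
      unfolding resonance_problem_def by (metis add.commute add_eq_0_iff minus_minus)
    then obtain g1 where g1: "\<And>j. edge_solution (\<lambda>s. \<alpha> * Q j s) (g j) (g1 j)"
      unfolding edge_solution_def by metis
    have d: "deriv_b g j = g1 j 0" "deriv_aj g j = - g1 j 1" for j
      using ends[of j "g1 j"] g1[of j] unfolding edge_solution_def by blast+
    then have "deriv_b g = (\<lambda>j. g1 j 0)" by blast
    with * g1 show "\<exists>g1. star_solution (\<lambda>j s. \<alpha> * Q j s) g g1 \<and> (\<forall>j. g1 j 1 = 0)"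
      unfolding resonance_problem_def star_solution_def
      by (intro exI[of _ g1]) (auto simp: d)
  next
    assume "\<exists>g1. star_solution (\<lambda>j s. \<alpha> * Q j s) g g1 \<and> (\<forall>j. g1 j 1 = 0)"
    then obtain g1 where g1: "\<And>j. edge_solution (\<lambda>s. \<alpha> * Q j s) (g j) (g1 j)"
      "kirchhoff (\<lambda>j. g j 0) (\<lambda>j. g1 j 0)" "\<And>j. g1 j 1 = 0"
      unfolding star_solution_def by auto
    have d: "deriv_b g = (\<lambda>j. g1 j 0)" "deriv_aj g j = - g1 j 1" for j
      using ends[of _ "g1 _"] g1(1) unfolding edge_solution_def by blast+
    show "resonance_problem Q \<alpha> g"
      unfolding resonance_problem_def d(1)
    proof (intro conjI allI)
      fix j
      show "\<exists>h g2. \<forall>s\<in>{0..1}. (g j has_vector_derivative h s) (at s within {0..1}) \<and>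
          (h has_vector_derivative g2 s) (at s within {0..1}) \<and>
          - g2 s + of_real (\<alpha> * Q j s) * g j s = 0"
        using g1(1)[of j] unfolding edge_solution_def
        by (intro exI[of _ "g1 j"] exI[of _ "\<lambda>s. of_real (\<alpha> * Q j s) * g j s"]) auto
    qed (use g1 d in auto)
  qed
  then show ?thesis by (auto simp: eigenspace_def)
qed

section \<open>Neumann profiles and their admissible outer values\<close>

definition cvec :: "real ^ 3 \<Rightarrow> complex ^ 3" where "cvec x = (\<chi> j. of_real (x $ j))"
definition Re_vec :: "complex ^ 3 \<Rightarrow> real ^ 3" where "Re_vec p = (\<chi> j. Re (p $ j))"
definition Im_vec :: "complex ^ 3 \<Rightarrow> real ^ 3" where "Im_vec p = (\<chi> j. Im (p $ j))"

lemma Re_vec_cvec [simp]: "Re_vec (cvec x) = x" and Im_vec_cvec [simp]: "Im_vec (cvec x) = 0"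
  by (auto simp: Re_vec_def Im_vec_def cvec_def vec_eq_iff)

locale neumann_star =
  fixes q \<phi> \<phi>1 :: "real star_fun"
  assumes q_cont: "\<And>j. continuous_on {0..1} (q j)"
    and \<phi>_sol: "\<And>j. edge_solution (q j) (\<lambda>s. of_real (\<phi> j s)) (\<lambda>s. of_real (\<phi>1 j s))"
    and \<phi>_end: "\<And>j. \<phi> j 1 = 1" "\<And>j. \<phi>1 j 1 = 0"
begin

text \<open>Every star solution with Neumann data is \<open>p $ j * \<phi> j\<close> on the edges, with \<open>p\<close> its outer values; \<open>outer\<close>
  is the set of \<open>p\<close> for which the Kirchhoff conditions hold at the centre.\<close>

definition real_outer :: "(real ^ 3) set" where
  "real_outer = {x. (\<forall>i j. x $ i * \<phi> i 0 = x $ j * \<phi> j 0) \<and> (\<Sum>j\<in>UNIV. x $ j * \<phi>1 j 0) = 0}"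

definition outer :: "(complex ^ 3) set" where
  "outer = {p. (\<forall>i j. p $ i * of_real (\<phi> i 0) = p $ j * of_real (\<phi> j 0)) \<and>
    (\<Sum>j\<in>UNIV. p $ j * of_real (\<phi>1 j 0)) = 0}"

text \<open>The coefficients \<open>\<phi> j 0\<close> and \<open>\<phi>1 j 0\<close> are real, so
  the conditions separate into real and imaginary parts: \<open>outer\<close> is the
  complexification of \<open>real_outer\<close>.\<close>

lemma outer_iff: "p \<in> outer \<longleftrightarrow> Re_vec p \<in> real_outer \<and> Im_vec p \<in> real_outer"
  by (auto simp: outer_def real_outer_def Re_vec_def Im_vec_def complex_eq_iff)

lemma cvec_in_outer [simp]: "cvec x \<in> outer \<longleftrightarrow> x \<in> real_outer"
  by (simp add: outer_iff) (simp add: real_outer_def)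

lemma subspace_real_outer: "subspace real_outer"
proof (rule subspaceI)
  fix x y assume *: "x \<in> real_outer" "y \<in> real_outer"
  have "x $ i * \<phi> i 0 = x $ j * \<phi> j 0" "y $ i * \<phi> i 0 = y $ j * \<phi> j 0" for i j
    using * unfolding real_outer_def by blast+
  from arg_cong2[where f = "(+)", OF this] show "x + y \<in> real_outer"
    using * by (auto simp: real_outer_def distrib_right sum.distrib)
next
  fix x c assume *: "x \<in> real_outer"
  have "x $ i * \<phi> i 0 = x $ j * \<phi> j 0" for i j
    using * unfolding real_outer_def by blast
  from arg_cong[where f = "(*) c", OF this] show "c *\<^sub>R x \<in> real_outer"
    using * by (auto simp: real_outer_def mult.assoc sum_distrib_left[symmetric])
qed (simp add: real_outer_def)

lemma outer_star_solution:
  assumes "p \<in> outer"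
  shows "star_solution q (\<lambda>j s. p $ j * of_real (\<phi> j s)) (\<lambda>j s. p $ j * of_real (\<phi>1 j s))"
  using assms edge_solution_scale[OF \<phi>_sol]
  by (auto simp: star_solution_def kirchhoff_def outer_def)

lemma star_solution_neumann:
  assumes u: "star_solution q u u1" and "\<And>j. u1 j 1 = 0"
  shows "s \<in> {0..1} \<Longrightarrow> u j s = u j 1 * of_real (\<phi> j s)" "(\<chi> j. u j 1) \<in> outer"
proof -
  have eq: "u j s = u j 1 * of_real (\<phi> j s)" "u1 j s = u j 1 * of_real (\<phi>1 j s)" if "s \<in> {0..1}" for j s
  proof -
    have "edge_solution (q j) (u j) (u1 j)" using u by (simp add: star_solution_def)
    note edge_solution_unique[OF this edge_solution_scale[OF \<phi>_sol, where c = "u j 1"] q_cont _ _ that]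
    then show "u j s = u j 1 * of_real (\<phi> j s)" "u1 j s = u j 1 * of_real (\<phi>1 j s)"
      using assms(2) \<phi>_end by simp_all
  qed
  then show "s \<in> {0..1} \<Longrightarrow> u j s = u j 1 * of_real (\<phi> j s)" by blast
  have "u j 0 = u j 1 * of_real (\<phi> j 0)" "u1 j 0 = u j 1 * of_real (\<phi>1 j 0)" for j
    using eq[of 0] by auto
  then show "(\<chi> j. u j 1) \<in> outer"
    using u unfolding star_solution_def kirchhoff_def outer_def by auto
qed

text \<open>Uniqueness is available from the outer end, so the centre is reached by a Wronskian:
  with the solution of outer data 0 and 1 it equals -1 at the outer end, is constant, and would
  vanish at the centre.\<close>

lemma \<phi>_initial_nonzero: "\<phi> j 0 \<noteq> 0 \<or> \<phi>1 j 0 \<noteq> 0"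
proof (rule ccontr)
  assume *: "\<not> ?thesis"
  obtain v v1 where v: "edge_solution (q j) v v1" "v 1 = 0" "v1 1 = 1"
    using edge_solution_exists[OF q_cont] by metis
  obtain A B where "\<And>s. s \<in> {0..1} \<Longrightarrow> norm (complex_of_real (\<phi> j s)) \<le> A"
    "\<And>s. s \<in> {0..1} \<Longrightarrow> norm (v s) \<le> B"
    using edge_solution_bounded[OF \<phi>_sol[of j]] edge_solution_bounded[OF v(1)] by metis
  from edge_green[OF \<phi>_sol[of j] v(1) _ this, of 0] v * \<phi>_end show False by simp
qed

text \<open>Excludes triple eigenvalues. If the first basis vector were admissible, comparing edges
  1 and 2 would give \<open>\<phi> 1 0 = 0\<close>, and the flux condition
  \<open>\<phi>1 1 0 = 0\<close>.\<close>

lemma real_outer_proper: "dim real_outer \<noteq> 3"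
proof
  assume "dim real_outer = 3"
  then have U: "real_outer = UNIV"
    using dim_eq_full[of real_outer] span_eq_iff[of real_outer] subspace_real_outer by simp
  have "(axis 1 1 :: real ^ 3) $ 1 * \<phi> 1 0 = (axis 1 1 :: real ^ 3) $ 2 * \<phi> 2 0"
    "(\<Sum>j\<in>UNIV. (axis 1 1 :: real ^ 3) $ j * \<phi>1 j 0) = 0"
    using U unfolding real_outer_def by blast+
  then show False
    using \<phi>_initial_nonzero[of 1] by (simp add: axis_def sum_3)
qed

end

section \<open>Eigenspaces, types of resonance and the coupling vector\<close>

locale resonance = neumann_star "\<lambda>j s. \<alpha> * Q j s" \<phi> \<phi>1
  for Q :: "real star_fun" and \<alpha> :: real and \<phi> \<phi>1 :: "real star_fun"
begin

definition lift :: "complex ^ 3 \<Rightarrow> complex star_fun" where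
  "lift p = (\<lambda>j s. if s \<in> {0..1} then p $ j * of_real (\<phi> j s) else 0)"

definition real_lift :: "real ^ 3 \<Rightarrow> real star_fun" where
  "real_lift x = (\<lambda>j s. if s \<in> {0..1} then x $ j * \<phi> j s else 0)"

lemma real_star_real_lift: "real_star (real_lift x) = lift (cvec x)"
  by (auto simp: real_star_def real_lift_def lift_def cvec_def fun_eq_iff)

lemma outer_values_real_lift: "outer_values (real_lift x) = x"
  by (simp add: outer_values_def real_lift_def \<phi>_end)

lemma lift_end: "lift p j 1 = p $ j"
  by (simp add: lift_def \<phi>_end)

lemma lift_eq_iff: "lift p = lift p' \<longleftrightarrow> p = p'"
  by (metis lift_end vec_eq_iff)

lemma lift_add: "lift (p + p') = lift p + lift p'"
  by (auto simp: lift_def fun_eq_iff algebra_simps)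

lemma lift_scale: "star_scale c (lift p) = lift (\<chi> j. c * p $ j)"
  by (auto simp: lift_def star_scale_def fun_eq_iff)

lemma lift_zero: "lift 0 = 0"
  by (auto simp: lift_def fun_eq_iff)

lemma lift_in_eigenspace:
  assumes "p \<in> outer" shows "lift p \<in> eigenspace Q \<alpha>"
proof -
  have "edge_solution (\<lambda>s. \<alpha> * Q j s) (lift p j) (\<lambda>s. p $ j * of_real (\<phi>1 j s))" for j
  proof -
    have "edge_solution (\<lambda>s. \<alpha> * Q j s) (\<lambda>s. p $ j * of_real (\<phi> j s)) (\<lambda>s. p $ j * of_real (\<phi>1 j s))"
      using outer_star_solution[OF assms] by (simp add: star_solution_def)
    then show ?thesis
      unfolding edge_solution_def lift_def
      by (auto intro: has_vector_derivative_transform[rotated 2])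
  qed
  then have "star_solution (\<lambda>j s. \<alpha> * Q j s) (lift p) (\<lambda>j s. p $ j * of_real (\<phi>1 j s))"
    using outer_star_solution[OF assms] by (simp add: star_solution_def lift_def)
  then show ?thesis
    unfolding eigenspace_iff by (auto simp: \<phi>_end lift_def)
qed

lemma eigenspace_eq: "eigenspace Q \<alpha> = lift ` outer"
proof
  show "eigenspace Q \<alpha> \<subseteq> lift ` outer"
  proof
    fix g assume g: "g \<in> eigenspace Q \<alpha>"
    then obtain g1 where g1: "star_solution (\<lambda>j s. \<alpha> * Q j s) g g1" "\<And>j. g1 j 1 = 0"
      unfolding eigenspace_iff by auto
    have "g j s = lift (\<chi> j. g j 1) j s" for j s
    proof (cases "s \<in> {0..1}")
      case True
      then show ?thesis
        using star_solution_neumann(1)[OF g1 True, of j] by (simp only: lift_def if_True vec_lambda_beta)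
    next
      case False
      then show ?thesis using g unfolding eigenspace_iff lift_def by (simp only: if_False) blast
    qed
    then have "g = lift (\<chi> j. g j 1)" by blast
    then show "g \<in> lift ` outer" using star_solution_neumann(2)[OF g1] by blast
  qed
qed (use lift_in_eigenspace in auto)

lemma real_star_in_eigenspace:
  assumes "real_star u \<in> eigenspace Q \<alpha>"
  shows "outer_values u \<in> real_outer"
proof -
  obtain p where p: "p \<in> outer" "real_star u = lift p"
    using assms unfolding eigenspace_eq by auto
  have "p $ j = of_real (u j 1)" for j
    using lift_end[of p j] unfolding p(2)[symmetric] by (simp add: real_star_def)
  then have "p = cvec (outer_values u)"
    by (simp add: cvec_def outer_values_def vec_eq_iff)
  then show ?thesis using p by simp
qed

lemma star_independent_single:
  "x \<noteq> 0 \<Longrightarrow> star.independent {lift (cvec x)}"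
proof -
  assume "x \<noteq> 0"
  then have "cvec x \<noteq> 0" by (auto simp: cvec_def vec_eq_iff)
  then have "lift (cvec x) \<noteq> 0" using lift_eq_iff lift_zero by metis
  then show ?thesis by simp
qed

text \<open>A complex proportionality between real vectors has a real one as its real part, and
  nonzero orthogonal vectors are not proportional.\<close>

lemma star_independent_pair:
  assumes x: "x \<noteq> 0" and y: "y \<noteq> 0" and xy: "inner x y = 0"
  shows "star.independent {lift (cvec x), lift (cvec y)}" "lift (cvec x) \<noteq> lift (cvec y)"
proof -
  show ne: "lift (cvec x) \<noteq> lift (cvec y)"
  proof
    assume "lift (cvec x) = lift (cvec y)"
    then have "Re_vec (cvec x) = Re_vec (cvec y)" by (simp add: lift_eq_iff)
    then show False using x xy by simp
  qed
  have "lift (cvec x) \<notin> star.span {lift (cvec y)}"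
  proof
    assume "lift (cvec x) \<in> star.span {lift (cvec y)}"
    then obtain c where "lift (cvec x) = star_scale c (lift (cvec y))"
      by (auto simp: star.span_singleton)
    then have *: "cvec x = (\<chi> j. c * cvec y $ j)" by (simp add: lift_scale lift_eq_iff)
    have "x $ j = Re c * y $ j" for j
      using arg_cong[OF *, of "\<lambda>v. Re (v $ j)"] by (simp add: cvec_def)
    then have "x = Re c *\<^sub>R y" by (simp add: vec_eq_iff)
    with xy x y show False by simp
  qed
  then show "star.independent {lift (cvec x), lift (cvec y)}"
    using star_independent_single[OF y] by (simp add: star.independent_insert)
qed

lemma outer_decomp: "p = cvec (Re_vec p) + (\<chi> j. \<i> * cvec (Im_vec p) $ j)"
  by (simp add: vec_eq_iff cvec_def Re_vec_def Im_vec_def complex_eq[symmetric])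

lemma subspace_eigenspace: "star.subspace (eigenspace Q \<alpha>)"
proof (rule star.subspaceI)
  show "0 \<in> eigenspace Q \<alpha>"
    unfolding eigenspace_eq lift_zero[symmetric] by (auto simp: outer_def)
next
  fix f g assume "f \<in> eigenspace Q \<alpha>" "g \<in> eigenspace Q \<alpha>"
  then obtain p p' where "p \<in> outer" "p' \<in> outer" "f = lift p" "g = lift p'"
    unfolding eigenspace_eq by auto
  moreover have add: "Re_vec (p + p') = Re_vec p + Re_vec p'" "Im_vec (p + p') = Im_vec p + Im_vec p'"
    by (simp_all add: Re_vec_def Im_vec_def vec_eq_iff)
  have "p + p' \<in> outer"
    using \<open>p \<in> outer\<close> \<open>p' \<in> outer\<close> subspace_add[OF subspace_real_outer]
    by (simp add: outer_iff add)
  ultimately show "f + g \<in> eigenspace Q \<alpha>"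
    unfolding eigenspace_eq by (auto simp: lift_add[symmetric])
next
  fix f c assume "f \<in> eigenspace Q \<alpha>"
  then obtain p where p: "p \<in> outer" "f = lift p"
    unfolding eigenspace_eq by auto
  have eq: "p $ i * of_real (\<phi> i 0) = p $ j * of_real (\<phi> j 0)" for i j
    using p unfolding outer_def by blast
  have "(\<chi> j. c * p $ j) \<in> outer"
    using p arg_cong[OF eq, of "(*) c"] by (auto simp: outer_def mult.assoc sum_distrib_left[symmetric])
  then show "star_scale c f \<in> eigenspace Q \<alpha>"
    unfolding eigenspace_eq p(2) lift_scale by blast
qed

lemma lift_in_span:
  assumes "real_outer = span B" "p \<in> outer"
  shows "lift p \<in> star.span ((\<lambda>x. lift (cvec x)) ` B)"
proof -
  have r: "lift (cvec x) \<in> star.span ((\<lambda>x. lift (cvec x)) ` B)" if "x \<in> span B" for x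
    using that
  proof (induction rule: span_induct_alt)
    case base
    have "cvec 0 = 0" by (simp add: cvec_def vec_eq_iff)
    then show ?case using star.span_zero lift_zero by metis
  next
    case (step c x y)
    have "cvec (c *\<^sub>R x + y) = (\<chi> j. of_real c * cvec x $ j) + cvec y"
      by (simp add: cvec_def vec_eq_iff)
    then have "lift (cvec (c *\<^sub>R x + y)) = star_scale (of_real c) (lift (cvec x)) + lift (cvec y)"
      by (simp add: lift_add lift_scale)
    moreover have "lift (cvec x) \<in> star.span ((\<lambda>x. lift (cvec x)) ` B)"
      using step(1) by (intro star.span_base) simp
    ultimately show ?case
      using step(2) star.span_add star.span_scale by metis
  qed
  have "lift p = lift (cvec (Re_vec p)) + star_scale \<i> (lift (cvec (Im_vec p)))"
    by (subst outer_decomp) (simp add: lift_add lift_scale)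
  with r[of "Re_vec p"] r[of "Im_vec p"] assms show ?thesis
    by (auto simp: outer_iff intro!: star.span_add star.span_scale)
qed

text \<open>Together with the independence lemmas this identifies the complex
  \<open>star.dim\<close> of the eigenspace with the real dimension of \<open>real_outer\<close>,
  which is what decides the type of the resonance.\<close>

lemma span_lift_basis:
  assumes "real_outer = span B"
  shows "star.span ((\<lambda>x. lift (cvec x)) ` B) = eigenspace Q \<alpha>"
proof
  have "(\<lambda>x. lift (cvec x)) ` B \<subseteq> eigenspace Q \<alpha>"
    using assms by (auto intro!: lift_in_eigenspace span_base)
  then show "star.span ((\<lambda>x. lift (cvec x)) ` B) \<subseteq> eigenspace Q \<alpha>"
    using star.span_minimal subspace_eigenspace by blast
  show "eigenspace Q \<alpha> \<subseteq> star.span ((\<lambda>x. lift (cvec x)) ` B)"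
    unfolding eigenspace_eq using lift_in_span[OF assms] by blast
qed

text \<open>The dimension of \<open>real_outer\<close> is 0, 1 or 2. The basis is taken orthonormal
  so that in the double case the cross product of its members has norm one, as the normalization of
  the coupling vector demands.\<close>

lemma resonance_cases:
  obtains (none) "real_outer = {0}" "\<alpha> \<notin> resonant_set Q"
  | (simple) x where "norm x = 1" "real_outer = span {x}"
      "\<alpha> \<in> simple_resonances Q" "\<alpha> \<notin> double_resonances Q"
  | (double) x y where "norm x = 1" "norm y = 1" "inner x y = 0" "real_outer = span {x, y}"
      "\<alpha> \<in> double_resonances Q" "\<alpha> \<notin> simple_resonances Q"
proof -
  obtain B where B: "B \<subseteq> real_outer" "pairwise orthogonal B" "\<And>x. x \<in> B \<Longrightarrow> norm x = 1"
    "independent B" "card B = dim real_outer" "span B = real_outer"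
    using orthonormal_basis_subspace[OF subspace_real_outer] by metis
  have sE: "star.span (eigenspace Q \<alpha>) = eigenspace Q \<alpha>"
    using subspace_eigenspace by (simp add: star.span_eq_iff)
  have "dim real_outer \<le> 3" using dim_subset_UNIV[of real_outer] by simp
  then consider "card B = 0" | "card B = 1" | "card B = 2"
    using real_outer_proper B(5) by linarith
  then show thesis
  proof cases
    case 1
    then have "B = {}" using independent_imp_finite[OF B(4)] by simp
    then have R: "real_outer = {0}" using B(6) by simp
    then have "eigenspace Q \<alpha> = {0}"
      using span_lift_basis[of "{}"] by simp
    then show thesis using none R by (auto simp: resonant_set_def)
  next
    case 2
    then obtain x where x: "B = {x}" by (auto simp: card_1_singleton_iff)
    have nx: "norm x = 1" using B x by simp
    then have "x \<noteq> 0" by auto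
    have R: "real_outer = span {x}" using B x by simp
    have s: "star.span {lift (cvec x)} = eigenspace Q \<alpha>" using span_lift_basis[OF R] by simp
    have ind: "star.independent {lift (cvec x)}" using star_independent_single[OF \<open>x \<noteq> 0\<close>] .
    have "star.dim (eigenspace Q \<alpha>) = 1"
      using star.dim_eq_card[OF trans[OF s sE[symmetric]] ind] by simp
    moreover have "lift (cvec x) \<in> eigenspace Q \<alpha>" unfolding s[symmetric] by (rule star.span_base) simp
    ultimately show thesis
      using simple[OF nx R] ind
      by (auto simp: simple_resonances_def double_resonances_def resonant_set_def)
  next
    case 3
    then obtain x y where x: "B = {x, y}" "x \<noteq> y" by (auto simp: card_2_iff)
    have nx: "norm x = 1" "norm y = 1" using B x by simp_all
    then have nz: "x \<noteq> 0" "y \<noteq> 0" by auto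
    have xy: "inner x y = 0" using B(2) x by (auto simp: pairwise_insert orthogonal_def)
    have R: "real_outer = span {x, y}" using B x by simp
    have s: "star.span {lift (cvec x), lift (cvec y)} = eigenspace Q \<alpha>" using span_lift_basis[OF R] by simp
    note ind = star_independent_pair[OF nz xy]
    have "card {lift (cvec x), lift (cvec y)} = 2" using ind(2) by simp
    then have "star.dim (eigenspace Q \<alpha>) = 2"
      unfolding star.dim_eq_card[OF trans[OF s sE[symmetric]] ind(1)] .
    moreover have "lift (cvec x) \<in> eigenspace Q \<alpha>" unfolding s[symmetric] by (rule star.span_base) simp
    moreover have "lift (cvec x) \<noteq> 0" using star_independent_single[OF nz(1)] by simp
    ultimately show thesis
      using double[OF nx xy R]
      by (auto simp: simple_resonances_def double_resonances_def resonant_set_def)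
  qed
qed

text \<open>\<open>coupling_vector\<close> is a choice, so its property becomes available only after
  one witness is exhibited: the lift of a unit vector of \<open>real_outer\<close>.\<close>

lemma coupling_vector_simple:
  assumes "\<alpha> \<in> simple_resonances Q" "\<alpha> \<notin> double_resonances Q" "norm x = 1" "x \<in> real_outer"
  shows "simple_coupling Q \<alpha> (coupling_vector Q \<alpha>)"
proof -
  have "lift (cvec x) \<noteq> 0"
    using assms(3) star_independent_single[of x] by fastforce
  then have "simple_coupling Q \<alpha> x"
    unfolding simple_coupling_def using assms
    by (intro exI[of _ "real_lift x"]) (simp add: real_star_real_lift outer_values_real_lift lift_in_eigenspace)
  with assms(1,2) have "(\<alpha> \<in> simple_resonances Q \<longrightarrow> simple_coupling Q \<alpha> (x)) \<and>
      (\<alpha> \<in> double_resonances Q \<longrightarrow> double_coupling Q \<alpha> (x))"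
    by blast
  from someI[of "\<lambda>\<theta>. (\<alpha> \<in> simple_resonances Q \<longrightarrow> simple_coupling Q \<alpha> \<theta>) \<and>
      (\<alpha> \<in> double_resonances Q \<longrightarrow> double_coupling Q \<alpha> \<theta>)", OF this, folded coupling_vector_def]
  show ?thesis using assms(1) by blast
qed

lemma coupling_vector_double:
  assumes "\<alpha> \<in> double_resonances Q" "\<alpha> \<notin> simple_resonances Q"
    and xy: "norm x = 1" "norm y = 1" "inner x y = 0" and R: "real_outer = span {x, y}"
  shows "double_coupling Q \<alpha> (coupling_vector Q \<alpha>)"
proof -
  \<comment> \<open>Lagrange's identity for an orthonormal pair.\<close>
  have "(norm (cross3 x y))\<^sup>2 = 1"
    using norm_cross[of x y] xy by simp
  then have "norm (cross3 x y) = 1" by (simp add: power2_eq_1_iff) (smt (verit) norm_ge_zero)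
  moreover have "x \<noteq> 0" "y \<noteq> 0" using xy by auto
  note star_independent_pair[OF this xy(3)]
  moreover have "star.span {lift (cvec x), lift (cvec y)} = eigenspace Q \<alpha>"
    using span_lift_basis[OF R] by simp
  ultimately have "double_coupling Q \<alpha> (cross3 x y)"
    unfolding double_coupling_def
    by (intro exI[of _ "real_lift x"] exI[of _ "real_lift y"])
      (simp add: real_star_real_lift outer_values_real_lift)
  with assms(1,2) have "(\<alpha> \<in> simple_resonances Q \<longrightarrow> simple_coupling Q \<alpha> (cross3 x y)) \<and>
      (\<alpha> \<in> double_resonances Q \<longrightarrow> double_coupling Q \<alpha> (cross3 x y))"
    by blast
  from someI[of "\<lambda>\<theta>. (\<alpha> \<in> simple_resonances Q \<longrightarrow> simple_coupling Q \<alpha> \<theta>) \<and>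
      (\<alpha> \<in> double_resonances Q \<longrightarrow> double_coupling Q \<alpha> \<theta>)", OF this, folded coupling_vector_def]
  show ?thesis using assms(1) by blast
qed

text \<open>The vector \<open>\<theta>\<close> comes from some unknown basis \<open>v\<close>,
  \<open>w\<close> of the eigenspace, not from \<open>x\<close> and \<open>y\<close>. As a cross
  product it is orthogonal to everything that \<open>v\<close> and \<open>w\<close> span at the
  outer end; since both sides are planes, inclusion is equality.\<close>

lemma real_outer_double:
  assumes "double_coupling Q \<alpha> \<theta>" and xy: "norm x = 1" "norm y = 1" "inner x y = 0"
    and R: "real_outer = span {x, y}"
  shows "real_outer = {z. inner \<theta> z = 0}"
proof (rule subspace_dim_equal[OF subspace_real_outer])
  obtain v w where span: "star.span {real_star v, real_star w} = eigenspace Q \<alpha>"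
    and \<theta>: "\<theta> = cross3 (outer_values v) (outer_values w)" "norm \<theta> = 1"
    using assms(1) unfolding double_coupling_def by blast
  show "real_outer \<subseteq> {z. inner \<theta> z = 0}"
  proof clarify
    fix z assume "z \<in> real_outer"
    then have "lift (cvec z) \<in> star.span {real_star v, real_star w}"
      unfolding span by (simp add: lift_in_eigenspace)
    then obtain c d where "lift (cvec z) - star_scale c (real_star v) = star_scale d (real_star w)"
      by (auto simp: star.span_breakdown_eq star.span_singleton)
    \<comment> \<open>Evaluation at the outer end turns a relation between eigenfunctions into one
      between outer values; its real part has real coefficients.\<close>
    from fun_cong[OF fun_cong[OF this], of _ 1]
    have eq: "lift (cvec z) j 1 - star_scale c (real_star v) j 1 = star_scale d (real_star w) j 1" for j
      by simp
    have "z = Re c *\<^sub>R outer_values v + Re d *\<^sub>R outer_values w"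
      using arg_cong[OF eq, of Re]
      by (simp add: vec_eq_iff lift_end cvec_def star_scale_def real_star_def outer_values_def algebra_simps)
    then show "inner \<theta> z = 0"
      by (simp add: \<theta>(1) inner_add_right dot_cross_self)
  qed
  show "subspace {z. inner \<theta> z = 0}" by (simp add: subspace_hyperplane)
  have "x \<noteq> 0" "y \<noteq> 0" using xy by auto
  then have "x \<noteq> y" "independent {x, y}"
    using \<open>x \<noteq> 0\<close> \<open>y \<noteq> 0\<close> xy pairwise_orthogonal_independent[of "{x, y}"]
    by (auto simp: pairwise_insert orthogonal_def inner_commute)
  then have "dim real_outer = 2"
    unfolding R by (simp add: dim_eq_card_independent)
  moreover have "\<theta> \<noteq> 0" using \<theta>(2) by auto
  ultimately show "dim {z. inner \<theta> z = 0} \<le> dim real_outer"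
    using dim_hyperplane[of \<theta>] by simp
qed

text \<open>From here on the type of the resonance and the choice of \<open>\<theta>\<close> no
  longer matter.\<close>

lemma limit_vertex_conditions_iff:
  "limit_vertex_conditions Q \<alpha> \<psi> \<longleftrightarrow>
     (\<chi> j. \<psi> j 0) \<in> outer \<and> (\<forall>w\<in>outer. (\<Sum>j\<in>UNIV. w $ j * deriv_a \<psi> j) = 0)"
proof (cases rule: resonance_cases)
  case none
  have "outer = {0}"
    unfolding set_eq_iff outer_iff none(1) by (auto simp: Re_vec_def Im_vec_def vec_eq_iff complex_eq_iff)
  moreover have "\<alpha> \<notin> simple_resonances Q" "\<alpha> \<notin> double_resonances Q"
    using none by (auto simp: simple_resonances_def double_resonances_def)
  ultimately show ?thesis
    using none by (simp add: limit_vertex_conditions_def vec_eq_iff)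
next
  case (simple x)
  define \<theta> where "\<theta> = coupling_vector Q \<alpha>"
  have "simple_coupling Q \<alpha> \<theta>"
    unfolding \<theta>_def using simple by (intro coupling_vector_simple[of x]) (auto intro: span_base)
  then obtain u where u: "real_star u \<in> eigenspace Q \<alpha>" "\<theta> = outer_values u" "norm \<theta> = 1"
    unfolding simple_coupling_def by blast
  \<comment> \<open>The chosen vector need not be \<open>x\<close>, but real eigenfunctions have
    their outer values on the same line, so only a nonzero factor is at stake.\<close>
  have "\<theta> \<in> span {x}" using real_star_in_eigenspace[OF u(1)] u simple by simp
  then obtain r where r: "\<theta> = r *\<^sub>R x" by (auto simp: span_singleton)
  then have "r \<noteq> 0" using u by auto
  have R: "z \<in> real_outer \<longleftrightarrow> (\<exists>c. z = c *\<^sub>R \<theta>)" for z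
  proof
    assume "z \<in> real_outer"
    then obtain c where "z = c *\<^sub>R x" using simple by (auto simp: span_singleton)
    then have "z = (c / r) *\<^sub>R \<theta>" using r \<open>r \<noteq> 0\<close> by simp
    then show "\<exists>c. z = c *\<^sub>R \<theta>" ..
  qed (use r simple in \<open>auto simp: span_singleton\<close>)
  have V: "p \<in> outer \<longleftrightarrow> (\<exists>c. \<forall>j. p $ j = c * of_real (\<theta> $ j))" for p
  proof
    assume "p \<in> outer"
    then obtain c d where "Re_vec p = c *\<^sub>R \<theta>" "Im_vec p = d *\<^sub>R \<theta>"
      unfolding outer_iff R by blast
    then have "p $ j = Complex c d * of_real (\<theta> $ j)" for j
      by (simp add: vec_eq_iff Re_vec_def Im_vec_def complex_eq_iff)
    then show "\<exists>c. \<forall>j. p $ j = c * of_real (\<theta> $ j)" by blast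
  next
    assume "\<exists>c. \<forall>j. p $ j = c * of_real (\<theta> $ j)"
    then obtain c where "\<And>j. p $ j = c * of_real (\<theta> $ j)" by blast
    then have "Re_vec p = Re c *\<^sub>R \<theta>" "Im_vec p = Im c *\<^sub>R \<theta>"
      by (simp_all add: vec_eq_iff Re_vec_def Im_vec_def)
    then show "p \<in> outer" unfolding outer_iff R by blast
  qed
  have "(\<forall>w\<in>outer. (\<Sum>j\<in>UNIV. w $ j * d j) = 0) \<longleftrightarrow> (\<Sum>j\<in>UNIV. of_real (\<theta> $ j) * d j) = 0" for d
  proof
    assume *: "\<forall>w\<in>outer. (\<Sum>j\<in>UNIV. w $ j * d j) = 0"
    have "cvec \<theta> \<in> outer" unfolding V by (intro exI[of _ 1]) (simp add: cvec_def)
    with * show "(\<Sum>j\<in>UNIV. of_real (\<theta> $ j) * d j) = 0" by (auto simp: cvec_def)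
  qed (auto simp: V mult.assoc sum_distrib_left[symmetric])
  moreover have "\<alpha> \<in> resonant_set Q" using simple by (simp add: simple_resonances_def)
  ultimately show ?thesis
    using simple by (simp add: limit_vertex_conditions_def V \<theta>_def[symmetric])
next
  case (double x y)
  define \<theta> where "\<theta> = coupling_vector Q \<alpha>"
  have dc: "double_coupling Q \<alpha> \<theta>"
    unfolding \<theta>_def by (rule coupling_vector_double[OF double(5,6,1-4)])
  then have n: "norm \<theta> = 1" unfolding double_coupling_def by blast
  have R: "real_outer = {z. inner \<theta> z = 0}"
    by (rule real_outer_double[OF dc double(1-4)])
  have V: "p \<in> outer \<longleftrightarrow> (\<Sum>j\<in>UNIV. of_real (\<theta> $ j) * p $ j) = 0" for p
    unfolding outer_iff R by (simp add: inner_vec_def Re_vec_def Im_vec_def complex_eq_iff)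
  have "(\<forall>w\<in>outer. (\<Sum>j\<in>UNIV. w $ j * d j) = 0) \<longleftrightarrow> (\<exists>c. \<forall>j. d j = c * of_real (\<theta> $ j))" for d
  proof
    assume *: "\<forall>w\<in>outer. (\<Sum>j\<in>UNIV. w $ j * d j) = 0"
    define c where "c = (\<Sum>j\<in>UNIV. of_real (\<theta> $ j) * d j)"
    \<comment> \<open>\<open>e\<close> is the part of \<open>d\<close> orthogonal to
      \<open>\<theta>\<close>. The pairing is bilinear, so \<open>e\<close> is tested against its
      conjugate, which lies in \<open>outer\<close> because \<open>\<theta>\<close> is real; the
      outcome is the sum of the squared moduli of \<open>e\<close>.\<close>
    define e where "e j = d j - c * of_real (\<theta> $ j)" for j
    have "(\<Sum>j\<in>UNIV. \<theta> $ j * \<theta> $ j) = 1"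
      using n by (simp add: norm_eq_1 inner_vec_def)
    then have one: "(\<Sum>j\<in>UNIV. of_real (\<theta> $ j) * complex_of_real (\<theta> $ j)) = 1"
      by (metis (no_types, lifting) of_real_1 of_real_mult of_real_sum sum.cong)
    have "(\<Sum>j\<in>UNIV. of_real (\<theta> $ j) * e j) = c - c * (\<Sum>j\<in>UNIV. of_real (\<theta> $ j) * of_real (\<theta> $ j))"
      by (simp add: e_def c_def right_diff_distrib sum_subtractf sum_distrib_left mult_ac)
    then have te: "(\<Sum>j\<in>UNIV. of_real (\<theta> $ j) * e j) = 0" using one by simp
    then have te': "(\<Sum>j\<in>UNIV. of_real (\<theta> $ j) * cnj (e j)) = 0"
      by (metis (no_types, lifting) complex_cnj_complex_of_real complex_cnj_mult complex_cnj_zero cnj_sum sum.cong)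
    then have "(\<chi> j. cnj (e j)) \<in> outer" unfolding V by simp
    with * have "(\<Sum>j\<in>UNIV. cnj (e j) * d j) = 0" by (auto dest: bspec)
    moreover have "d j = e j + c * of_real (\<theta> $ j)" for j by (simp add: e_def)
    ultimately have "(\<Sum>j\<in>UNIV. cnj (e j) * e j) + c * (\<Sum>j\<in>UNIV. of_real (\<theta> $ j) * cnj (e j)) = 0"
      by (simp add: distrib_left sum.distrib sum_distrib_left mult_ac)
    then have "(\<Sum>j\<in>UNIV. complex_of_real ((cmod (e j))\<^sup>2)) = 0"
      using te' by (simp add: complex_norm_square mult_ac del: of_real_power)
    then have "(\<Sum>j\<in>UNIV. (cmod (e j))\<^sup>2) = 0"
      unfolding of_real_sum[symmetric] of_real_eq_0_iff .
    then have "e j = 0" for j by (simp add: sum_nonneg_eq_0_iff)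
    then show "\<exists>c. \<forall>j. d j = c * of_real (\<theta> $ j)" unfolding e_def by auto
  next
    assume "\<exists>c. \<forall>j. d j = c * of_real (\<theta> $ j)"
    then obtain c where c: "\<And>j. d j = c * of_real (\<theta> $ j)" by blast
    have "(\<Sum>j\<in>UNIV. w $ j * d j) = c * (\<Sum>j\<in>UNIV. of_real (\<theta> $ j) * w $ j)" for w
      unfolding sum_distrib_left by (intro sum.cong refl) (subst c, simp add: mult_ac)
    then show "\<forall>w\<in>outer. (\<Sum>j\<in>UNIV. w $ j * d j) = 0" by (simp add: V)
  qed
  moreover have "\<alpha> \<in> resonant_set Q" using double by (simp add: double_resonances_def)
  ultimately show ?thesis
    using double by (simp add: limit_vertex_conditions_def V \<theta>_def[symmetric] conj_commute)
qed

end

subsection \<open>Rescaling the regularized problem\<close>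

lemma at_within_atLeast_neq_bot: "at x within {x..} \<noteq> (bot :: real filter)"
proof -
  have "{x<..} \<subseteq> {x..}" by auto
  from at_le[OF this, of x] show ?thesis
    using trivial_limit_at_right_real[of x] by (auto simp: bot.extremum_unique)
qed

lemma deriv_a_eq:
  assumes "(y j has_vector_derivative d) (at 0 within {0..})"
  shows "deriv_a y j = d"
  unfolding deriv_a_def using vector_derivative_within[OF at_within_atLeast_neq_bot assms] .

section \<open>Plane waves on the half-lines\<close>

definition incoming :: "real \<Rightarrow> 3 \<Rightarrow> 3 \<Rightarrow> real \<Rightarrow> complex" where
  "incoming k n m s = (if m = n then exp (- (\<i> * of_real (k * s))) else 0)"

definition outgoing :: "real \<Rightarrow> real \<Rightarrow> complex" where
  "outgoing k s = exp (\<i> * of_real (k * s))"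

lemma scattered_wave_eq: "scattered_wave k T n m s = T $ n $ m * outgoing k s + incoming k n m s"
  by (simp add: scattered_wave_def incoming_def outgoing_def)

definition scattered_wave_deriv :: "real \<Rightarrow> complex ^ 3 ^ 3 \<Rightarrow> 3 \<Rightarrow> complex star_fun" where
  "scattered_wave_deriv k T n m s = \<i> * of_real k * (T $ n $ m * outgoing k s - incoming k n m s)"

lemma incoming_deriv: "(incoming k n m has_vector_derivative - (\<i> * of_real k * incoming k n m s)) (at s within S)"
proof (cases "m = n")
  case True
  have "((\<lambda>z. exp (- (\<i> * (of_real k * z)))) has_field_derivative
      - (\<i> * of_real k * exp (- (\<i> * (of_real k * of_real s))))) (at (of_real s))"
    by (auto intro!: derivative_eq_intros)
  from has_vector_derivative_real_field[OF this] True show ?thesis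
    by (auto simp: incoming_def[abs_def] intro: has_vector_derivative_at_within)
qed (simp add: incoming_def[abs_def])

lemma outgoing_deriv: "(outgoing k has_vector_derivative \<i> * of_real k * outgoing k s) (at s within S)"
proof -
  have "((\<lambda>z. exp (\<i> * (of_real k * z))) has_field_derivative
      \<i> * of_real k * exp (\<i> * (of_real k * of_real s))) (at (of_real s))"
    by (auto intro!: derivative_eq_intros)
  from has_vector_derivative_real_field[OF this] show ?thesis
    by (auto simp: outgoing_def[abs_def] intro: has_vector_derivative_at_within)
qed

lemma scattered_wave_deriv:
  "(scattered_wave k T n m has_vector_derivative scattered_wave_deriv k T n m s) (at s within S)"
  "(scattered_wave_deriv k T n m has_vector_derivative - (of_real (k\<^sup>2)) * scattered_wave k T n m s) (at s within S)"
proof -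
  have "((\<lambda>s. T $ n $ m * outgoing k s + incoming k n m s) has_vector_derivative
      T $ n $ m * (\<i> * of_real k * outgoing k s) + - (\<i> * of_real k * incoming k n m s)) (at s within S)"
    by (intro has_vector_derivative_add has_vector_derivative_mult_right incoming_deriv outgoing_deriv)
  then show "(scattered_wave k T n m has_vector_derivative scattered_wave_deriv k T n m s) (at s within S)"
    by (simp add: scattered_wave_eq[abs_def] scattered_wave_deriv_def algebra_simps)
  have "((\<lambda>s. \<i> * of_real k * (T $ n $ m * outgoing k s - incoming k n m s)) has_vector_derivative
      \<i> * of_real k * (T $ n $ m * (\<i> * of_real k * outgoing k s) - - (\<i> * of_real k * incoming k n m s))) (at s within S)"
    by (intro has_vector_derivative_diff has_vector_derivative_mult_right incoming_deriv outgoing_deriv)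
  then show "(scattered_wave_deriv k T n m has_vector_derivative - (of_real (k\<^sup>2)) * scattered_wave k T n m s) (at s within S)"
    by (simp add: scattered_wave_deriv_def[abs_def] scattered_wave_eq algebra_simps power2_eq_square)
qed

lemma has_vector_derivative_rescale:
  fixes f :: "real \<Rightarrow> complex"
  assumes "(f has_vector_derivative f') (at (c * s) within (*) c ` S)"
  shows "((\<lambda>s. f (c * s)) has_vector_derivative of_real c * f') (at s within S)"
proof -
  have "((*) c has_vector_derivative c) (at s within S)"
    by (auto intro!: derivative_eq_intros)
  from vector_diff_chain_within[OF this assms] show ?thesis
    by (simp add: o_def scaleR_conv_of_real)
qed

text \<open>Both pieces are Lipschitz, and matching values make the glued function Lipschitz even if
  its derivative jumps at \<open>e\<close>. The same statement therefore serves a solution and its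
  derivative. Passing to \<open>max e R\<close> covers \<open>R\<close> below
  \<open>e\<close>.\<close>

lemma C1_glue:
  fixes f g :: "real \<Rightarrow> complex"
  assumes e: "0 < e"
    and f: "\<And>s. s \<in> {0..e} \<Longrightarrow> (f has_vector_derivative f' s) (at s within {0..e})"
    and g: "\<And>s S. (g has_vector_derivative g' s) (at s within S)"
    and f': "continuous_on {0..e} f'" and g': "\<And>S. continuous_on S g'" and eq: "f e = g e"
  shows "abs_continuous_on_interval 0 R (\<lambda>s. if s \<le> e then f s else g s)"
proof -
  obtain L where L: "L-lipschitz_on {0..e} f" using C1_lipschitz[OF f f'] by blast
  obtain M where M: "M-lipschitz_on {e..max e R} g" using C1_lipschitz[OF g g'] by blast
  from lipschitz_on_concat_max[OF L M eq]
  have "abs_continuous_on_interval 0 (max e R) (\<lambda>s. if s \<le> e then f s else g s)"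
    by (rule lipschitz_abs_continuous)
  then show ?thesis by (rule abs_continuous_subinterval) auto
qed

text \<open>The scaling is undone up to \<open>\<epsilon>\<close> and the wave is attached beyond.
  Agreement of value and slope at \<open>\<epsilon>\<close> makes the result continuously
  differentiable.\<close>

lemma star_solution_imp_regularized:
  assumes e: "0 < \<epsilon>" and Q: "\<And>j. continuous_on {0..1} (Q j)"
    and u: "star_solution (\<lambda>j s. \<alpha> * Q j s - (\<epsilon> * k)\<^sup>2) u u1"
    and end_u: "\<And>m. u m 1 = scattered_wave k T n m \<epsilon>"
    and end_u1: "\<And>m. u1 m 1 = of_real \<epsilon> * scattered_wave_deriv k T n m \<epsilon>"
  shows "\<exists>y. regularized_solution Q \<alpha> \<epsilon> k y \<and> (\<forall>m. \<forall>s\<ge>\<epsilon>. y m s = scattered_wave k T n m s)"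
proof -
  let ?w = "scattered_wave k T n" and ?w1 = "scattered_wave_deriv k T n"
  define f where "f j s = u j (s / \<epsilon>)" for j s
  define f1 where "f1 j s = of_real (1 / \<epsilon>) * u1 j (s / \<epsilon>)" for j s
  define f2 where "f2 j s = of_real (\<alpha> * Q j (s / \<epsilon>) / \<epsilon>\<^sup>2 - k\<^sup>2) * u j (s / \<epsilon>)" for j s
  define y where "y j s = (if s \<le> \<epsilon> then f j s else ?w j s)" for j s
  define y1 where "y1 j s = (if s \<le> \<epsilon> then f1 j s else ?w1 j s)" for j s
  have sub: "(*) (1 / \<epsilon>) ` {0..\<epsilon>} \<subseteq> {0..1}" using e by (auto simp: field_simps)
  have df: "(f j has_vector_derivative f1 j s) (at s within {0..\<epsilon>})"
    "(f1 j has_vector_derivative f2 j s) (at s within {0..\<epsilon>})" if s: "s \<in> {0..\<epsilon>}" for j s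
  proof -
    have t: "(1 / \<epsilon>) * s \<in> {0..1}" using s e by (auto simp: field_simps)
    have uj: "(u j has_vector_derivative u1 j t) (at t within {0..1})"
      "(u1 j has_vector_derivative of_real (\<alpha> * Q j t - (\<epsilon> * k)\<^sup>2) * u j t) (at t within {0..1})"
      if "t \<in> {0..1}" for t
      using u that unfolding star_solution_def edge_solution_def by auto
    note du = has_vector_derivative_within_subset[OF uj(1)[OF t] sub]
    note du1 = has_vector_derivative_within_subset[OF uj(2)[OF t] sub]
    show "(f j has_vector_derivative f1 j s) (at s within {0..\<epsilon>})"
      using has_vector_derivative_rescale[OF du] by (simp add: f_def[abs_def] f1_def)
    have "((\<lambda>s. of_real (1 / \<epsilon>) * u1 j (1 / \<epsilon> * s)) has_vector_derivative of_real (1 / \<epsilon>) *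
       (of_real (1 / \<epsilon>) * (of_real (\<alpha> * Q j (1 / \<epsilon> * s) - (\<epsilon> * k)\<^sup>2) * u j (1 / \<epsilon> * s)))) (at s within {0..\<epsilon>})"
      by (intro has_vector_derivative_mult_right has_vector_derivative_rescale[OF du1])
    also have "of_real (1 / \<epsilon>) * (of_real (1 / \<epsilon>) * (of_real (\<alpha> * Q j (1 / \<epsilon> * s) - (\<epsilon> * k)\<^sup>2) * u j (1 / \<epsilon> * s)))
      = of_real ((1 / \<epsilon>) * (1 / \<epsilon>) * (\<alpha> * Q j (1 / \<epsilon> * s) - (\<epsilon> * k)\<^sup>2)) * u j (1 / \<epsilon> * s)"
      by (simp only: of_real_mult mult.assoc)
    also have "(1 / \<epsilon>) * (1 / \<epsilon>) * (\<alpha> * Q j (1 / \<epsilon> * s) - (\<epsilon> * k)\<^sup>2) = \<alpha> * Q j (s / \<epsilon>) / \<epsilon>\<^sup>2 - k\<^sup>2"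
      using e by (simp add: field_simps power2_eq_square)
    finally show "(f1 j has_vector_derivative f2 j s) (at s within {0..\<epsilon>})"
      by (simp add: f1_def[abs_def] f2_def)
  qed
  have cf: "continuous_on {0..\<epsilon>} (f j)" "continuous_on {0..\<epsilon>} (f1 j)" for j
    using continuous_on_vector_derivative[OF df(1)] continuous_on_vector_derivative[OF df(2)] by auto
  have cf2: "continuous_on {0..\<epsilon>} (f2 j)" for j
    unfolding f2_def f_def[symmetric] using e
    by (intro continuous_intros cf continuous_on_compose2[OF Q]) (auto simp: field_simps)
  have eq: "f j \<epsilon> = ?w j \<epsilon>" "f1 j \<epsilon> = ?w1 j \<epsilon>" for j
    using e by (simp_all add: f_def f1_def end_u end_u1)
  have cw: "continuous_on S (?w1 j)" "continuous_on S (\<lambda>s. - (of_real (k\<^sup>2)) * ?w j s)" for j S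
    by (rule continuous_on_vector_derivative[OF scattered_wave_deriv(2)])
      (intro continuous_on_mult_left continuous_on_vector_derivative[OF scattered_wave_deriv(1)])
  have dy: "(y j has_vector_derivative y1 j s) (at s within {0..})" if "s \<ge> 0" for j s
  proof -
    \<comment> \<open>The closures of the two pieces meet only at \<open>\<epsilon>\<close>, where
      \<open>eq\<close> makes values and slopes agree.\<close>
    have cl: "{0..\<epsilon>} \<union> closure {0..\<epsilon>} \<inter> closure {\<epsilon><..} = {0..\<epsilon>}"
      "{\<epsilon><..} \<union> closure {0..\<epsilon>} \<inter> closure {\<epsilon><..} = {\<epsilon>..}" using e by auto
    have "((\<lambda>x. if x \<in> {0..\<epsilon>} then f j x else ?w j x) has_vector_derivative
        (if s \<in> {0..\<epsilon>} then f1 j s else ?w1 j s)) (at s within {0..})"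
    proof (rule has_vector_derivative_If_within_closures[where T = "{\<epsilon><..}"], unfold cl)
      show "s \<in> {0..\<epsilon>} \<union> {\<epsilon><..}" "{0..} = {0..\<epsilon>} \<union> {\<epsilon><..}" using that e by auto
      show "f j s = ?w j s" "f1 j s = ?w1 j s" if "s \<in> closure {0..\<epsilon>}" "s \<in> closure {\<epsilon><..}"
        using that eq e by (auto simp: order_antisym)
    qed (use df scattered_wave_deriv in auto)
    also have "(if s \<in> {0..\<epsilon>} then f1 j s else ?w1 j s) = y1 j s" using that by (auto simp: y1_def)
    finally show ?thesis
      by (rule has_vector_derivative_transform[rotated 2]) (use that in \<open>auto simp: y_def\<close>)
  qed
  have y2: "\<exists>y2. (y1 j has_vector_derivative y2) (at s) \<and>
      - y2 + of_real (\<alpha> * Q_eps Q \<epsilon> j s) * y j s = of_real (k\<^sup>2) * y j s"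
    if "s > 0" "s \<noteq> \<epsilon>" for j s
  proof (cases "s < \<epsilon>")
    case True
    then have "at s within {0..\<epsilon>} = at s"
      using that by (intro at_within_interior) (auto simp: interior_atLeastAtMost_real)
    then have "(f1 j has_vector_derivative f2 j s) (at s)" using df(2)[of s] True that by auto
    then have "(y1 j has_vector_derivative f2 j s) (at s)"
      by (rule has_vector_derivative_transform_within_open[of _ _ _ "{..<\<epsilon>}"])
        (use True in \<open>auto simp: y1_def\<close>)
    moreover have "- f2 j s + of_real (\<alpha> * Q_eps Q \<epsilon> j s) * y j s = of_real (k\<^sup>2) * y j s"
      using True that by (simp add: f2_def y_def f_def Q_eps_def algebra_simps)
    ultimately show ?thesis by blast
  next
    case False
    have "(y1 j has_vector_derivative - (of_real (k\<^sup>2)) * ?w j s) (at s)"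
      by (rule has_vector_derivative_transform_within_open[OF scattered_wave_deriv(2), of "{\<epsilon><..}"])
        (use False that in \<open>auto simp: y1_def\<close>)
    moreover have "- (- (of_real (k\<^sup>2)) * ?w j s) + of_real (\<alpha> * Q_eps Q \<epsilon> j s) * y j s = of_real (k\<^sup>2) * y j s"
      using False that by (simp add: y_def Q_eps_def)
    ultimately show ?thesis by blast
  qed
  have ac: "\<forall>R>0. abs_continuous_on_interval 0 R (y j) \<and> abs_continuous_on_interval 0 R (y1 j)" for j
    using C1_glue[OF e df(1) scattered_wave_deriv(1) cf(2) cw(1) eq(1)]
      C1_glue[OF e df(2) scattered_wave_deriv(2) cf2 cw(2) eq(2)]
    by (simp add: y_def[abs_def] y1_def[abs_def])
  \<comment> \<open>The potential may jump at \<open>\<epsilon>\<close>, so the equation is claimed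
    off this single point.\<close>
  have "{\<epsilon>} \<in> null_sets lebesgue" by simp
  then have ae: "AE s in lebesgue. s > 0 \<longrightarrow> (\<exists>y2. (y1 j has_vector_derivative y2) (at s) \<and>
      - y2 + of_real (\<alpha> * Q_eps Q \<epsilon> j s) * y j s = of_real (k\<^sup>2) * y j s)" for j
    by (rule AE_I') (use y2 in blast)
  have "y j 0 = u j 0" "deriv_a y j = of_real (1 / \<epsilon>) * u1 j 0" for j
    using deriv_a_eq[of y j, OF dy[of 0 j]] e by (simp_all add: y_def y1_def f_def f1_def)
  moreover have "kirchhoff (\<lambda>j. u j 0) (\<lambda>j. u1 j 0)" using u by (simp add: star_solution_def)
  ultimately have "kirchhoff (\<lambda>j. y j 0) (deriv_a y)"
    unfolding kirchhoff_def by (simp add: sum_distrib_left[symmetric] del: of_real_divide)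
  moreover have "\<forall>j. \<exists>y1.
        (\<forall>s\<ge>0. (y j has_vector_derivative y1 s) (at s within {0..})) \<and>
        (\<forall>R>0. abs_continuous_on_interval 0 R (y j) \<and> abs_continuous_on_interval 0 R y1) \<and>
        (AE s in lebesgue. s > 0 \<longrightarrow> (\<exists>y2. (y1 has_vector_derivative y2) (at s) \<and>
           - y2 + of_real (\<alpha> * Q_eps Q \<epsilon> j s) * y j s = of_real (k\<^sup>2) * y j s))"
  proof
    fix j
    have "\<forall>s\<ge>0. (y j has_vector_derivative y1 j s) (at s within {0..})" using dy by blast
    from conjI[OF this conjI[OF ac ae]] show "\<exists>y1.
        (\<forall>s\<ge>0. (y j has_vector_derivative y1 s) (at s within {0..})) \<and>
        (\<forall>R>0. abs_continuous_on_interval 0 R (y j) \<and> abs_continuous_on_interval 0 R y1) \<and>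
        (AE s in lebesgue. s > 0 \<longrightarrow> (\<exists>y2. (y1 has_vector_derivative y2) (at s) \<and>
           - y2 + of_real (\<alpha> * Q_eps Q \<epsilon> j s) * y j s = of_real (k\<^sup>2) * y j s))"
      by (rule exI[of _ "y1 j"])
  qed
  ultimately have "regularized_solution Q \<alpha> \<epsilon> k y"
    unfolding regularized_solution_def by blast
  moreover have "y m s = ?w m s" if "s \<ge> \<epsilon>" for m s
    using that eq(1)[of m] by (cases "s = \<epsilon>") (auto simp: y_def)
  ultimately show ?thesis by blast
qed

text \<open>This direction is needed for uniqueness, where the solution is arbitrary. Below
  \<open>\<epsilon>\<close> the almost everywhere derivative of \<open>y1\<close> is a continuous
  function, and \<open>abs_continuous_ftc\<close> turns the equation into a classical one.\<close>

lemma regularized_imp_star_solution: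
  assumes e: "0 < \<epsilon>" and Q: "\<And>j. continuous_on {0..1} (Q j)"
    and y: "regularized_solution Q \<alpha> \<epsilon> k y" and w: "\<And>m s. s \<ge> \<epsilon> \<Longrightarrow> y m s = scattered_wave k T n m s"
  obtains u u1 where "star_solution (\<lambda>j s. \<alpha> * Q j s - (\<epsilon> * k)\<^sup>2) u u1"
    "\<And>m. u m 1 = scattered_wave k T n m \<epsilon>"
    "\<And>m. u1 m 1 = of_real \<epsilon> * scattered_wave_deriv k T n m \<epsilon>"
proof -
  have "\<forall>j. \<exists>y1. (\<forall>s\<ge>0. (y j has_vector_derivative y1 s) (at s within {0..})) \<and>
      abs_continuous_on_interval 0 \<epsilon> y1 \<and>
      (AE s in lebesgue. s > 0 \<longrightarrow> (\<exists>y2. (y1 has_vector_derivative y2) (at s) \<and>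
         - y2 + of_real (\<alpha> * Q_eps Q \<epsilon> j s) * y j s = of_real (k\<^sup>2) * y j s))"
    using y e unfolding regularized_solution_def by meson
  from choice[OF this] obtain y1 where y1: "\<forall>j. (\<forall>s\<ge>0. (y j has_vector_derivative y1 j s) (at s within {0..})) \<and>
      abs_continuous_on_interval 0 \<epsilon> (y1 j) \<and>
      (AE s in lebesgue. s > 0 \<longrightarrow> (\<exists>y2. (y1 j has_vector_derivative y2) (at s) \<and>
         - y2 + of_real (\<alpha> * Q_eps Q \<epsilon> j s) * y j s = of_real (k\<^sup>2) * y j s))"
    by (elim exE)
  have dy: "\<And>j s. s \<ge> 0 \<Longrightarrow> (y j has_vector_derivative y1 j s) (at s within {0..})"
    and ac: "\<And>j. abs_continuous_on_interval 0 \<epsilon> (y1 j)"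
    and ae: "\<And>j. AE s in lebesgue. s > 0 \<longrightarrow> (\<exists>y2. (y1 j has_vector_derivative y2) (at s) \<and>
         - y2 + of_real (\<alpha> * Q_eps Q \<epsilon> j s) * y j s = of_real (k\<^sup>2) * y j s)"
    using y1 by (simp_all only:)
  \<comment> \<open>Formed with \<open>Q\<close> rather than \<open>Q_eps\<close>, which is set to
    zero at both ends of the interval: this version is continuous up to the endpoints and agrees
    inside.\<close>
  define g where "g j s = of_real (\<alpha> * Q j (s / \<epsilon>) / \<epsilon>\<^sup>2 - k\<^sup>2) * y j s" for j s
  have dy': "(y j has_vector_derivative y1 j s) (at s within {0..\<epsilon>})" if "s \<in> {0..\<epsilon>}" for j s
    using that by (intro has_vector_derivative_within_subset[OF dy]) auto
  have cy: "continuous_on {0..\<epsilon>} (y j)" for j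
    using dy' by (intro continuous_on_vector_derivative) auto
  have cg: "continuous_on {0..\<epsilon>} (g j)" for j
    unfolding g_def using e
    by (intro continuous_intros cy continuous_on_compose2[OF Q]) (auto simp: field_simps)
  have dy1: "(y1 j has_vector_derivative g j s) (at s within {0..\<epsilon>})" if "s \<in> {0..\<epsilon>}" for j s
  proof (rule abs_continuous_ftc[OF ac cg _ that])
    show "AE s in lebesgue. 0 < s \<and> s < \<epsilon> \<longrightarrow> (y1 j has_vector_derivative g j s) (at s)"
      using ae[of j]
    proof eventually_elim
      case (elim s)
      show ?case
      proof
        assume s: "0 < s \<and> s < \<epsilon>"
        then obtain z where z: "(y1 j has_vector_derivative z) (at s)"
          "- z + of_real (\<alpha> * Q_eps Q \<epsilon> j s) * y j s = of_real (k\<^sup>2) * y j s"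
          using elim by blast
        then have "z = of_real (\<alpha> * Q_eps Q \<epsilon> j s) * y j s - of_real (k\<^sup>2) * y j s"
          by (simp add: algebra_simps)
        also have "\<dots> = g j s" using s by (simp add: g_def Q_eps_def left_diff_distrib)
        finally show "(y1 j has_vector_derivative g j s) (at s)" using z by simp
      qed
    qed
  qed
  have img: "(*) \<epsilon> ` {0..1} = {0..\<epsilon>}" using e by (simp add: image_mult_atLeastAtMost)
  define u where "u j t = y j (\<epsilon> * t)" for j t
  define u1 where "u1 j t = of_real \<epsilon> * y1 j (\<epsilon> * t)" for j t
  have "edge_solution (\<lambda>s. \<alpha> * Q j s - (\<epsilon> * k)\<^sup>2) (u j) (u1 j)" for j
    unfolding edge_solution_def
  proof (intro ballI conjI)
    fix t :: real assume t: "t \<in> {0..1}"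
    then have et: "\<epsilon> * t \<in> {0..\<epsilon>}" using img by blast
    show "(u j has_vector_derivative u1 j t) (at t within {0..1})"
      unfolding u_def u1_def using dy'[OF et] img by (intro has_vector_derivative_rescale) simp
    have "((\<lambda>t. of_real \<epsilon> * y1 j (\<epsilon> * t)) has_vector_derivative of_real \<epsilon> * (of_real \<epsilon> * g j (\<epsilon> * t)))
        (at t within {0..1})"
      using dy1[OF et] img
      by (intro has_vector_derivative_mult_right has_vector_derivative_rescale) simp
    moreover have "of_real \<epsilon> * (of_real \<epsilon> * g j (\<epsilon> * t)) = of_real (\<alpha> * Q j t - (\<epsilon> * k)\<^sup>2) * u j t"
    proof -
      have eq: "\<epsilon> * \<epsilon> * (\<alpha> * Q j (\<epsilon> * t / \<epsilon>) / \<epsilon>\<^sup>2 - k\<^sup>2) = \<alpha> * Q j t - (\<epsilon> * k)\<^sup>2"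
        using e by (simp add: field_simps power2_eq_square)
      have "of_real \<epsilon> * (of_real \<epsilon> * g j (\<epsilon> * t))
          = of_real (\<epsilon> * \<epsilon> * (\<alpha> * Q j (\<epsilon> * t / \<epsilon>) / \<epsilon>\<^sup>2 - k\<^sup>2)) * u j t"
        unfolding g_def u_def by (simp only: of_real_mult mult.assoc)
      then show ?thesis unfolding eq .
    qed
    ultimately show "(u1 j has_vector_derivative of_real (\<alpha> * Q j t - (\<epsilon> * k)\<^sup>2) * u j t) (at t within {0..1})"
      by (simp add: u1_def[abs_def])
  qed
  moreover have "kirchhoff (\<lambda>j. u j 0) (\<lambda>j. u1 j 0)"
  proof -
    have "deriv_a y j = y1 j 0" for j using deriv_a_eq[of y j, OF dy[of 0 j]] by simp
    moreover have "kirchhoff (\<lambda>j. y j 0) (deriv_a y)" using y unfolding regularized_solution_def by blast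
    ultimately show ?thesis unfolding kirchhoff_def u_def u1_def by (simp add: sum_distrib_left[symmetric])
  qed
  ultimately have "star_solution (\<lambda>j s. \<alpha> * Q j s - (\<epsilon> * k)\<^sup>2) u u1" by (simp add: star_solution_def)
  moreover have "u m 1 = scattered_wave k T n m \<epsilon>" for m using w by (simp add: u_def)
  moreover have "u1 m 1 = of_real \<epsilon> * scattered_wave_deriv k T n m \<epsilon>" for m
  proof -
    \<comment> \<open>The derivative of \<open>y\<close> at \<open>\<epsilon>\<close> is also its
      derivative from the right, where \<open>y\<close> is the wave.\<close>
    have "(scattered_wave k T n m has_vector_derivative y1 m \<epsilon>) (at \<epsilon> within {\<epsilon>..})"
      using e by (intro has_vector_derivative_transform[OF _ _ has_vector_derivative_within_subset[OF dy[of \<epsilon> m]]])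
        (auto simp: w)
    then have "y1 m \<epsilon> = scattered_wave_deriv k T n m \<epsilon>"
      using vector_derivative_unique_within[OF at_within_atLeast_neq_bot _ scattered_wave_deriv(1)] by blast
    then show ?thesis by (simp add: u1_def)
  qed
  ultimately show thesis using that by blast
qed

subsection \<open>Convergence of the scattering matrices\<close>

lemma star_solution_bounded:
  assumes "star_solution q u u1"
  shows "\<exists>A. \<forall>j. \<forall>s\<in>{0..1}. norm (u j s) \<le> A"
proof -
  have "\<forall>j. \<exists>A. \<forall>s\<in>{0..1}. norm (u j s) \<le> A"
    using assms edge_solution_bounded unfolding star_solution_def by blast
  then obtain A where A: "\<And>j s. s \<in> {0..1} \<Longrightarrow> norm (u j s) \<le> A j" by metis
  have "norm (u j s) \<le> (\<Sum>j\<in>UNIV. \<bar>A j\<bar>)" if "s \<in> {0..1}" for j s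
    using A[OF that, of j] member_le_sum[of j UNIV "\<lambda>j. \<bar>A j\<bar>"] by auto
  then show ?thesis by blast
qed

text \<open>Green's formula for a solution and its conjugate is conservation of the probability current.\<close>

lemma star_flux:
  assumes u: "star_solution q u u1" and \<kappa>: "\<kappa> > 0"
    and u_end: "\<And>m. u m 1 = a m + c m" "\<And>m. u1 m 1 = \<i> * of_real \<kappa> * (a m - c m)"
  shows "(\<Sum>m\<in>UNIV. (norm (a m))\<^sup>2) = (\<Sum>m\<in>UNIV. (norm (c m))\<^sup>2)"
proof -
  obtain A where A: "\<And>j s. s \<in> {0..1} \<Longrightarrow> norm (u j s) \<le> A"
    using star_solution_bounded[OF u] by blast
  have "norm (\<Sum>j\<in>UNIV. u1 j 1 * cnj (u j 1) - u j 1 * cnj (u1 j 1)) \<le> 3 * (0 * (A * A))"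
    using A by (intro star_green[OF u star_solution_cnj[OF u]]) auto
  moreover have "u1 j 1 * cnj (u j 1) - u j 1 * cnj (u1 j 1)
      = 2 * \<i> * of_real \<kappa> * of_real ((norm (a j))\<^sup>2 - (norm (c j))\<^sup>2)" for j
    unfolding u_end of_real_diff complex_norm_square by (simp add: algebra_simps)
  ultimately have "2 * \<i> * of_real \<kappa> * (\<Sum>j\<in>UNIV. complex_of_real ((norm (a j))\<^sup>2 - (norm (c j))\<^sup>2)) = 0"
    by (simp add: sum_distrib_left)
  then have "complex_of_real (\<Sum>j\<in>UNIV. (norm (a j))\<^sup>2 - (norm (c j))\<^sup>2) = 0"
    using \<kappa> by (simp only: of_real_sum) simp
  then show ?thesis by (simp only: of_real_eq_0_iff sum_subtractf right_minus_eq)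
qed

text \<open>The Kirchhoff conditions as three scalar equations. Their number equals that of the
  unknown amplitudes, so injectivity will give solvability.\<close>

definition defect :: "(3 \<Rightarrow> complex) \<Rightarrow> (3 \<Rightarrow> complex) \<Rightarrow> complex ^ 3" where
  "defect x d = vector [x 1 - x 2, x 2 - x 3, \<Sum>j\<in>UNIV. d j]"

lemma kirchhoff_iff_defect: "kirchhoff x d \<longleftrightarrow> defect x d = 0"
proof
  assume "kirchhoff x d"
  then have "x 1 = x 2" "x 2 = x 3" "(\<Sum>j\<in>UNIV. d j) = 0" unfolding kirchhoff_def by blast+
  then show "defect x d = 0"
    by (simp add: defect_def vec_eq_iff forall_3)
next
  assume "defect x d = 0"
  then have "x 1 = x 2" "x 2 = x 3" "(\<Sum>j\<in>UNIV. d j) = 0"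
    by (simp_all add: defect_def vec_eq_iff forall_3)
  then show "kirchhoff x d" unfolding kirchhoff_def by (simp add: forall_3)
qed

lemma defect_add: "defect (\<lambda>j. x j + y j) (\<lambda>j. c j + d j) = defect x c + defect y d"
  by (simp add: defect_def vec_eq_iff forall_3 sum.distrib)

lemma linear_defect: "linear (\<lambda>p :: complex ^ 3. defect (\<lambda>j. p $ j * x j) (\<lambda>j. p $ j * d j))"
  by (rule linearI)
    (simp_all add: defect_def vec_eq_iff forall_3 sum.distrib distrib_right scaleR_diff_right scaleR_sum_right)

text \<open>The edge solutions with outer data 1 and \<open>\<i> * \<kappa>\<close> or
  \<open>- \<i> * \<kappa>\<close> match waves of unit amplitude, outgoing or incoming. The
  Kirchhoff conditions become a linear system for the outgoing amplitudes. Its homogeneous solutions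
  have no incoming wave and vanish by \<open>star_flux\<close>.\<close>

lemma star_solution_scattering_exists:
  assumes q: "\<And>j. continuous_on {0..1} (q j)" and \<kappa>: "\<kappa> > 0"
  obtains u u1 a where "star_solution q u u1" "\<And>m. u m 1 = a m + c m"
    "\<And>m. u1 m 1 = \<i> * of_real \<kappa> * (a m - c m)"
proof -
  have "\<forall>j. \<exists>f f1. edge_solution (q j) f f1 \<and> f 1 = 1 \<and> f1 1 = b" for b
    using edge_solution_exists[OF q] by metis
  then obtain f f1 where f: "\<And>b j. edge_solution (q j) (f b j) (f1 b j)" "\<And>b j. f b j 1 = 1" "\<And>b j. f1 b j 1 = b"
    by metis
  define b where "b = \<i> * complex_of_real \<kappa>"
  define u where "u a c j s = a j * f b j s + c j * f (- b) j s" for a c j s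
  define u1 where "u1 a c j s = a j * f1 b j s + c j * f1 (- b) j s" for a c j s
  have edge: "edge_solution (q j) (u a c j) (u1 a c j)" for a c j
    unfolding u_def u1_def by (intro edge_solution_add edge_solution_scale f)
  have ends: "u a c m 1 = a m + c m" "u1 a c m 1 = \<i> * of_real \<kappa> * (a m - c m)" for a c m
    by (simp_all add: u_def u1_def f b_def algebra_simps)
  define G where "G p = defect (\<lambda>j. p $ j * f b j 0) (\<lambda>j. p $ j * f1 b j 0)" for p :: "complex ^ 3"
  have lin: "linear G" unfolding G_def[abs_def] by (rule linear_defect)
  have star: "star_solution q (u (($) p) c) (u1 (($) p) c) \<longleftrightarrow>
      G p + defect (\<lambda>j. c j * f (- b) j 0) (\<lambda>j. c j * f1 (- b) j 0) = 0" for p c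
    using edge by (simp add: star_solution_def kirchhoff_iff_defect G_def defect_add[symmetric] u_def u1_def)
  have "inj G"
    unfolding linear_injective_0[OF lin]
  proof (intro allI impI)
    fix p assume "G p = 0"
    then have "star_solution q (u (($) p) (\<lambda>_. 0)) (u1 (($) p) (\<lambda>_. 0))"
      unfolding star by (simp add: defect_def vec_eq_iff forall_3)
    from star_flux[OF this \<kappa> ends] have "(\<Sum>m\<in>UNIV. (norm (p $ m))\<^sup>2) = 0" by simp
    then show "p = 0" by (simp add: sum_nonneg_eq_0_iff vec_eq_iff)
  qed
  then have "surj G" using linear_injective_imp_surjective[OF lin] by blast
  then obtain p where "G p = - defect (\<lambda>j. c j * f (- b) j 0) (\<lambda>j. c j * f1 (- b) j 0)"
    unfolding surj_def by metis
  then have "star_solution q (u (($) p) c) (u1 (($) p) c)" unfolding star by simp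
  from that[OF this ends] show thesis .
qed

section \<open>Reflection across the space of outer values\<close>

context neumann_star
begin

lemma outer_diff: "p \<in> outer \<Longrightarrow> p' \<in> outer \<Longrightarrow> p - p' \<in> outer"
proof -
  have "Re_vec (p - p') = Re_vec p - Re_vec p'" "Im_vec (p - p') = Im_vec p - Im_vec p'"
    by (simp_all add: Re_vec_def Im_vec_def vec_eq_iff)
  then show "p \<in> outer \<Longrightarrow> p' \<in> outer \<Longrightarrow> p - p' \<in> outer"
    by (simp add: outer_iff subspace_diff[OF subspace_real_outer])
qed

text \<open>A bilinear pairing has isotropic complex vectors, so testing \<open>p\<close> against
  itself is not enough. The real and imaginary parts of \<open>p\<close> also belong to
  \<open>outer\<close>, and testing against them produces sums of squares.\<close>

lemma outer_self_orthogonal: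
  assumes "p \<in> outer" "\<And>w. w \<in> outer \<Longrightarrow> (\<Sum>j\<in>UNIV. w $ j * p $ j) = 0"
  shows "p = 0"
proof -
  have "(\<Sum>j\<in>UNIV. of_real (Re (p $ j)) * p $ j) = 0" "(\<Sum>j\<in>UNIV. of_real (Im (p $ j)) * p $ j) = 0"
    using assms(2)[of "cvec (Re_vec p)"] assms(2)[of "cvec (Im_vec p)"] assms(1)
    unfolding cvec_in_outer by (simp_all add: outer_iff[of p]) (simp_all add: cvec_def Re_vec_def Im_vec_def)
  from arg_cong[OF this(1), of Re] arg_cong[OF this(2), of Im]
  have "(\<Sum>j\<in>UNIV. (Re (p $ j))\<^sup>2) = 0" "(\<Sum>j\<in>UNIV. (Im (p $ j))\<^sup>2) = 0"
    by (simp_all add: power2_eq_square)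
  then show ?thesis by (simp add: sum_nonneg_eq_0_iff vec_eq_iff complex_eq_iff)
qed

text \<open>The row is the reflection \<open>2 P e - e\<close> of \<open>e = axis n 1\<close>, where \<open>P\<close> projects onto \<open>outer\<close>.\<close>

lemma reflection_exists:
  obtains r :: "complex ^ 3" where "r + axis n 1 \<in> outer"
    "\<And>w. w \<in> outer \<Longrightarrow> (\<Sum>j\<in>UNIV. w $ j * (r $ j - axis n 1 $ j)) = 0"
proof -
  obtain y z where yz: "y \<in> span real_outer" "\<And>w. w \<in> span real_outer \<Longrightarrow> orthogonal z w"
    "(axis n 1 :: real ^ 3) = y + z"
    using orthogonal_subspace_decomp_exists by blast
  have sp: "span real_outer = real_outer" using subspace_real_outer by (simp add: span_eq_iff)
  have ax: "(axis n 1 :: complex ^ 3) = cvec (y + z)"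
    unfolding yz(3)[symmetric] by (simp add: vec_eq_iff cvec_def axis_def)
  show thesis
  proof
    have "cvec (y - z) + axis n 1 = cvec (2 *\<^sub>R y)"
      unfolding ax by (simp add: vec_eq_iff cvec_def)
    then show "cvec (y - z) + axis n 1 \<in> outer"
      using yz(1) subspace_scale[OF subspace_real_outer] unfolding sp by simp
    fix w assume "w \<in> outer"
    then have "inner z (Re_vec w) = 0" "inner z (Im_vec w) = 0"
      using yz(2) unfolding sp outer_iff orthogonal_def by auto
    then have "(\<Sum>j\<in>UNIV. w $ j * of_real (z $ j)) = 0"
      by (simp add: inner_vec_def Re_vec_def Im_vec_def complex_eq_iff mult.commute)
    moreover have "w $ j * (cvec (y - z) $ j - axis n 1 $ j) = -2 * (w $ j * of_real (z $ j))" for j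
      unfolding ax by (simp add: cvec_def algebra_simps)
    ultimately show "(\<Sum>j\<in>UNIV. w $ j * (cvec (y - z) $ j - axis n 1 $ j)) = 0"
      by (simp add: sum_distrib_left[symmetric] sum_negf)
  qed
qed

end

text \<open>Continuity of \<open>Q\<close> is stated separately because for
  \<open>\<alpha> = 0\<close> it does not follow from that of \<open>\<alpha> * Q\<close>.\<close>

locale scattering = resonance +
  fixes k :: real
  assumes k: "k > 0" and Q_cont: "\<And>j. continuous_on {0..1} (Q j)"
begin

lemma limit_scattering_iff:
  "limit_vertex_conditions Q \<alpha> (scattered_wave k T n) \<longleftrightarrow> T $ n + axis n 1 \<in> outer \<and>
     (\<forall>w\<in>outer. (\<Sum>j\<in>UNIV. w $ j * (T $ n $ j - axis n 1 $ j)) = 0)"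
proof -
  have "incoming k n j 0 = axis n 1 $ j" "outgoing k 0 = 1" for j
    by (simp_all add: incoming_def axis_def outgoing_def)
  then have *: "scattered_wave k T n j 0 = (T $ n + axis n 1) $ j"
    "deriv_a (scattered_wave k T n) j = \<i> * of_real k * (T $ n $ j - axis n 1 $ j)" for j
    using deriv_a_eq[of "scattered_wave k T n" j, OF scattered_wave_deriv(1)]
    by (simp_all add: scattered_wave_eq scattered_wave_deriv_def)
  have sum: "(\<Sum>j\<in>UNIV. w $ j * deriv_a (scattered_wave k T n) j)
      = \<i> * of_real k * (\<Sum>j\<in>UNIV. w $ j * (T $ n $ j - axis n 1 $ j))" for w
    unfolding * sum_distrib_left by (simp add: mult_ac)
  have "(\<chi> j. scattered_wave k T n j 0) = T $ n + axis n 1"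
    by (simp add: vec_eq_iff *(1))
  then show ?thesis
    unfolding limit_vertex_conditions_iff sum using k by simp
qed

text \<open>Resolves the definite description: two candidate rows differ by a vector that lies in
  \<open>outer\<close> and is orthogonal to it.\<close>

lemma limit_scattering:
  "scattering_matrix Q \<alpha> k $ n + axis n 1 \<in> outer"
  "w \<in> outer \<Longrightarrow> (\<Sum>j\<in>UNIV. w $ j * (scattering_matrix Q \<alpha> k $ n $ j - axis n 1 $ j)) = 0"
proof -
  have "\<forall>n. \<exists>r :: complex ^ 3. r + axis n 1 \<in> outer \<and>
      (\<forall>w\<in>outer. (\<Sum>j\<in>UNIV. w $ j * (r $ j - axis n 1 $ j)) = 0)"
    using reflection_exists by metis
  from choice[OF this] obtain r :: "3 \<Rightarrow> complex ^ 3" where r: "\<forall>n. r n + axis n 1 \<in> outer \<and>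
      (\<forall>w\<in>outer. (\<Sum>j\<in>UNIV. w $ j * (r n $ j - axis n 1 $ j)) = 0)"
    by (elim exE)
  have "\<exists>!T. \<forall>n. limit_vertex_conditions Q \<alpha> (scattered_wave k T n)"
  proof (rule ex1I)
    show "\<forall>n. limit_vertex_conditions Q \<alpha> (scattered_wave k (\<chi> n. r n) n)"
      unfolding limit_scattering_iff using r by simp
    fix T assume T: "\<forall>n. limit_vertex_conditions Q \<alpha> (scattered_wave k T n)"
    have "T $ n - r n = 0" for n
    proof (rule outer_self_orthogonal)
      have "(T $ n + axis n 1) - (r n + axis n 1) \<in> outer"
        using T r unfolding limit_scattering_iff by (intro outer_diff) blast+
      then show "T $ n - r n \<in> outer" by simp
      fix w assume "w \<in> outer"
      then have "(\<Sum>j\<in>UNIV. w $ j * (T $ n $ j - axis n 1 $ j)) - (\<Sum>j\<in>UNIV. w $ j * (r n $ j - axis n 1 $ j)) = 0 - 0"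
        using T r unfolding limit_scattering_iff by (intro arg_cong2[where f = "(-)"]) blast+
      then show "(\<Sum>j\<in>UNIV. w $ j * (T $ n - r n) $ j) = 0"
        by (simp add: sum_subtractf[symmetric] right_diff_distrib[symmetric])
    qed
    then show "T = (\<chi> n. r n)" by (simp add: vec_eq_iff)
  qed
  from theI'[OF this] have "\<forall>n. limit_vertex_conditions Q \<alpha> (scattered_wave k (scattering_matrix Q \<alpha> k) n)"
    unfolding scattering_matrix_def .
  then show "scattering_matrix Q \<alpha> k $ n + axis n 1 \<in> outer"
    "w \<in> outer \<Longrightarrow> (\<Sum>j\<in>UNIV. w $ j * (scattering_matrix Q \<alpha> k $ n $ j - axis n 1 $ j)) = 0"
    unfolding limit_scattering_iff by blast+
qed

text \<open>The outer end \<open>s = 1\<close> is the point \<open>\<epsilon>\<close> of the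
  half-line, hence the phases taken at \<open>\<epsilon>\<close> and the factor
  \<open>\<epsilon> * k\<close> in the slope.\<close>

definition scattering_solution :: "real \<Rightarrow> 3 \<Rightarrow> complex ^ 3 \<Rightarrow> complex star_fun \<Rightarrow> complex star_fun \<Rightarrow> bool" where
  "scattering_solution \<epsilon> n r u u1 \<longleftrightarrow> star_solution (\<lambda>j s. \<alpha> * Q j s - (\<epsilon> * k)\<^sup>2) u u1 \<and>
     (\<forall>m. u m 1 = r $ m * outgoing k \<epsilon> + incoming k n m \<epsilon>) \<and>
     (\<forall>m. u1 m 1 = \<i> * of_real (\<epsilon> * k) * (r $ m * outgoing k \<epsilon> - incoming k n m \<epsilon>))"

lemma regularized_scattering_iff:
  assumes "0 < \<epsilon>"
  shows "(\<exists>y. regularized_solution Q \<alpha> \<epsilon> k y \<and> (\<forall>m. \<forall>s\<ge>\<epsilon>. y m s = scattered_wave k T n m s))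
     \<longleftrightarrow> (\<exists>u u1. scattering_solution \<epsilon> n (T $ n) u u1)"
proof
  assume "\<exists>y. regularized_solution Q \<alpha> \<epsilon> k y \<and> (\<forall>m. \<forall>s\<ge>\<epsilon>. y m s = scattered_wave k T n m s)"
  then obtain y where y: "regularized_solution Q \<alpha> \<epsilon> k y" "\<And>m s. s \<ge> \<epsilon> \<Longrightarrow> y m s = scattered_wave k T n m s"
    by blast
  obtain u u1 where "star_solution (\<lambda>j s. \<alpha> * Q j s - (\<epsilon> * k)\<^sup>2) u u1"
    "\<And>m. u m 1 = scattered_wave k T n m \<epsilon>" "\<And>m. u1 m 1 = of_real \<epsilon> * scattered_wave_deriv k T n m \<epsilon>"
    using regularized_imp_star_solution[OF assms Q_cont y] by blast
  then have "scattering_solution \<epsilon> n (T $ n) u u1"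
    by (simp add: scattering_solution_def scattered_wave_eq scattered_wave_deriv_def mult_ac)
  then show "\<exists>u u1. scattering_solution \<epsilon> n (T $ n) u u1" by blast
next
  assume "\<exists>u u1. scattering_solution \<epsilon> n (T $ n) u u1"
  then obtain u u1 where u: "star_solution (\<lambda>j s. \<alpha> * Q j s - (\<epsilon> * k)\<^sup>2) u u1"
    "\<And>m. u m 1 = scattered_wave k T n m \<epsilon>" "\<And>m. u1 m 1 = of_real \<epsilon> * scattered_wave_deriv k T n m \<epsilon>"
    by (auto simp: scattering_solution_def scattered_wave_eq scattered_wave_deriv_def mult_ac)
  show "\<exists>y. regularized_solution Q \<alpha> \<epsilon> k y \<and> (\<forall>m. \<forall>s\<ge>\<epsilon>. y m s = scattered_wave k T n m s)"
    by (rule star_solution_imp_regularized[OF assms Q_cont u])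
qed

text \<open>Resolves the definite description for positive \<open>\<epsilon>\<close>. The amplitude
  at the outer end is divided by the phase, which has modulus one; two solutions differ by one
  without incoming wave, which has no outgoing wave either.\<close>

lemma scattering_solution_exists:
  assumes "0 < \<epsilon>"
  shows "\<exists>u u1. scattering_solution \<epsilon> n (scattering_matrix_eps Q \<alpha> \<epsilon> k $ n) u u1"
proof -
  have \<kappa>: "\<epsilon> * k > 0" using assms k by simp
  have out: "outgoing k \<epsilon> \<noteq> 0" by (simp add: outgoing_def)
  have cont: "continuous_on {0..1} (\<lambda>s. \<alpha> * Q j s - (\<epsilon> * k)\<^sup>2)" for j
    by (intro continuous_intros Q_cont)
  have "\<exists>r u u1. scattering_solution \<epsilon> n r u u1" for n
  proof -
    obtain u u1 a where "star_solution (\<lambda>j s. \<alpha> * Q j s - (\<epsilon> * k)\<^sup>2) u u1"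
      "\<And>m. u m 1 = a m + incoming k n m \<epsilon>" "\<And>m. u1 m 1 = \<i> * of_real (\<epsilon> * k) * (a m - incoming k n m \<epsilon>)"
      by (rule star_solution_scattering_exists[where q = "\<lambda>j s. \<alpha> * Q j s - (\<epsilon> * k)\<^sup>2", OF cont \<kappa>, where c = "\<lambda>m. incoming k n m \<epsilon>"]) (rule that)
    then have "scattering_solution \<epsilon> n (\<chi> m. a m / outgoing k \<epsilon>) u u1"
      using out by (simp add: scattering_solution_def)
    then show ?thesis by blast
  qed
  then obtain r where r: "\<And>n. \<exists>u u1. scattering_solution \<epsilon> n (r n) u u1" by metis
  have unique: "p = p'" if p: "scattering_solution \<epsilon> n p u u1" and p': "scattering_solution \<epsilon> n p' v v1"
    for n p p' u u1 v v1
  proof -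
    have "star_solution (\<lambda>j s. \<alpha> * Q j s - (\<epsilon> * k)\<^sup>2) (\<lambda>j s. u j s + (-1) * v j s) (\<lambda>j s. u1 j s + (-1) * v1 j s)"
      using p p' unfolding scattering_solution_def by (intro star_solution_add star_solution_scale) auto
    from star_flux[OF this \<kappa>, of "\<lambda>m. (p $ m - p' $ m) * outgoing k \<epsilon>" "\<lambda>_. 0"]
    have "(\<Sum>m\<in>UNIV. (norm ((p $ m - p' $ m) * outgoing k \<epsilon>))\<^sup>2) = 0"
      using p p' unfolding scattering_solution_def by (simp add: algebra_simps)
    then show ?thesis using out by (simp add: sum_nonneg_eq_0_iff vec_eq_iff)
  qed
  have "\<exists>!T. \<forall>n. \<exists>u u1. scattering_solution \<epsilon> n (T $ n) u u1"
  proof (rule ex1I)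
    show "\<forall>n. \<exists>u u1. scattering_solution \<epsilon> n ((\<chi> n. r n) $ n) u u1" using r by simp
    fix T :: "complex ^ 3 ^ 3" assume "\<forall>n. \<exists>u u1. scattering_solution \<epsilon> n (T $ n) u u1"
    then have "T $ n = r n" for n using r unique by metis
    then show "T = (\<chi> n. r n)" by (simp add: vec_eq_iff)
  qed
  from theI'[OF this] show ?thesis
    unfolding scattering_matrix_eps_def regularized_scattering_iff[OF assms] by blast
qed

lemma norm_outgoing: "norm (outgoing k s) = 1"
  by (simp add: outgoing_def)

text \<open>Only edge \<open>n\<close> carries an incoming wave, of modulus one, so current
  conservation gives the row unit length.\<close>

lemma scattering_solution_flux:
  assumes "0 < \<epsilon>" "scattering_solution \<epsilon> n r u u1"
  shows "norm (r $ m) \<le> 1"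
proof -
  have "\<epsilon> * k > 0" using assms(1) k by simp
  from star_flux[OF _ this, of _ u u1 "\<lambda>m. r $ m * outgoing k \<epsilon>" "\<lambda>m. incoming k n m \<epsilon>"] assms(2)
  have "(\<Sum>m\<in>UNIV. (norm (r $ m * outgoing k \<epsilon>))\<^sup>2) = (\<Sum>m\<in>UNIV. (norm (incoming k n m \<epsilon>))\<^sup>2)"
    unfolding scattering_solution_def by blast
  also have "\<dots> = (\<Sum>m\<in>UNIV. if m = n then 1 else 0)"
    by (intro sum.cong) (simp_all add: incoming_def)
  finally have "(\<Sum>m\<in>UNIV. (norm (r $ m))\<^sup>2) = 1" by (simp add: norm_mult norm_outgoing)
  then have "(norm (r $ m))\<^sup>2 \<le> 1"
    using member_le_sum[of m UNIV "\<lambda>m. (norm (r $ m))\<^sup>2"] by simp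
  then show ?thesis by (simp add: power_le_one_iff abs_square_le_1)
qed

lemma norm_incoming: "norm (incoming k n m s) \<le> 1"
  by (simp add: incoming_def)

lemma potential_bounded: "\<exists>M. \<forall>j. \<forall>s\<in>{0..1}. \<bar>\<alpha> * Q j s\<bar> \<le> M"
proof -
  have "\<forall>j. \<exists>M. \<forall>s\<in>{0..1}. \<bar>\<alpha> * Q j s\<bar> \<le> M"
  proof
    fix j
    show "\<exists>M. \<forall>s\<in>{0..1}. \<bar>\<alpha> * Q j s\<bar> \<le> M"
      using compact_imp_bounded[OF compact_continuous_image[OF q_cont[of j] compact_Icc]]
      by (fastforce simp: bounded_iff)
  qed
  then obtain M where M: "\<And>j s. s \<in> {0..1} \<Longrightarrow> \<bar>\<alpha> * Q j s\<bar> \<le> M j" by metis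
  have "\<bar>\<alpha> * Q j s\<bar> \<le> (\<Sum>j\<in>UNIV. \<bar>M j\<bar>)" if "s \<in> {0..1}" for j s
    using M[OF that, of j] member_le_sum[of j UNIV "\<lambda>j. \<bar>M j\<bar>"] by auto
  then show ?thesis by blast
qed

text \<open>Both estimates start at the outer end, where the amplitudes give \<open>u\<close> of
  size 2 and \<open>u1\<close> of size \<open>2 * \<epsilon> * k\<close>. The difference
  \<open>v\<close> from the Neumann profile has value zero and the slope of \<open>u\<close> there,
  and it solves the zero-energy equation with source \<open>(\<epsilon> * k)\<^sup>2 * u\<close>.
  The constants depend on neither \<open>\<epsilon>\<close> nor the solution.\<close>

lemma scattering_solution_bounds:
  obtains A C where "0 \<le> A" "0 \<le> C"
    "\<And>\<epsilon> n r u u1 j s. 0 < \<epsilon> \<Longrightarrow> \<epsilon> * k \<le> 1 \<Longrightarrow> scattering_solution \<epsilon> n r u u1 \<Longrightarrow> s \<in> {0..1} \<Longrightarrow> norm (u j s) \<le> A"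
    "\<And>\<epsilon> n r u u1 j. 0 < \<epsilon> \<Longrightarrow> \<epsilon> * k \<le> 1 \<Longrightarrow> scattering_solution \<epsilon> n r u u1 \<Longrightarrow>
       norm (u j 0 - u j 1 * of_real (\<phi> j 0)) \<le> C * (\<epsilon> * k) \<and> norm (u1 j 0 - u j 1 * of_real (\<phi>1 j 0)) \<le> C * (\<epsilon> * k)"
proof -
  obtain M where M: "\<And>j s. s \<in> {0..1} \<Longrightarrow> \<bar>\<alpha> * Q j s\<bar> \<le> M" using potential_bounded by blast
  have M0: "0 \<le> M" using M[of 0 0] by simp
  \<comment> \<open>The 8 is twice the squared outer bound, and \<open>3 + M\<close> allows for an
    energy of at most 1 added to the potential. In \<open>C\<close>, the 4 comes from the outer
    slope and \<open>A\<^sup>2\<close> from the source.\<close>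
  define A where "A = sqrt (exp (3 + M) * 8)"
  define C where "C = sqrt (exp (2 + M) * (4 + A\<^sup>2))"
  have A0: "0 \<le> A" "A\<^sup>2 = exp (3 + M) * 8" and C0: "0 \<le> C" "C\<^sup>2 = exp (2 + M) * (4 + A\<^sup>2)"
    by (simp_all add: A_def C_def)
  {
    fix \<epsilon> n r u u1 j and s :: real
    assume e: "0 < \<epsilon>" "\<epsilon> * k \<le> 1" and u: "scattering_solution \<epsilon> n r u u1"
    define \<kappa> where "\<kappa> = \<epsilon> * k"
    have \<kappa>: "0 < \<kappa>" "\<kappa> \<le> 1" using e k by (simp_all add: \<kappa>_def)
    then have \<kappa>2: "\<kappa>\<^sup>2 \<le> 1" by (simp add: power_le_one)
    have edge: "edge_solution (\<lambda>s. \<alpha> * Q j s - \<kappa>\<^sup>2) (u j) (u1 j)"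
      using u by (simp add: scattering_solution_def star_solution_def \<kappa>_def)
    have r: "norm (r $ j) \<le> 1" using scattering_solution_flux[OF e(1) u] .
    have "norm (r $ j * outgoing k \<epsilon>) \<le> 1" using r by (simp add: norm_mult norm_outgoing)
    then have n2: "norm (r $ j * outgoing k \<epsilon> + incoming k n j \<epsilon>) \<le> 2"
      "norm (r $ j * outgoing k \<epsilon> - incoming k n j \<epsilon>) \<le> 2"
      using norm_incoming[of n j \<epsilon>] norm_triangle_ineq[of "r $ j * outgoing k \<epsilon>" "incoming k n j \<epsilon>"]
        norm_triangle_ineq4[of "r $ j * outgoing k \<epsilon>" "incoming k n j \<epsilon>"] by linarith+
    have u_end: "norm (u j 1) \<le> 2"
      using u n2(1) by (simp add: scattering_solution_def)
    have "u1 j 1 = \<i> * of_real \<kappa> * (r $ j * outgoing k \<epsilon> - incoming k n j \<epsilon>)"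
      using u by (simp add: scattering_solution_def \<kappa>_def)
    then have "norm (u1 j 1) = \<kappa> * norm (r $ j * outgoing k \<epsilon> - incoming k n j \<epsilon>)"
      using \<kappa> by (simp add: norm_mult)
    then have u1_end: "norm (u1 j 1) \<le> \<kappa> * 2" using n2(2) \<kappa> by simp
    have sq: "(norm (u j 1))\<^sup>2 \<le> 4" "(norm (u1 j 1))\<^sup>2 \<le> 4 * \<kappa>\<^sup>2"
      using power_mono[OF u_end, of 2] power_mono[OF u1_end, of 2] by (simp_all add: power_mult_distrib mult.commute)
    have uA: "norm (u j s) \<le> A" if s: "s \<in> {0..1}" for s
    proof (rule power2_le_imp_le)
      have "\<bar>\<alpha> * Q j s - \<kappa>\<^sup>2\<bar> \<le> M + 1" if "s \<in> {0..1}" for s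
        using M[OF that, of j] \<kappa>2 zero_le_power2[of \<kappa>] by linarith
      from edge_solution_growth[OF edge this s]
      have "(norm (u j s))\<^sup>2 + (norm (u1 j s))\<^sup>2 \<le> exp (2 + (M + 1)) * ((norm (u j 1))\<^sup>2 + (norm (u1 j 1))\<^sup>2)" .
      also have "\<dots> \<le> exp (2 + (M + 1)) * 8"
        using sq \<kappa>2 by (intro mult_left_mono) auto
      also have "2 + (M + 1) = 3 + M" by simp
      finally show "(norm (u j s))\<^sup>2 \<le> A\<^sup>2" unfolding A0 using zero_le_power2[of "norm (u1 j s)"] by linarith
    qed (use A0 in auto)
    define v where "v s = u j s - u j 1 * of_real (\<phi> j s)" for s
    define v1 where "v1 s = u1 j s - u j 1 * of_real (\<phi>1 j s)" for s
    define v2 where "v2 s = of_real (\<alpha> * Q j s - \<kappa>\<^sup>2) * u j s - u j 1 * (of_real (\<alpha> * Q j s) * of_real (\<phi> j s))" for s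
    have "(norm (v 0))\<^sup>2 + (norm (v1 0))\<^sup>2 \<le> exp (2 + M) * ((norm (v 1))\<^sup>2 + (norm (v1 1))\<^sup>2 + (\<kappa>\<^sup>2 * A)\<^sup>2)"
    proof (rule second_order_growth)
      fix s :: real assume s: "s \<in> {0..1}"
      show "(v has_vector_derivative v1 s) (at s within {0..1})"
        unfolding v_def v1_def using edge \<phi>_sol[of j] s unfolding edge_solution_def
        by (intro has_vector_derivative_diff has_vector_derivative_mult_right) auto
      show "(v1 has_vector_derivative v2 s) (at s within {0..1})"
        unfolding v1_def v2_def using edge \<phi>_sol[of j] s unfolding edge_solution_def
        by (intro has_vector_derivative_diff has_vector_derivative_mult_right) auto
      have "v2 s = of_real (\<alpha> * Q j s) * v s - of_real (\<kappa>\<^sup>2) * u j s"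
        by (simp add: v2_def v_def algebra_simps)
      then have "norm (v2 s) \<le> norm (of_real (\<alpha> * Q j s) * v s) + norm (of_real (\<kappa>\<^sup>2) * u j s)"
        by (simp only: norm_triangle_ineq4)
      also have "\<dots> = \<bar>\<alpha> * Q j s\<bar> * norm (v s) + \<kappa>\<^sup>2 * norm (u j s)"
        by (simp only: norm_mult norm_of_real abs_power2)
      also have "\<dots> \<le> M * norm (v s) + \<kappa>\<^sup>2 * A"
        using M[OF s, of j] uA[OF s] by (intro add_mono mult_right_mono mult_left_mono) auto
      finally show "norm (v2 s) \<le> M * norm (v s) + \<kappa>\<^sup>2 * A" .
    qed (use M0 A0 in auto)
    also have "v 1 = 0" by (simp add: v_def \<phi>_end)
    also have "v1 1 = u1 j 1" by (simp add: v1_def \<phi>_end)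
    also have "exp (2 + M) * ((norm (0 :: complex))\<^sup>2 + (norm (u1 j 1))\<^sup>2 + (\<kappa>\<^sup>2 * A)\<^sup>2)
        \<le> exp (2 + M) * (\<kappa>\<^sup>2 * (4 + A\<^sup>2))"
    proof (rule mult_left_mono)
      have "(\<kappa>\<^sup>2 * A)\<^sup>2 = \<kappa>\<^sup>2 * (\<kappa>\<^sup>2 * A\<^sup>2)" by (simp add: power2_eq_square)
      also have "\<dots> \<le> \<kappa>\<^sup>2 * (1 * A\<^sup>2)" using \<kappa>2 by (intro mult_left_mono mult_right_mono) auto
      finally show "(norm (0 :: complex))\<^sup>2 + (norm (u1 j 1))\<^sup>2 + (\<kappa>\<^sup>2 * A)\<^sup>2 \<le> \<kappa>\<^sup>2 * (4 + A\<^sup>2)"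
        using sq(2) by (simp add: algebra_simps)
    qed simp
    also have "\<dots> = (C * \<kappa>)\<^sup>2" by (simp add: C0 power_mult_distrib)
    finally have "(norm (v 0))\<^sup>2 \<le> (C * \<kappa>)\<^sup>2" "(norm (v1 0))\<^sup>2 \<le> (C * \<kappa>)\<^sup>2"
      using zero_le_power2[of "norm (v 0)"] zero_le_power2[of "norm (v1 0)"] by linarith+
    then have "norm (v 0) \<le> C * \<kappa>" "norm (v1 0) \<le> C * \<kappa>"
      using C0 \<kappa> by (auto intro: power2_le_imp_le)
    then have "norm (u j 0 - u j 1 * of_real (\<phi> j 0)) \<le> C * (\<epsilon> * k)"
      "norm (u1 j 0 - u j 1 * of_real (\<phi>1 j 0)) \<le> C * (\<epsilon> * k)"
      by (simp_all add: v_def v1_def \<kappa>_def)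
    note uA this
  }
  then show thesis using that[OF A0(1) C0(1)] by blast
qed

section \<open>Passage to the limit\<close>

abbreviation "S \<epsilon> \<equiv> scattering_matrix_eps Q \<alpha> \<epsilon> k"
abbreviation "T \<equiv> scattering_matrix Q \<alpha> k"

lemma eventually_small: "\<forall>\<^sub>F \<epsilon> in at_right 0. 0 < \<epsilon> \<and> \<epsilon> * k \<le> 1"
  unfolding eventually_at_right[OF zero_less_one]
  using k by (intro exI[of _ "1 / k"]) (auto simp: field_simps)

lemma tendsto_const_kappa: "((\<lambda>\<epsilon>. c * (\<epsilon> * k)) \<longlongrightarrow> 0) (at_right 0)"
  by (rule tendsto_eq_intros refl)+ simp

text \<open>Green's formula against the zero-energy solution with Neumann data \<open>w\<close>: the boundary term carries a
  factor \<open>\<epsilon> k\<close>, the bulk term a factor \<open>(\<epsilon> k)\<^sup>2\<close>.\<close>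

lemma scattering_green_limit:
  assumes w: "w \<in> outer"
  shows "((\<lambda>\<epsilon>. \<Sum>j\<in>UNIV. w $ j * (S \<epsilon> $ n $ j * outgoing k \<epsilon> - incoming k n j \<epsilon>)) \<longlongrightarrow> 0) (at_right 0)"
proof -
  obtain A C where A: "0 \<le> A" "\<And>\<epsilon> n r u u1 j s. 0 < \<epsilon> \<Longrightarrow> \<epsilon> * k \<le> 1 \<Longrightarrow>
      scattering_solution \<epsilon> n r u u1 \<Longrightarrow> s \<in> {0..1} \<Longrightarrow> norm (u j s) \<le> A"
    using scattering_solution_bounds by metis
  note ws = outer_star_solution[OF w]
  obtain B where B: "\<And>j s. s \<in> {0..1} \<Longrightarrow> norm (w $ j * of_real (\<phi> j s)) \<le> B"
    using star_solution_bounded[OF ws] by blast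
  have "\<forall>\<^sub>F \<epsilon> in at_right 0. norm (\<Sum>j\<in>UNIV. w $ j * (S \<epsilon> $ n $ j * outgoing k \<epsilon> - incoming k n j \<epsilon>))
      \<le> 3 * (A * B) * (\<epsilon> * k)"
    using eventually_small
  proof eventually_elim
    case (elim \<epsilon>)
    obtain u u1 where u: "scattering_solution \<epsilon> n (S \<epsilon> $ n) u u1"
      using scattering_solution_exists elim by blast
    define \<kappa> where "\<kappa> = \<epsilon> * k"
    have \<kappa>: "0 < \<kappa>" using elim k by (simp add: \<kappa>_def)
    define X where "X = (\<Sum>j\<in>UNIV. w $ j * (S \<epsilon> $ n $ j * outgoing k \<epsilon> - incoming k n j \<epsilon>))"
    have us: "star_solution (\<lambda>j s. \<alpha> * Q j s - \<kappa>\<^sup>2) u u1"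
      using u by (simp add: scattering_solution_def \<kappa>_def)
    have "norm (\<Sum>j\<in>UNIV. u1 j 1 * (w $ j * of_real (\<phi> j 1)) - u j 1 * (w $ j * of_real (\<phi>1 j 1)))
        \<le> 3 * (\<kappa>\<^sup>2 * (A * B))"
      using A(2)[OF _ _ u] elim B by (intro star_green[OF us ws]) auto
    also have "(\<Sum>j\<in>UNIV. u1 j 1 * (w $ j * of_real (\<phi> j 1)) - u j 1 * (w $ j * of_real (\<phi>1 j 1)))
        = \<i> * of_real \<kappa> * X"
      unfolding X_def sum_distrib_left
      using u by (intro sum.cong) (simp_all add: scattering_solution_def \<phi>_end \<kappa>_def mult_ac)
    finally have "\<kappa> * norm X \<le> \<kappa> * (3 * (A * B) * \<kappa>)"
      using \<kappa> by (simp add: norm_mult power2_eq_square mult_ac)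
    then have "norm X \<le> 3 * (A * B) * \<kappa>" using \<kappa> by (rule mult_left_le_imp_le)
    then show ?case by (simp only: X_def \<kappa>_def)
  qed
  then show ?thesis by (rule Lim_null_comparison[OF _ tendsto_const_kappa])
qed

text \<open>Replacing \<open>u\<close> by the zero-energy Neumann solution with the same outer values changes the data at
  the centre only by \<open>O(\<epsilon> k)\<close>, so these outer values almost lie in \<open>outer\<close>.\<close>

lemma scattering_defect_limit:
  shows "((\<lambda>\<epsilon>. (S \<epsilon> $ n $ i * outgoing k \<epsilon> + incoming k n i \<epsilon>) * of_real (\<phi> i 0)
      - (S \<epsilon> $ n $ j * outgoing k \<epsilon> + incoming k n j \<epsilon>) * of_real (\<phi> j 0)) \<longlongrightarrow> 0) (at_right 0)"
    and "((\<lambda>\<epsilon>. \<Sum>j\<in>UNIV. (S \<epsilon> $ n $ j * outgoing k \<epsilon> + incoming k n j \<epsilon>) * of_real (\<phi>1 j 0)) \<longlongrightarrow> 0) (at_right 0)"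
proof -
  obtain A C where C: "0 \<le> C" "\<And>\<epsilon> n r u u1 j. 0 < \<epsilon> \<Longrightarrow> \<epsilon> * k \<le> 1 \<Longrightarrow> scattering_solution \<epsilon> n r u u1 \<Longrightarrow>
       norm (u j 0 - u j 1 * of_real (\<phi> j 0)) \<le> C * (\<epsilon> * k) \<and> norm (u1 j 0 - u j 1 * of_real (\<phi>1 j 0)) \<le> C * (\<epsilon> * k)"
    by (rule scattering_solution_bounds) blast
  have "\<forall>\<^sub>F \<epsilon> in at_right 0. norm ((S \<epsilon> $ n $ i * outgoing k \<epsilon> + incoming k n i \<epsilon>) * of_real (\<phi> i 0)
      - (S \<epsilon> $ n $ j * outgoing k \<epsilon> + incoming k n j \<epsilon>) * of_real (\<phi> j 0)) \<le> 2 * C * (\<epsilon> * k) \<and>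
    norm (\<Sum>j\<in>UNIV. (S \<epsilon> $ n $ j * outgoing k \<epsilon> + incoming k n j \<epsilon>) * of_real (\<phi>1 j 0)) \<le> 3 * C * (\<epsilon> * k)"
    using eventually_small
  proof eventually_elim
    case (elim \<epsilon>)
    obtain u u1 where u: "scattering_solution \<epsilon> n (S \<epsilon> $ n) u u1"
      using scattering_solution_exists elim by blast
    have u_end: "S \<epsilon> $ n $ j * outgoing k \<epsilon> + incoming k n j \<epsilon> = u j 1" for j
      using u by (simp add: scattering_solution_def)
    have K: "kirchhoff (\<lambda>j. u j 0) (\<lambda>j. u1 j 0)"
      using u by (simp add: scattering_solution_def star_solution_def)
    have c: "norm (u j 0 - u j 1 * of_real (\<phi> j 0)) \<le> C * (\<epsilon> * k)"
      "norm (u1 j 0 - u j 1 * of_real (\<phi>1 j 0)) \<le> C * (\<epsilon> * k)" for j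
      using C(2)[OF _ _ u] elim by blast+
    have "u i 0 = u j 0" using K unfolding kirchhoff_def by blast
    then have "u i 1 * of_real (\<phi> i 0) - u j 1 * of_real (\<phi> j 0)
        = (u j 0 - u j 1 * of_real (\<phi> j 0)) - (u i 0 - u i 1 * of_real (\<phi> i 0))" by simp
    then have "norm (u i 1 * of_real (\<phi> i 0) - u j 1 * of_real (\<phi> j 0)) \<le> 2 * C * (\<epsilon> * k)"
      using norm_triangle_ineq4[of "u j 0 - u j 1 * of_real (\<phi> j 0)" "u i 0 - u i 1 * of_real (\<phi> i 0)"]
        c(1)[of i] c(1)[of j] by (simp only:)
    moreover have "(\<Sum>j\<in>UNIV. u j 1 * of_real (\<phi>1 j 0)) = - (\<Sum>j\<in>UNIV. u1 j 0 - u j 1 * of_real (\<phi>1 j 0))"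
      using K by (simp add: kirchhoff_def sum_subtractf)
    then have "norm (\<Sum>j\<in>UNIV. u j 1 * of_real (\<phi>1 j 0)) \<le> (\<Sum>j\<in>(UNIV :: 3 set). C * (\<epsilon> * k))"
      using sum_norm_le[of UNIV "\<lambda>j. u1 j 0 - u j 1 * of_real (\<phi>1 j 0)" "\<lambda>_. C * (\<epsilon> * k)"] c(2)
      by (simp only: norm_minus_cancel)
    ultimately show ?case unfolding u_end by simp
  qed
  then have "\<forall>\<^sub>F \<epsilon> in at_right 0. norm ((S \<epsilon> $ n $ i * outgoing k \<epsilon> + incoming k n i \<epsilon>) * of_real (\<phi> i 0)
      - (S \<epsilon> $ n $ j * outgoing k \<epsilon> + incoming k n j \<epsilon>) * of_real (\<phi> j 0)) \<le> 2 * C * (\<epsilon> * k)"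
    "\<forall>\<^sub>F \<epsilon> in at_right 0. norm (\<Sum>j\<in>UNIV. (S \<epsilon> $ n $ j * outgoing k \<epsilon> + incoming k n j \<epsilon>) * of_real (\<phi>1 j 0)) \<le> 3 * C * (\<epsilon> * k)"
    by (auto elim: eventually_mono)
  from this[THEN Lim_null_comparison[OF _ tendsto_const_kappa]]
  show "((\<lambda>\<epsilon>. (S \<epsilon> $ n $ i * outgoing k \<epsilon> + incoming k n i \<epsilon>) * of_real (\<phi> i 0)
      - (S \<epsilon> $ n $ j * outgoing k \<epsilon> + incoming k n j \<epsilon>) * of_real (\<phi> j 0)) \<longlongrightarrow> 0) (at_right 0)"
    "((\<lambda>\<epsilon>. \<Sum>j\<in>UNIV. (S \<epsilon> $ n $ j * outgoing k \<epsilon> + incoming k n j \<epsilon>) * of_real (\<phi>1 j 0)) \<longlongrightarrow> 0) (at_right 0)"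
    by blast+
qed

text \<open>The limit row satisfies the reflection conditions exactly and the row at
  \<open>\<epsilon>\<close> approximately, so \<open>D \<epsilon>\<close> satisfies the homogeneous
  ones approximately. As test vectors, the \<open>T $ i + axis i 1\<close> suffice: they are twice
  the projections of the basis vectors and span \<open>outer\<close>.\<close>

lemma scattering_matrix_tendsto: "((\<lambda>\<epsilon>. S \<epsilon> $ n $ m) \<longlongrightarrow> T $ n $ m) (at_right 0)"
proof -
  define D where "D \<epsilon> = S \<epsilon> $ n - T $ n" for \<epsilon>
  \<comment> \<open>\<open>h\<close> and \<open>l\<close> are the errors of replacing the phases at
    \<open>\<epsilon>\<close> by their values at 0; \<open>h\<close> is small because the rows stay
    bounded.\<close>
  define h where "h j \<epsilon> = S \<epsilon> $ n $ j * (outgoing k \<epsilon> - 1)" for j \<epsilon>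
  define l where "l j \<epsilon> = incoming k n j \<epsilon> - axis n 1 $ j" for j \<epsilon>
  have "(outgoing k \<longlongrightarrow> outgoing k 0) (at_right 0)" "(incoming k n j \<longlongrightarrow> incoming k n j 0) (at_right 0)" for j
    using has_vector_derivative_continuous[OF outgoing_deriv] has_vector_derivative_continuous[OF incoming_deriv]
    by (auto simp: continuous_within)
  moreover have "incoming k n j 0 = axis n 1 $ j" "outgoing k 0 = 1" for j
    by (simp_all add: incoming_def axis_def outgoing_def)
  ultimately have out: "((\<lambda>\<epsilon>. outgoing k \<epsilon> - 1) \<longlongrightarrow> 0) (at_right 0)"
    and l: "(l j \<longlongrightarrow> 0) (at_right 0)" for j
    unfolding l_def[abs_def] using LIM_zero by fastforce+
  have h: "(h j \<longlongrightarrow> 0) (at_right 0)" for j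
  proof (rule Lim_null_comparison[OF _ tendsto_norm_zero[OF out]])
    show "\<forall>\<^sub>F \<epsilon> in at_right 0. norm (h j \<epsilon>) \<le> norm (outgoing k \<epsilon> - 1)"
      using eventually_small
    proof eventually_elim
      case (elim \<epsilon>)
      then obtain u u1 where "scattering_solution \<epsilon> n (S \<epsilon> $ n) u u1"
        using scattering_solution_exists by blast
      from scattering_solution_flux[OF _ this, of j] elim
      have "norm (S \<epsilon> $ n $ j) \<le> 1" by blast
      then show ?case by (simp add: h_def norm_mult mult_left_le_one_le)
    qed
  qed
  have T: "(T $ n + axis n 1) $ i * of_real (\<phi> i 0) = (T $ n + axis n 1) $ j * of_real (\<phi> j 0)"
    "(\<Sum>j\<in>UNIV. (T $ n + axis n 1) $ j * of_real (\<phi>1 j 0)) = 0" for i j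
    using limit_scattering(1)[of n] unfolding outer_def by blast+
  \<comment> \<open>Two readings of the same difference: the sum of the amplitudes enters the
    conditions at the centre, their difference the orthogonality relations.\<close>
  have plus: "D \<epsilon> $ j = (S \<epsilon> $ n $ j * outgoing k \<epsilon> + incoming k n j \<epsilon>) - (h j \<epsilon> + l j \<epsilon>) - (T $ n + axis n 1) $ j"
    and minus: "D \<epsilon> $ j = (S \<epsilon> $ n $ j * outgoing k \<epsilon> - incoming k n j \<epsilon>) - (h j \<epsilon> - l j \<epsilon>) - (T $ n $ j - axis n 1 $ j)" for j \<epsilon>
    by (simp_all add: D_def h_def l_def algebra_simps)
  have D1: "((\<lambda>\<epsilon>. D \<epsilon> $ i * of_real (\<phi> i 0) - D \<epsilon> $ j * of_real (\<phi> j 0)) \<longlongrightarrow> 0) (at_right 0)" for i j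
  proof -
    have "((\<lambda>\<epsilon>. (h i \<epsilon> + l i \<epsilon>) * of_real (\<phi> i 0) - (h j \<epsilon> + l j \<epsilon>) * of_real (\<phi> j 0)) \<longlongrightarrow> 0) (at_right 0)"
      by (rule tendsto_eq_intros h l refl)+ simp
    note lim = tendsto_diff[OF scattering_defect_limit(1)[of n i j] this]
    have "D \<epsilon> $ i * of_real (\<phi> i 0) - D \<epsilon> $ j * of_real (\<phi> j 0) =
        (S \<epsilon> $ n $ i * outgoing k \<epsilon> + incoming k n i \<epsilon>) * of_real (\<phi> i 0)
        - (S \<epsilon> $ n $ j * outgoing k \<epsilon> + incoming k n j \<epsilon>) * of_real (\<phi> j 0)
        - ((h i \<epsilon> + l i \<epsilon>) * of_real (\<phi> i 0) - (h j \<epsilon> + l j \<epsilon>) * of_real (\<phi> j 0))" for \<epsilon>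
      unfolding plus left_diff_distrib using T(1)[of i j] by simp
    with lim show ?thesis by simp
  qed
  have D2: "((\<lambda>\<epsilon>. \<Sum>j\<in>UNIV. D \<epsilon> $ j * of_real (\<phi>1 j 0)) \<longlongrightarrow> 0) (at_right 0)"
  proof -
    have "((\<lambda>\<epsilon>. \<Sum>j\<in>UNIV. (h j \<epsilon> + l j \<epsilon>) * of_real (\<phi>1 j 0)) \<longlongrightarrow> 0) (at_right 0)"
      by (rule tendsto_eq_intros h l refl)+ simp
    from tendsto_diff[OF scattering_defect_limit(2)[of n] this] show ?thesis
      using T(2) unfolding plus left_diff_distrib sum_subtractf by simp
  qed
  have D3: "((\<lambda>\<epsilon>. \<Sum>j\<in>UNIV. w $ j * D \<epsilon> $ j) \<longlongrightarrow> 0) (at_right 0)" if w: "w \<in> outer" for w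
  proof -
    have "((\<lambda>\<epsilon>. \<Sum>j\<in>UNIV. w $ j * (h j \<epsilon> - l j \<epsilon>)) \<longlongrightarrow> 0) (at_right 0)"
      by (rule tendsto_eq_intros h l refl)+ simp
    from tendsto_diff[OF scattering_green_limit[OF w, of n] this] show ?thesis
      using limit_scattering(2)[OF w, of n]
      unfolding minus right_diff_distrib[of "_ $ _"] sum_subtractf by simp
  qed
  \<comment> \<open>The first component vanishes exactly on \<open>outer\<close>; the second pairs with vectors of \<open>outer\<close> whose
    difference with \<open>T $ i - axis i 1\<close>, orthogonal to \<open>outer\<close>, is \<open>2 axis i 1\<close>. So \<open>F\<close> is injective.\<close>
  define F where "F p = (defect (\<lambda>j. p $ j * of_real (\<phi> j 0)) (\<lambda>j. p $ j * of_real (\<phi>1 j 0)),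
      \<chi> i. \<Sum>j\<in>UNIV. (T $ i + axis i 1) $ j * p $ j)" for p :: "complex ^ 3"
  have "linear (\<lambda>p :: complex ^ 3. \<chi> i. \<Sum>j\<in>UNIV. (T $ i + axis i 1) $ j * p $ j)"
    by (rule linearI) (simp_all add: vec_eq_iff distrib_left sum.distrib scaleR_sum_right)
  then have lin: "linear F"
    unfolding F_def[abs_def] linear_conv_bounded_linear
    by (intro bounded_linear_Pair linear_defect[unfolded linear_conv_bounded_linear])
  have "inj F"
    unfolding linear_injective_0[OF lin]
  proof (intro allI impI)
    fix p assume Fp: "F p = 0"
    then have "kirchhoff (\<lambda>j. p $ j * of_real (\<phi> j 0)) (\<lambda>j. p $ j * of_real (\<phi>1 j 0))"
      unfolding kirchhoff_iff_defect F_def by (simp add: zero_prod_def)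
    then have p: "p \<in> outer" unfolding outer_def kirchhoff_def by blast
    have 1: "(\<Sum>j\<in>UNIV. (T $ i + axis i 1) $ j * p $ j) = 0" for i
      using Fp by (simp add: F_def zero_prod_def vec_eq_iff)
    have 2: "(\<Sum>j\<in>UNIV. p $ j * (T $ i $ j - axis i 1 $ j)) = 0" for i
      by (rule limit_scattering(2)[OF p])
    have "p $ i = 0" for i
    proof -
      have "2 * p $ i = (\<Sum>j\<in>UNIV. 2 * axis i 1 $ j * p $ j)"
        by (simp add: axis_def if_distrib[of "\<lambda>x. 2 * x * _"] cong: if_cong)
      also have "\<dots> = (\<Sum>j\<in>UNIV. (T $ i + axis i 1) $ j * p $ j) - (\<Sum>j\<in>UNIV. p $ j * (T $ i $ j - axis i 1 $ j))"
        unfolding sum_subtractf[symmetric] by (intro sum.cong) (simp_all add: algebra_simps)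
      finally show ?thesis using 1[of i] 2[of i] by simp
    qed
    then show "p = 0" by (simp add: vec_eq_iff)
  qed
  \<comment> \<open>Injectivity made quantitative: \<open>norm (D \<epsilon>)\<close> is at most
    \<open>norm (F (D \<epsilon>)) / B\<close>.\<close>
  then obtain B where B: "B > 0" "\<And>p. B * norm p \<le> norm (F p)"
    using linear_inj_bounded_below_pos[OF lin] by blast
  have "((\<lambda>\<epsilon>. F (D \<epsilon>)) \<longlongrightarrow> (0, 0)) (at_right 0)"
    unfolding F_def
  proof (intro tendsto_Pair vec_tendstoI)
    fix i :: 3
    show "((\<lambda>\<epsilon>. defect (\<lambda>j. D \<epsilon> $ j * of_real (\<phi> j 0)) (\<lambda>j. D \<epsilon> $ j * of_real (\<phi>1 j 0)) $ i)
        \<longlongrightarrow> 0 $ i) (at_right 0)"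
      using exhaust_3[of i] D1[of 1 2] D1[of 2 3] D2 by (auto simp: defect_def)
    show "((\<lambda>\<epsilon>. (\<chi> i. \<Sum>j\<in>UNIV. (T $ i + axis i 1) $ j * D \<epsilon> $ j) $ i) \<longlongrightarrow> 0 $ i) (at_right 0)"
      using D3[OF limit_scattering(1)[of i]] by simp
  qed
  then have "((\<lambda>\<epsilon>. norm (F (D \<epsilon>)) / B) \<longlongrightarrow> 0) (at_right 0)"
    using tendsto_divide[OF tendsto_norm tendsto_const, of _ "(0, 0)" _ B] B(1)
    by fastforce
  then have "(D \<longlongrightarrow> 0) (at_right 0)"
    by (rule Lim_null_comparison[rotated]) (use B in \<open>auto simp: field_simps\<close>)
  then have "((\<lambda>\<epsilon>. D \<epsilon> $ m) \<longlongrightarrow> 0 $ m) (at_right 0)" by (rule tendsto_vec_nth)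
  then show ?thesis by (simp add: D_def LIM_zero_iff)
qed

end

theorem theorem2p1:
  fixes Q :: "real star_fun" and k \<alpha> :: real
  assumes "smooth_on_Omega Q"
    and "\<exists>j. \<exists>s\<in>{0..1}. Q j s \<noteq> 0"
    and "integral_Omega Q = 0"
    and "k > 0"
  shows "\<forall>n m. ((\<lambda>\<epsilon>. scattering_matrix_eps Q \<alpha> \<epsilon> k $ n $ m) \<longlongrightarrow>
                  scattering_matrix Q \<alpha> k $ n $ m) (at_right 0)"
proof -
  have Q: "continuous_on {0..1} (Q j)" for j
    using assms(1) unfolding smooth_on_Omega_def by (metis DERIV_continuous_on)
  then have q: "continuous_on {0..1} (\<lambda>s. \<alpha> * Q j s)" for j
    by (intro continuous_intros)
  have "\<forall>j. \<exists>\<phi> \<phi>1. \<phi> 1 = 1 \<and> \<phi>1 1 = 0 \<and>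
      edge_solution (\<lambda>s. \<alpha> * Q j s) (\<lambda>s. of_real (\<phi> s)) (\<lambda>s. of_real (\<phi>1 s))"
    using real_edge_solution_exists[OF q] by metis
  then obtain \<phi> \<phi>1 where "\<And>j. \<phi> j 1 = 1" "\<And>j. \<phi>1 j 1 = 0"
    "\<And>j. edge_solution (\<lambda>s. \<alpha> * Q j s) (\<lambda>s. of_real (\<phi> j s)) (\<lambda>s. of_real (\<phi>1 j s))"
    by metis
  then interpret scattering Q \<alpha> \<phi> \<phi>1 k
    by unfold_locales (use q Q assms(4) in auto)
  show ?thesis using scattering_matrix_tendsto by blast
qed

end
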